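(* Let $K$ be a countable subfield of $\mathbb{R}$. Then $(\mathcal{H}_{bac}(\mathcal{C},\mu_K),\tau_{ac})$ is Roelcke precompact.
   Context: $\mathcal{C}$ is the Cantor space. For a countable subfield $K\subseteq\mathbb{R}$, let $\mathbb{B}_K$ be the Fraïssé limit of the class of all finite Boolean algebras equipped with finitely additive, strictly positive (on nonzero elements) probability measures with values in $K\cap[0,1]$ (embeddings being measure-preserving Boolean algebra embeddings). By Stone duality the underlying Boolean algebra of $\mathbb{B}_K$ is identified with the algebra of clopen subsets of $\mathcal{C}$, and the measure of $\mathbb{B}_K$ extends uniquely to a Borel probability measure $\mu_K$ on $\mathcal{C}$. For a finite Borel measure $\mu$ on a compact metrizable space $X$, $\mathcal{H}_{bac}(X,\mu)$ is the group of all homeomorphisms $g$ of $X$ such that for every Borel set $A$ one has $\mu(A)=0$ iff $\mu(g(A))=0$. For $g\in\mathcal{H}_{bac}(X,\mu)$, $\mathcal{D}(g)\in L^1(X,\mu)$ is the Radon–Nikodym derivative of $A\mapsto\mu(g(A))$ with respect to $\mu$, and $\rho_{ac}(g,h):=\|\mathcal{D}(g)-\mathcal{D}(h)\|_{L^1(X,\mu)}$. $\tau_{ac}$ is the topology on $\mathcal{H}_{bac}(X,\mu)$ generated by the restriction of the compact-open topology together with the topology induced by $\rho_{ac}$. A topological group $G$ is Roelcke precompact if for every neighborhood $\mathcal{V}$ of the identity there are finitely many $g_1,\dots,g_r\in G$ with $G=\bigcup_{l=1}^r\mathcal{V}g_l\mathcal{V}$. *)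

theory Defs
  imports "HOL-Analysis.Analysis" "HOL-Probability.Probability_Measure" "HOL-Algebra.Coset"
begin

definition real_subfield :: "real set \<Rightarrow> bool" where
  "real_subfield K \<longleftrightarrow>
     0 \<in> K \<and> 1 \<in> K \<and>
     (\<forall>x\<in>K. \<forall>y\<in>K. x + y \<in> K \<and> x * y \<in> K) \<and>
     (\<forall>x\<in>K. - x \<in> K) \<and>
     (\<forall>x\<in>K. x \<noteq> 0 \<longrightarrow> inverse x \<in> K)"


section \<open>Boolean algebras with a measure\<close>

record 'a ba = "'a partial_object" +
  ba_meet :: "'a \<Rightarrow> 'a \<Rightarrow> 'a"
  ba_join :: "'a \<Rightarrow> 'a \<Rightarrow> 'a"
  ba_compl :: "'a \<Rightarrow> 'a"
  ba_bot :: 'a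
  ba_top :: 'a

record 'a mba = "'a ba" +
  ba_meas :: "'a \<Rightarrow> real"

text \<open>Closure of a set under the Boolean operations. Only meaningful for subsets of the carrier.\<close>

definition ba_closed :: "('a, 'm) ba_scheme \<Rightarrow> 'a set \<Rightarrow> bool" where
  "ba_closed B S \<longleftrightarrow>
     ba_bot B \<in> S \<and> ba_top B \<in> S \<and>
     (\<forall>x\<in>S. \<forall>y\<in>S. ba_meet B x y \<in> S \<and> ba_join B x y \<in> S) \<and>
     (\<forall>x\<in>S. ba_compl B x \<in> S)"

definition boolean_alg :: "('a, 'm) ba_scheme \<Rightarrow> bool" where
  "boolean_alg B \<longleftrightarrow>
     ba_closed B (carrier B) \<and>
     (\<forall>x\<in>carrier B. \<forall>y\<in>carrier B. \<forall>z\<in>carrier B.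
        ba_meet B (ba_meet B x y) z = ba_meet B x (ba_meet B y z) \<and>
        ba_join B (ba_join B x y) z = ba_join B x (ba_join B y z) \<and>
        ba_meet B x (ba_join B y z) = ba_join B (ba_meet B x y) (ba_meet B x z) \<and>
        ba_join B x (ba_meet B y z) = ba_meet B (ba_join B x y) (ba_join B x z)) \<and>
     (\<forall>x\<in>carrier B. \<forall>y\<in>carrier B.
        ba_meet B x y = ba_meet B y x \<and> ba_join B x y = ba_join B y x) \<and>
     (\<forall>x\<in>carrier B.
        ba_meet B x (ba_top B) = x \<and> ba_join B x (ba_bot B) = x \<and>
        ba_meet B x (ba_compl B x) = ba_bot B \<and> ba_join B x (ba_compl B x) = ba_top B)"

text \<open>Strictly positive, finitely additive probability measure with values in \<open>K \<inter> [0,1]\<close>.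
  Additivity gives the value 0 at the bottom element, so the algebra is nondegenerate.\<close>

definition measured_ba :: "real set \<Rightarrow> ('a, 'm) mba_scheme \<Rightarrow> bool" where
  "measured_ba K B \<longleftrightarrow>
     boolean_alg B \<and>
     (\<forall>x\<in>carrier B. ba_meas B x \<in> K \<inter> {0..1}) \<and>
     ba_meas B (ba_top B) = 1 \<and>
     (\<forall>x\<in>carrier B. \<forall>y\<in>carrier B. ba_meet B x y = ba_bot B \<longrightarrow>
        ba_meas B (ba_join B x y) = ba_meas B x + ba_meas B y) \<and>
     (\<forall>x\<in>carrier B. x \<noteq> ba_bot B \<longrightarrow> ba_meas B x > 0)"

definition finite_measured_ba :: "real set \<Rightarrow> ('a, 'm) mba_scheme \<Rightarrow> bool" where
  "finite_measured_ba K B \<longleftrightarrow> measured_ba K B \<and> finite (carrier B)"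

definition ba_embedding ::
    "('a, 'm) ba_scheme \<Rightarrow> ('b, 'n) ba_scheme \<Rightarrow> ('a \<Rightarrow> 'b) \<Rightarrow> bool" where
  "ba_embedding A B f \<longleftrightarrow>
     f \<in> carrier A \<rightarrow> carrier B \<and> inj_on f (carrier A) \<and>
     f (ba_bot A) = ba_bot B \<and> f (ba_top A) = ba_top B \<and>
     (\<forall>x\<in>carrier A. \<forall>y\<in>carrier A.
        f (ba_meet A x y) = ba_meet B (f x) (f y) \<and>
        f (ba_join A x y) = ba_join B (f x) (f y)) \<and>
     (\<forall>x\<in>carrier A. f (ba_compl A x) = ba_compl B (f x))"

definition ba_iso ::
    "('a, 'm) ba_scheme \<Rightarrow> ('b, 'n) ba_scheme \<Rightarrow> ('a \<Rightarrow> 'b) \<Rightarrow> bool" where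
  "ba_iso A B f \<longleftrightarrow> ba_embedding A B f \<and> f ` carrier A = carrier B"

definition mba_embedding ::
    "('a, 'm) mba_scheme \<Rightarrow> ('b, 'n) mba_scheme \<Rightarrow> ('a \<Rightarrow> 'b) \<Rightarrow> bool" where
  "mba_embedding A B f \<longleftrightarrow>
     ba_embedding A B f \<and> (\<forall>x\<in>carrier A. ba_meas B (f x) = ba_meas A x)"

definition mba_iso ::
    "('a, 'm) mba_scheme \<Rightarrow> ('b, 'n) mba_scheme \<Rightarrow> ('a \<Rightarrow> 'b) \<Rightarrow> bool" where
  "mba_iso A B f \<longleftrightarrow> mba_embedding A B f \<and> f ` carrier A = carrier B"

definition generated_sub :: "('a, 'm) ba_scheme \<Rightarrow> 'a set \<Rightarrow> ('a, 'm) ba_scheme" where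
  "generated_sub M X =
     M\<lparr>carrier := \<Inter>{S. X \<subseteq> S \<and> S \<subseteq> carrier M \<and> ba_closed M S}\<rparr>"

text \<open>\<open>M\<close> is a Fraisse limit of the class of finite measured Boolean algebras over \<open>K\<close>:
  a countable ultrahomogeneous structure whose age is that class. Every finite structure
  is isomorphic to one whose carrier is a set of natural numbers, so the quantifier over
  \<^typ>\<open>nat mba\<close> ranges over the whole class up to isomorphism.\<close>

definition fraisse_limit :: "real set \<Rightarrow> 'a mba \<Rightarrow> bool" where
  "fraisse_limit K M \<longleftrightarrow>
     measured_ba K M \<and> countable (carrier M) \<and>
     (\<forall>X. finite X \<and> X \<subseteq> carrier M \<longrightarrow> finite_measured_ba K (generated_sub M X)) \<and>
     (\<forall>A :: nat mba. finite_measured_ba K A \<longrightarrow> (\<exists>f. mba_embedding A M f)) \<and>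
     (\<forall>X Y f. finite X \<and> X \<subseteq> carrier M \<and> finite Y \<and> Y \<subseteq> carrier M \<and>
        mba_iso (generated_sub M X) (generated_sub M Y) f \<longrightarrow>
        (\<exists>h. mba_iso M M h \<and> (\<forall>x\<in>carrier (generated_sub M X). h x = f x)))"

definition clopen_algebra :: "'a::topological_space set ba" where
  "clopen_algebra =
     \<lparr>carrier = {U. open U \<and> closed U}, ba_meet = (\<inter>), ba_join = (\<union>),
      ba_compl = uminus, ba_bot = {}, ba_top = UNIV\<rparr>"

text \<open>\<open>\<mu>\<close> is a Borel probability measure extending the measure of \<open>B\<close>, transported to the
  clopen algebra along the isomorphism \<open>\<phi>\<close>. Such an identification is not canonical.\<close>

definition borel_extension ::
    "'b mba \<Rightarrow> ('b \<Rightarrow> 'a::topological_space set) \<Rightarrow> 'a measure \<Rightarrow> bool" where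
  "borel_extension B \<phi> \<mu> \<longleftrightarrow>
     ba_iso B clopen_algebra \<phi> \<and>
     sets \<mu> = sets borel \<and> prob_space \<mu> \<and>
     (\<forall>b\<in>carrier B. measure \<mu> (\<phi> b) = ba_meas B b)"

type_synonym cantor = "nat \<Rightarrow> bool"


section \<open>The group of bi-absolutely continuous homeomorphisms\<close>

definition H_bac :: "'a::topological_space measure \<Rightarrow> ('a \<Rightarrow> 'a) set" where
  "H_bac \<mu> =
     {g. (\<exists>h. homeomorphism UNIV UNIV g h) \<and>
         (\<forall>A\<in>sets borel. emeasure \<mu> A = 0 \<longleftrightarrow> emeasure \<mu> (g ` A) = 0)}"

definition H_bac_group :: "'a::topological_space measure \<Rightarrow> ('a \<Rightarrow> 'a) monoid" where
  "H_bac_group \<mu> = \<lparr>carrier = H_bac \<mu>, mult = (\<circ>), one = id\<rparr>"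

text \<open>For a homeomorphism \<open>g\<close>, the preimage of \<open>A\<close> under the inverse of \<open>g\<close> is \<open>g ` A\<close>,
  so the distribution below is the measure sending \<open>A\<close> to \<open>\<mu> (g ` A)\<close>.\<close>

definition RN_D :: "'a::topological_space measure \<Rightarrow> ('a \<Rightarrow> 'a) \<Rightarrow> 'a \<Rightarrow> real" where
  "RN_D \<mu> g = (\<lambda>x. enn2real (RN_deriv \<mu> (distr \<mu> borel (inv_into UNIV g)) x))"

definition rho_ac :: "'a::topological_space measure \<Rightarrow> ('a \<Rightarrow> 'a) \<Rightarrow> ('a \<Rightarrow> 'a) \<Rightarrow> real" where
  "rho_ac \<mu> g h = (\<integral>x. \<bar>RN_D \<mu> g x - RN_D \<mu> h x\<bar> \<partial>\<mu>)"

definition compact_open_topology :: "('a::topological_space \<Rightarrow> 'b::topological_space) topology" where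
  "compact_open_topology =
     subtopology (topology_generated_by {{f. f ` C \<subseteq> U} | C U. compact C \<and> open U})
       {f. continuous_on UNIV f}"

definition rho_ac_topology :: "'a::topological_space measure \<Rightarrow> ('a \<Rightarrow> 'a) topology" where
  "rho_ac_topology \<mu> =
     topology_generated_by {{h \<in> H_bac \<mu>. rho_ac \<mu> g h < \<epsilon>} | g \<epsilon>. g \<in> H_bac \<mu> \<and> \<epsilon> > 0}"

definition tau_ac :: "'a::topological_space measure \<Rightarrow> ('a \<Rightarrow> 'a) topology" where
  "tau_ac \<mu> =
     topology_generated_by
       ({U. openin (subtopology compact_open_topology (H_bac \<mu>)) U} \<union>
        {U. openin (rho_ac_topology \<mu>) U})"


section \<open>Roelcke precompactness\<close>

definition topological_group :: "('g, 'm) monoid_scheme \<Rightarrow> 'g topology \<Rightarrow> bool" where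
  "topological_group G T \<longleftrightarrow>
     group G \<and> topspace T = carrier G \<and>
     continuous_map (prod_topology T T) T (\<lambda>(x, y). x \<otimes>\<^bsub>G\<^esub> y) \<and>
     continuous_map T T (\<lambda>x. inv\<^bsub>G\<^esub> x)"

definition roelcke_precompact :: "('g, 'm) monoid_scheme \<Rightarrow> 'g topology \<Rightarrow> bool" where
  "roelcke_precompact G T \<longleftrightarrow>
     topological_group G T \<and>
     (\<forall>V U. openin T U \<and> \<one>\<^bsub>G\<^esub> \<in> U \<and> U \<subseteq> V \<and> V \<subseteq> carrier G \<longrightarrow>
        (\<exists>F. finite F \<and> F \<subseteq> carrier G \<and>
             carrier G = (\<Union>g\<in>F. (V #>\<^bsub>G\<^esub> g) <#>\<^bsub>G\<^esub> V)))"

end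

theory Submission
  imports Defs
begin

text \<open>
  Write \<open>m\<close> for the measure \<open>\<mu>\<close> and consider homeomorphisms \<open>g\<close> up to two things: their action on
  the cylinders of a fixed level, and the measures \<open>m (g ` A)\<close> of the images of Borel sets, uniformly
  in \<open>A\<close> with an error \<open>e\<close>. Since the \<open>L\<^sup>1\<close> distance of two derivatives is, up to a factor of two, the
  largest difference of the measures of images, the elements that agree with the identity in this
  sense form a basis of neighbourhoods of the identity (\<open>openin_tau_ac_iff\<close>). The distance is invariant
  under right translations; together with continuity of left translations (\<open>near_comp_leftE\<close>) this
  yields a topological group.

  Apart from positivity of the measure on clopen sets, the Fraisse limit enters through a single
  property: every proportion in which one clopen set can be divided into clopen parts occurs in every
  other nonempty clopen set. It follows from the age together with ultrahomogeneity, and from the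
  field operations of \<open>K\<close>. By back-and-forth, every bijection between the nonempty pieces of two
  finite clopen partitions is then induced by a homeomorphism that multiplies the measure by a
  constant on each piece (\<open>exists_scaling\<close>).

  Let \<open>V\<close> be a neighbourhood of the identity as above. The derivative of \<open>g\<close> is close in \<open>L\<^sup>1\<close> to its
  conditional expectation with respect to small cylinders (\<open>conditional_expectation_approx\<close>), so up to
  \<open>V\<close> one may think of \<open>g\<close> as a map that scales the measure by a constant on each small cylinder. There
  are many cylinders, and the constants are unbounded. However, cylinders with similar constants, with
  the same position, and with the same position of their images can be merged. Merging
  constants that are at most one changes the measures of the images by little, which is a correction
  by \<open>V\<close> on the left; merging constants above one changes the measures of the preimages by little,
  which is a correction by \<open>V\<close> on the right (\<open>blockwise_scaling_in_double_coset\<close>). Thus a small part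
  of the space that \<open>g\<close> blows up by a huge factor causes no trouble: its precise size is invisible to
  \<open>V g V\<close>. What remains is a number of pieces that is bounded in terms of \<open>V\<close> alone. Two maps whose
  pieces occupy the same positions and have nearly the same measures, as do their images, lie in the
  same double coset (\<open>similar_blockwise_scalings\<close>), and rounding the measures leaves finitely many
  cases.
\<close>

section \<open>Cylinders and clopen sets of the Cantor space\<close>

abbreviation clopen :: "'a::topological_space set \<Rightarrow> bool" where
  "clopen U \<equiv> open U \<and> closed U"

definition cyl :: "nat \<Rightarrow> cantor \<Rightarrow> cantor set" where
  "cyl n x = {y. \<forall>i<n. y i = x i}"

definition cyls :: "nat \<Rightarrow> cantor set set" where
  "cyls n = range (cyl n)"

lemma self_in_cyl: "x \<in> cyl n x"
  by (simp add: cyl_def)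

lemma cyl_eq_if_in: "y \<in> cyl n x \<Longrightarrow> cyl n y = cyl n x"
  by (auto simp: cyl_def)

lemma open_coordinate: "open {y :: cantor. y i = b}"
proof -
  have "continuous_on UNIV (\<lambda>y :: cantor. y i)"
    by simp
  then have "open ((\<lambda>y :: cantor. y i) -` {b})"
    by (intro open_vimage) (auto simp: open_discrete)
  then show ?thesis
    by (simp add: vimage_def)
qed

lemma clopen_coordinate: "clopen {y :: cantor. y i = b}"
proof -
  have "- {y :: cantor. y i = b} = {y. y i = (\<not> b)}"
    by auto
  then show ?thesis
    using open_coordinate[of i b] open_coordinate[of i "\<not> b"]
    by (simp add: closed_def)
qed

lemma clopen_cyl: "clopen (cyl n x)"
proof -
  have "cyl n x = (\<Inter>i\<in>{..<n}. {y. y i = x i})"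
    by (auto simp: cyl_def)
  then show ?thesis
    using clopen_coordinate by (auto intro!: open_INT closed_INT)
qed

lemma finite_cyls: "finite (cyls n)"
proof -
  have "cyl n x \<in> (\<lambda>S. cyl n (\<lambda>i. i \<in> S)) ` Pow {..<n}" for x
    by (rule image_eqI[of _ _ "{i. i < n \<and> x i}"]) (auto simp: cyl_def)
  then have "cyls n \<subseteq> (\<lambda>S. cyl n (\<lambda>i. i \<in> S)) ` Pow {..<n}"
    unfolding cyls_def by auto
  then show ?thesis
    by (rule finite_subset) simp
qed

lemma Union_cyls: "\<Union>(cyls n) = UNIV"
  using self_in_cyl by (auto simp: cyls_def)

lemma disjoint_cyls: "Q \<in> cyls n \<Longrightarrow> Q' \<in> cyls n \<Longrightarrow> Q \<noteq> Q' \<Longrightarrow> Q \<inter> Q' = {}"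
  unfolding cyls_def using cyl_eq_if_in by (metis disjoint_iff rangeE)

lemma cyls_clopen: "Q \<in> cyls n \<Longrightarrow> clopen Q"
  using clopen_cyl by (auto simp: cyls_def)

lemma cyls_nonempty: "Q \<in> cyls n \<Longrightarrow> Q \<noteq> {}"
  using self_in_cyl by (auto simp: cyls_def)

lemma cyl_antimono: "m \<le> n \<Longrightarrow> cyl n x \<subseteq> cyl m x"
  by (auto simp: cyl_def)

lemma compact_UNIV_cantor: "compact (UNIV :: cantor set)"
proof -
  have "compact_space (product_topology (\<lambda>_. euclidean) (UNIV :: nat set) :: cantor topology)"
    unfolding compact_space_product_topology
    by (simp add: compact_space_def finite_imp_compact)
  then show ?thesis
    by (simp add: euclidean_product_topology compact_space_def)
qed

lemma open_contains_cyl: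
  assumes "open U" "x \<in> U"
  shows "\<exists>n. cyl n x \<subseteq> U"
proof -
  have "openin (product_topology (\<lambda>_. euclidean) UNIV) U"
    using assms(1) unfolding open_fun_def by simp
  from product_topology_open_contains_basis[OF this assms(2)]
  obtain X where X: "x \<in> Pi\<^sub>E UNIV X" "finite {i. X i \<noteq> UNIV}" "Pi\<^sub>E UNIV X \<subseteq> U"
    by auto
  obtain n where n: "\<forall>i\<in>{i. X i \<noteq> UNIV}. i < n"
    using X(2) finite_nat_set_iff_bounded by auto
  have "cyl n x \<subseteq> Pi\<^sub>E UNIV X"
  proof
    fix y assume y: "y \<in> cyl n x"
    have "y i \<in> X i" for i
    proof (cases "X i = UNIV")
      case False
      then have "i < n" using n by blast
      then show ?thesis using y X(1) by (auto simp: cyl_def PiE_iff)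
    qed auto
    then show "y \<in> Pi\<^sub>E UNIV X" by (auto simp: PiE_iff)
  qed
  then show ?thesis using X(3) by blast
qed

text \<open>Compactness replaces a level that depends on the point by one level for all of \<open>C\<close>. Every
  passage from clopen sets to cylinders of a fixed level rests on this.\<close>

lemma compact_in_open_uniform:
  assumes "compact C" "open U" "C \<subseteq> U"
  shows "\<exists>n. \<forall>x\<in>C. cyl n x \<subseteq> U"
proof -
  have "\<forall>x\<in>C. \<exists>n. cyl n x \<subseteq> U"
    using open_contains_cyl assms(2,3) by blast
  then obtain n where n: "\<And>x. x \<in> C \<Longrightarrow> cyl (n x) x \<subseteq> U" by metis
  obtain D where D: "D \<subseteq> C" "finite D" "C \<subseteq> (\<Union>x\<in>D. cyl (n x) x)"
    using assms(1) by (rule compactE_image[of C C "\<lambda>x. cyl (n x) x"])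
      (auto simp: clopen_cyl self_in_cyl)
  define m where "m = Max (insert 0 (n ` D))"
  have "cyl m y \<subseteq> U" if y: "y \<in> C" for y
  proof -
    obtain x where x: "x \<in> D" "y \<in> cyl (n x) x" using D y by blast
    then have "n x \<le> m" using D(2) by (auto simp: m_def)
    then have "cyl m y \<subseteq> cyl (n x) y" by (rule cyl_antimono)
    then show ?thesis using cyl_eq_if_in[OF x(2)] n x D(1) by blast
  qed
  then show ?thesis by blast
qed

definition decided :: "nat \<Rightarrow> cantor set \<Rightarrow> bool" where
  "decided n U \<longleftrightarrow> (\<forall>x\<in>U. cyl n x \<subseteq> U)"

lemma decided_mono: "decided m U \<Longrightarrow> m \<le> n \<Longrightarrow> decided n U"
  using cyl_antimono unfolding decided_def by blast

lemma clopen_decided: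
  assumes "clopen U"
  shows "\<exists>n. decided n U"
proof -
  have "compact U"
    using compact_UNIV_cantor assms closed_Int_compact[of U UNIV] by simp
  then show ?thesis
    using compact_in_open_uniform[of U U] assms unfolding decided_def by blast
qed

lemma finite_clopens_decided:
  assumes "finite F" "\<forall>U\<in>F. clopen U"
  shows "\<exists>n. \<forall>U\<in>F. decided n U"
  using assms
proof (induction F)
  case (insert U F)
  then obtain n m where "\<forall>U\<in>F. decided n U" "decided m U"
    using clopen_decided by blast
  then have "\<forall>V\<in>insert U F. decided (max n m) V"
    using decided_mono by (metis insert_iff max.cobounded1 max.cobounded2)
  then show ?case by blast
qed simp

lemma decided_Union: "decided n U \<Longrightarrow> U = \<Union>{Q\<in>cyls n. Q \<subseteq> U}"
  unfolding decided_def cyls_def using self_in_cyl by blast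

text \<open>Through this interpolation the compact-open topology on homeomorphisms is described by the
  action on clopen sets alone.\<close>

lemma clopen_between:
  assumes "compact C" "open U" "C \<subseteq> (U :: cantor set)"
  shows "\<exists>W. clopen W \<and> C \<subseteq> W \<and> W \<subseteq> U"
proof -
  obtain n where n: "\<forall>x\<in>C. cyl n x \<subseteq> U" using compact_in_open_uniform[OF assms] by blast
  define W where "W = \<Union>(cyl n ` C)"
  have "finite (cyl n ` C)" by (rule finite_subset[OF _ finite_cyls[of n]]) (auto simp: cyls_def)
  then have "clopen W" unfolding W_def using clopen_cyl by auto
  moreover have "C \<subseteq> W" "W \<subseteq> U" using n self_in_cyl by (auto simp: W_def)
  ultimately show ?thesis by blast
qed

text \<open>An open set is the countable union, over all levels, of the cylinders contained in it.\<close>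

lemma sets_borel_clopen: "sets (borel :: cantor measure) = sigma_sets UNIV {U. clopen U}"
proof -
  have "U \<in> sigma_sets UNIV {U. clopen U}" if "open U" for U :: "cantor set"
  proof -
    have eq: "(\<Union>n. \<Union>{Q\<in>cyls n. Q \<subseteq> U}) = U"
    proof
      show "U \<subseteq> (\<Union>n. \<Union>{Q\<in>cyls n. Q \<subseteq> U})"
      proof
        fix x assume "x \<in> U"
        then obtain n where "cyl n x \<subseteq> U" using open_contains_cyl \<open>open U\<close> by blast
        then show "x \<in> (\<Union>n. \<Union>{Q\<in>cyls n. Q \<subseteq> U})"
          using self_in_cyl[of x n] by (auto simp: cyls_def)
      qed
    qed blast
    moreover have "(\<Union>n. \<Union>{Q\<in>cyls n. Q \<subseteq> U}) \<in> sigma_sets UNIV {U. clopen U}"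
    proof (rule sigma_sets.Union)
      fix n
      have "clopen (\<Union>{Q\<in>cyls n. Q \<subseteq> U})"
        using finite_cyls[of n] cyls_clopen by (auto intro!: closed_Union open_Union)
      then show "\<Union>{Q\<in>cyls n. Q \<subseteq> U} \<in> sigma_sets UNIV {U. clopen U}"
        by (intro sigma_sets.Basic) simp
    qed
    ultimately show ?thesis unfolding eq by simp
  qed
  then have "sigma_sets UNIV {U :: cantor set. open U} \<subseteq> sigma_sets UNIV {U. clopen U}"
    by (intro sigma_sets_mono) auto
  moreover have "sigma_sets UNIV {U :: cantor set. clopen U} \<subseteq> sigma_sets UNIV {U. open U}"
    by (intro sigma_sets_mono) auto
  ultimately show ?thesis
    unfolding borel_def by auto
qed

section \<open>Matchings between clopen partitions\<close>

text \<open>A prescription of which piece is to be sent onto which. As a set of pairs it can be read in both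
  directions: its converse is again a matching, which is what a back-and-forth argument exchanges.\<close>

definition matching :: "(cantor set \<times> cantor set) set \<Rightarrow> cantor set \<Rightarrow> cantor set \<Rightarrow> bool" where
  "matching R A B \<longleftrightarrow>
     finite R \<and>
     (\<forall>r\<in>R. clopen (fst r) \<and> clopen (snd r) \<and> fst r \<noteq> {} \<and> snd r \<noteq> {}) \<and>
     (\<forall>r\<in>R. \<forall>r'\<in>R. r \<noteq> r' \<longrightarrow> fst r \<inter> fst r' = {} \<and> snd r \<inter> snd r' = {}) \<and>
     \<Union>(fst ` R) = A \<and> \<Union>(snd ` R) = B"

lemma matchingI:
  assumes "finite R"
    and "\<And>P Q. (P, Q) \<in> R \<Longrightarrow> clopen P \<and> clopen Q \<and> P \<noteq> {} \<and> Q \<noteq> {}"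
    and "\<And>r r'. r \<in> R \<Longrightarrow> r' \<in> R \<Longrightarrow> r \<noteq> r' \<Longrightarrow> fst r \<inter> fst r' = {}"
    and "\<And>r r'. r \<in> R \<Longrightarrow> r' \<in> R \<Longrightarrow> r \<noteq> r' \<Longrightarrow> snd r \<inter> snd r' = {}"
    and "(\<Union>r\<in>R. fst r) = A" "(\<Union>r\<in>R. snd r) = B"
  shows "matching R A B"
  unfolding matching_def using assms(1,3,4,5,6) assms(2)[OF prod.collapse[THEN ssubst, of "\<lambda>r. r \<in> R"]]
  by simp

lemma matching_finite: "matching R A B \<Longrightarrow> finite R"
  by (simp add: matching_def)

lemma matching_piece:
  assumes "matching R A B" "r \<in> R"
  shows "clopen (fst r)" "clopen (snd r)" "fst r \<noteq> {}" "snd r \<noteq> {}" "fst r \<subseteq> A" "snd r \<subseteq> B"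
  using assms by (auto simp: matching_def)

lemma matching_disjoint:
  assumes "matching R A B" "r \<in> R" "r' \<in> R" "r \<noteq> r'"
  shows "fst r \<inter> fst r' = {}" "snd r \<inter> snd r' = {}"
  using assms by (simp_all add: matching_def)

lemma matching_cover:
  assumes "matching R A B"
  shows "(\<Union>r\<in>R. fst r) = A" "(\<Union>r\<in>R. snd r) = B"
  using assms by (simp_all add: matching_def)

lemma matching_converse:
  assumes R: "matching R A B"
  shows "matching (R\<inverse>) B A"
proof (rule matchingI)
  show "finite (R\<inverse>)" using matching_finite[OF R] by simp
  show "clopen P \<and> clopen Q \<and> P \<noteq> {} \<and> Q \<noteq> {}" if "(P, Q) \<in> R\<inverse>" for P Q
    using matching_piece[OF R, of "(Q, P)"] that by simp
  fix r r' assume r: "r \<in> R\<inverse>" "r' \<in> R\<inverse>" "r \<noteq> r'"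
  have "prod.swap r \<in> R" "prod.swap r' \<in> R" "prod.swap r \<noteq> prod.swap r'"
    using r by (auto simp: prod_eq_iff)
  from matching_disjoint[OF R this]
  show "fst r \<inter> fst r' = {}" "snd r \<inter> snd r' = {}" by simp_all
next
  show "(\<Union>r\<in>R\<inverse>. fst r) = B" using matching_cover(2)[OF R] by force
  show "(\<Union>r\<in>R\<inverse>. snd r) = A" using matching_cover(1)[OF R] by force
qed

lemma matching_unique_fst:
  "matching R A B \<Longrightarrow> r \<in> R \<Longrightarrow> r' \<in> R \<Longrightarrow> x \<in> fst r \<Longrightarrow> x \<in> fst r' \<Longrightarrow> r = r'"
  using matching_disjoint(1) by (metis disjoint_iff)

lemma matching_Union:
  assumes R: "matching R A B" and S: "\<And>r. r \<in> R \<Longrightarrow> matching (S r) (fst r) (snd r)"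
  shows "matching (\<Union>r\<in>R. S r) A B"
proof (rule matchingI)
  show "finite (\<Union>r\<in>R. S r)"
    using matching_finite[OF R] matching_finite[OF S] by blast
  show "clopen P \<and> clopen Q \<and> P \<noteq> {} \<and> Q \<noteq> {}" if "(P, Q) \<in> (\<Union>r\<in>R. S r)" for P Q
    using that matching_piece[OF S, of _ "(P, Q)"] by auto
  fix s s' assume s: "s \<in> (\<Union>r\<in>R. S r)" "s' \<in> (\<Union>r\<in>R. S r)" "s \<noteq> s'"
  obtain r r' where r: "r \<in> R" "s \<in> S r" "r' \<in> R" "s' \<in> S r'" using s by blast
  have "fst s \<inter> fst s' = {} \<and> snd s \<inter> snd s' = {}"
  proof (cases "r = r'")
    case True
    then show ?thesis using matching_disjoint[OF S[OF r(1)]] r s(3) by simp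
  next
    case False
    then show ?thesis
      using matching_disjoint[OF R r(1,3)] matching_piece(5,6)[OF S r(2)] matching_piece(5,6)[OF S r(4)] r
      by blast
  qed
  then show "fst s \<inter> fst s' = {}" "snd s \<inter> snd s' = {}" by auto
next
  have "(\<Union>r\<in>(\<Union>r\<in>R. S r). fst r) = (\<Union>r\<in>R. \<Union>s\<in>S r. fst s)" by auto
  also have "\<dots> = (\<Union>r\<in>R. fst r)" using matching_cover(1)[OF S] by simp
  finally show "(\<Union>r\<in>(\<Union>r\<in>R. S r). fst r) = A" using matching_cover(1)[OF R] by simp
  have "(\<Union>r\<in>(\<Union>r\<in>R. S r). snd r) = (\<Union>r\<in>R. \<Union>s\<in>S r. snd s)" by auto
  also have "\<dots> = (\<Union>r\<in>R. snd r)" using matching_cover(2)[OF S] by simp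
  finally show "(\<Union>r\<in>(\<Union>r\<in>R. S r). snd r) = B" using matching_cover(2)[OF R] by simp
qed

lemma cyl_limit_unique:
  assumes "\<And>n. \<exists>z. x \<in> cyl n z \<and> y \<in> cyl n z"
  shows "x = y"
proof
  fix i
  obtain z where "x \<in> cyl (Suc i) z" "y \<in> cyl (Suc i) z" using assms by blast
  then show "x i = y i" by (simp add: cyl_def)
qed

text \<open>The pieces containing a point \<open>x\<close> have partners that decrease; by compactness these have a
  common point, which is the value at \<open>x\<close>. Continuity holds because the partners shrink to points.
  The same lemma for the converse matchings will produce the inverse function.\<close>

lemma limit_of_matchings:
  fixes R :: "nat \<Rightarrow> (cantor set \<times> cantor set) set"
  assumes R: "\<And>n. matching (R n) UNIV UNIV"
    and ref: "\<And>n r'. r' \<in> R (Suc n) \<Longrightarrow> \<exists>r\<in>R n. fst r' \<subseteq> fst r \<and> snd r' \<subseteq> snd r"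
    and small: "\<And>n r. r \<in> R (Suc n) \<Longrightarrow> \<exists>y. snd r \<subseteq> cyl n y"
  shows "\<exists>s. continuous_on UNIV s \<and> (\<forall>n. \<forall>r\<in>R n. s ` fst r \<subseteq> snd r)"
proof -
  have "\<exists>r\<in>R n. x \<in> fst r" for n x
    using matching_cover(1)[OF R[of n]] by blast
  then obtain p where p: "\<And>n x. p n x \<in> R n" "\<And>n x. x \<in> fst (p n x)" by metis
  have p_eq: "p n x = r" if "r \<in> R n" "x \<in> fst r" for n x r
    using matching_unique_fst[OF R p(1) that(1) p(2) that(2)] .
  have "\<exists>y. \<forall>n. y \<in> snd (p n x)" for x
  proof -
    have "snd (p (Suc n) x) \<subseteq> snd (p n x)" for n
    proof -
      obtain r where r: "r \<in> R n" "fst (p (Suc n) x) \<subseteq> fst r" "snd (p (Suc n) x) \<subseteq> snd r"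
        using ref[OF p(1)] by blast
      then have "p n x = r" using p_eq p(2) by blast
      then show ?thesis using r(3) by simp
    qed
    then have "decseq (\<lambda>n. snd (p n x))" by (rule decseq_SucI)
    then have "(\<Inter>n. snd (p n x)) \<noteq> {}"
      using compact_UNIV_cantor matching_piece(2,4)[OF R p(1)]
      by (intro compact_space_imp_nest[of euclidean]) (auto simp: compact_space_def)
    then show ?thesis by blast
  qed
  then obtain s where s: "\<And>x n. s x \<in> snd (p n x)" by metis
  have sub: "s ` fst r \<subseteq> snd r" if "r \<in> R n" for n r
    using s p_eq[OF that] by blast
  have "continuous_on UNIV s"
  proof (subst continuous_on_open_vimage[OF open_UNIV], intro allI impI)
    fix V :: "cantor set" assume V: "open V"
    have "\<exists>T. open T \<and> x \<in> T \<and> T \<subseteq> s -` V \<inter> UNIV" if x: "x \<in> s -` V \<inter> UNIV" for x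
    proof -
      obtain n where n: "cyl n (s x) \<subseteq> V" using open_contains_cyl[OF V] x by blast
      obtain y where y: "snd (p (Suc n) x) \<subseteq> cyl n y" using small[OF p(1)] by blast
      then have "cyl n y = cyl n (s x)" using s cyl_eq_if_in by blast
      then have "fst (p (Suc n) x) \<subseteq> s -` V \<inter> UNIV" using y n sub[OF p(1)[of "Suc n" x]] by blast
      moreover have "open (fst (p (Suc n) x))"
        using matching_piece(1)[OF R p(1)] by blast
      ultimately show ?thesis using p(2) by blast
    qed
    then show "open (s -` V \<inter> UNIV)" by (subst open_subopen) blast
  qed
  then show ?thesis using sub by blast
qed

section \<open>Measures with the same proportions in all clopen sets\<close>

text \<open>The last assumption says that every proportion in which some clopen set can be cut also occurs
  in every other nonempty clopen set. The products express an equality of proportions.\<close>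

locale ratio_measure =
  fixes \<mu> :: "cantor measure"
  assumes sets_mu: "sets \<mu> = sets borel"
    and prob_mu: "prob_space \<mu>"
    and clopen_pos: "\<And>U. clopen U \<Longrightarrow> U \<noteq> {} \<Longrightarrow> measure \<mu> U > 0"
    and split: "\<And>P P' Q. clopen P \<Longrightarrow> clopen P' \<Longrightarrow> P' \<subset> P \<Longrightarrow> P' \<noteq> {} \<Longrightarrow> clopen Q \<Longrightarrow> Q \<noteq> {} \<Longrightarrow>
      \<exists>Q'. clopen Q' \<and> Q' \<subseteq> Q \<and> measure \<mu> Q' * measure \<mu> P = measure \<mu> P' * measure \<mu> Q"
begin

sublocale prob_space \<mu> by (rule prob_mu)

lemma clopen_sets: "clopen U \<Longrightarrow> U \<in> sets \<mu>"
  using sets_mu by auto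

lemma borel_sets: "A \<in> sets borel \<Longrightarrow> A \<in> sets \<mu>"
  using sets_mu by auto

abbreviation m :: "cantor set \<Rightarrow> real" where "m \<equiv> measure \<mu>"

text \<open>A refinement cuts both sides of every pair in the same proportions; hence the factor by which
  the measure changes from the first to the second side is passed on to all smaller pairs.\<close>

definition refines where
  "refines R' R \<longleftrightarrow> (\<forall>r'\<in>R'. \<exists>r\<in>R. fst r' \<subseteq> fst r \<and> snd r' \<subseteq> snd r \<and>
     m (snd r') * m (fst r) = m (fst r') * m (snd r))"

lemma refinesE:
  assumes "refines R' R" "r' \<in> R'"
  obtains r where "r \<in> R" "fst r' \<subseteq> fst r" "snd r' \<subseteq> snd r"
    "m (snd r') * m (fst r) = m (fst r') * m (snd r)"
  using assms unfolding refines_def by blast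

lemma refines_refl: "refines R R"
  unfolding refines_def by (metis mult.commute subset_refl)

lemma refines_trans:
  assumes R: "matching R A B" "matching R' A B" "matching R'' A B" "refines R'' R'" "refines R' R"
  shows "refines R'' R"
  unfolding refines_def
proof
  fix r'' assume r'': "r'' \<in> R''"
  obtain r' where r': "r' \<in> R'" "fst r'' \<subseteq> fst r'" "snd r'' \<subseteq> snd r'"
      "m (snd r'') * m (fst r') = m (fst r'') * m (snd r')"
    using r'' R(4) unfolding refines_def by blast
  obtain r where r: "r \<in> R" "fst r' \<subseteq> fst r" "snd r' \<subseteq> snd r"
      "m (snd r') * m (fst r) = m (fst r') * m (snd r)"
    using r'(1) R(5) unfolding refines_def by blast
  have "m (fst r') > 0" using clopen_pos matching_piece(1,3)[OF R(2) r'(1)] by blast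
  moreover have "m (fst r') * (m (snd r'') * m (fst r)) = m (fst r') * (m (fst r'') * m (snd r))"
  proof -
    have "m (fst r') * (m (snd r'') * m (fst r)) = (m (snd r'') * m (fst r')) * m (fst r)"
      by (simp only: mult_ac)
    also have "\<dots> = m (fst r'') * (m (snd r') * m (fst r))"
      unfolding r'(4) by (simp only: mult_ac)
    also have "\<dots> = m (fst r') * (m (fst r'') * m (snd r))"
      unfolding r(4) by (simp only: mult_ac)
    finally show ?thesis .
  qed
  ultimately have "m (snd r'') * m (fst r) = m (fst r'') * m (snd r)" by simp
  then show "\<exists>r\<in>R. fst r'' \<subseteq> fst r \<and> snd r'' \<subseteq> snd r \<and>
     m (snd r'') * m (fst r) = m (fst r'') * m (snd r)"
    using r r' by blast
qed

lemma refines_converse: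
  assumes "refines R' R"
  shows "refines (R'\<inverse>) (R\<inverse>)"
  unfolding refines_def
proof
  fix r' assume "r' \<in> R'\<inverse>"
  then have "prod.swap r' \<in> R'" by auto
  from refinesE[OF assms this] obtain r where r: "r \<in> R" "snd r' \<subseteq> fst r" "fst r' \<subseteq> snd r"
      "m (fst r') * m (fst r) = m (snd r') * m (snd r)" by auto
  then show "\<exists>r\<in>R\<inverse>. fst r' \<subseteq> fst r \<and> snd r' \<subseteq> snd r \<and>
     m (snd r') * m (fst r) = m (fst r') * m (snd r)"
    by (intro bexI[of _ "prod.swap r"]) (simp_all add: prod.swap_def)
qed

text \<open>The proportion in which \<open>U\<close> cuts the first side is copied to the second side.\<close>

lemma split_piece:
  assumes r: "clopen (fst r)" "clopen (snd r)" "fst r \<noteq> {}" "snd r \<noteq> {}" and U: "clopen U"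
  shows "\<exists>S. matching S (fst r) (snd r) \<and> refines S {r} \<and> (\<forall>s\<in>S. fst s \<subseteq> U \<or> fst s \<inter> U = {})"
proof (cases "fst r \<subseteq> U \<or> fst r \<inter> U = {}")
  case True
  have "matching {r} (fst r) (snd r)" using r by (auto simp: matching_def)
  then show ?thesis using True refines_refl by blast
next
  case False
  define P P' Q where "P = fst r" and "P' = P \<inter> U" and "Q = snd r"
  have P': "P' \<subset> P" "P' \<noteq> {}" "clopen P'" "clopen P" "clopen Q" "Q \<noteq> {}"
    using False r U by (auto simp: P'_def P_def Q_def)
  obtain Q' where Q': "clopen Q'" "Q' \<subseteq> Q" "m Q' * m P = m P' * m Q"
    using split[OF P'(4,3,1,2,5,6)] by blast
  have PP': "clopen (P - P')" "clopen (Q - Q')"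
    using P' Q' by (auto intro: open_Diff closed_Diff)
  have mm: "m (P - P') = m P - m P'" "m (Q - Q') = m Q - m Q'"
    using P' Q' by (auto intro!: finite_measure_Diff simp: clopen_sets)
  have pos: "m P' > 0" "m Q > 0" "m (P - P') > 0" "m P > 0"
    using clopen_pos P' PP' by auto
  have eq2: "m (Q - Q') * m P = m (P - P') * m Q"
    unfolding mm using Q'(3) by (simp add: algebra_simps)
  have ne: "Q' \<noteq> {}" "Q - Q' \<noteq> {}"
    using Q'(3) eq2 pos by (metis measure_empty mult_eq_0_iff less_irrefl)+
  define S where "S = {(P', Q'), (P - P', Q - Q')}"
  have "matching S P Q"
    unfolding matching_def S_def using P' Q' PP' ne by auto
  moreover have "refines S {r}"
    unfolding refines_def S_def using P' Q' eq2 by (auto simp: P_def Q_def)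
  moreover have "\<forall>s\<in>S. fst s \<subseteq> U \<or> fst s \<inter> U = {}"
    unfolding S_def P'_def by auto
  ultimately show ?thesis unfolding P_def Q_def by blast
qed

lemma split_matching:
  assumes R: "matching R A B" and U: "clopen U"
  shows "\<exists>R'. matching R' A B \<and> refines R' R \<and> (\<forall>r\<in>R'. fst r \<subseteq> U \<or> fst r \<inter> U = {})"
proof -
  have "\<forall>r\<in>R. \<exists>S. matching S (fst r) (snd r) \<and> refines S {r} \<and> (\<forall>s\<in>S. fst s \<subseteq> U \<or> fst s \<inter> U = {})"
    using split_piece[OF _ _ _ _ U] matching_piece[OF R] by blast
  then obtain S where S: "\<And>r. r \<in> R \<Longrightarrow> matching (S r) (fst r) (snd r)"
      "\<And>r. r \<in> R \<Longrightarrow> refines (S r) {r}"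
      "\<And>r s. r \<in> R \<Longrightarrow> s \<in> S r \<Longrightarrow> fst s \<subseteq> U \<or> fst s \<inter> U = {}"
    by metis
  have "matching (\<Union>r\<in>R. S r) A B" by (rule matching_Union[OF R S(1)])
  moreover have "refines (\<Union>r\<in>R. S r) R" using S(2) unfolding refines_def by blast
  ultimately show ?thesis using S(3) by (intro exI[of _ "\<Union>r\<in>R. S r"]) blast
qed

lemma split_matching_finite:
  assumes R: "matching R A B" and F: "finite F" "\<forall>U\<in>F. clopen U"
  shows "\<exists>R'. matching R' A B \<and> refines R' R \<and> (\<forall>r\<in>R'. \<forall>U\<in>F. fst r \<subseteq> U \<or> fst r \<inter> U = {})"
  using F
proof (induction F)
  case empty
  then show ?case using R refines_refl by blast
next
  case (insert U F)
  then obtain R1 where R1: "matching R1 A B" "refines R1 R"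
      "\<forall>r\<in>R1. \<forall>U\<in>F. fst r \<subseteq> U \<or> fst r \<inter> U = {}" by auto
  obtain R2 where R2: "matching R2 A B" "refines R2 R1" "\<forall>r\<in>R2. fst r \<subseteq> U \<or> fst r \<inter> U = {}"
    using split_matching[OF R1(1), of U] insert.prems by auto
  have "refines R2 R" using refines_trans[OF R R1(1) R2(1) R2(2) R1(2)] .
  moreover have "\<forall>r\<in>R2. \<forall>V\<in>F. fst r \<subseteq> V \<or> fst r \<inter> V = {}"
  proof (intro ballI)
    fix r V assume r: "r \<in> R2" and V: "V \<in> F"
    obtain r1 where "r1 \<in> R1" "fst r \<subseteq> fst r1" by (rule refinesE[OF R2(2) r])
    then show "fst r \<subseteq> V \<or> fst r \<inter> V = {}" using R1(3) V by blast
  qed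
  ultimately show ?case using R2 by blast
qed

lemma split_matching_level:
  assumes R: "matching R UNIV UNIV"
  shows "\<exists>R'. matching R' UNIV UNIV \<and> refines R' R \<and> (\<forall>r\<in>R'. \<exists>x. fst r \<subseteq> cyl n x)"
proof -
  obtain R' where R': "matching R' UNIV UNIV" "refines R' R"
      "\<forall>r\<in>R'. \<forall>U\<in>cyls n. fst r \<subseteq> U \<or> fst r \<inter> U = {}"
    using split_matching_finite[OF R finite_cyls[of n]] cyls_clopen by blast
  have "\<exists>x. fst r \<subseteq> cyl n x" if "r \<in> R'" for r
  proof -
    have "fst r \<noteq> {}" using matching_piece(3)[OF R'(1) that] .
    then obtain x where "x \<in> fst r" by blast
    then have "\<not> fst r \<inter> cyl n x = {}" using self_in_cyl[of x n] by blast
    moreover have "cyl n x \<in> cyls n" by (simp add: cyls_def)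
    ultimately show ?thesis using R'(3) that by blast
  qed
  then show ?thesis using R' by blast
qed

text \<open>Forth: the first sides are cut to the size of cylinders. Back: the same is done for the converse.\<close>

lemma back_and_forth_step:
  assumes R: "matching R UNIV UNIV"
  shows "\<exists>R'. matching R' UNIV UNIV \<and> refines R' R \<and>
    (\<forall>r\<in>R'. (\<exists>x. fst r \<subseteq> cyl n x) \<and> (\<exists>y. snd r \<subseteq> cyl n y))"
proof -
  obtain R1 where R1: "matching R1 UNIV UNIV" "refines R1 R" "\<forall>r\<in>R1. \<exists>x. fst r \<subseteq> cyl n x"
    using split_matching_level[OF R] by blast
  obtain R2 where R2: "matching R2 UNIV UNIV" "refines R2 (R1\<inverse>)" "\<forall>r\<in>R2. \<exists>x. fst r \<subseteq> cyl n x"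
    using split_matching_level[OF matching_converse[OF R1(1)]] by blast
  have c: "matching (R2\<inverse>) UNIV UNIV" "refines (R2\<inverse>) R1"
    using matching_converse[OF R2(1)] refines_converse[OF R2(2)] by auto
  have "refines (R2\<inverse>) R" by (rule refines_trans[OF R R1(1) c(1) c(2) R1(2)])
  moreover have "\<exists>x. fst r \<subseteq> cyl n x" if r: "r \<in> R2\<inverse>" for r
  proof -
    obtain r1 where "r1 \<in> R1" "fst r \<subseteq> fst r1" by (rule refinesE[OF c(2) r])
    then show ?thesis using R1(3) by blast
  qed
  moreover have "\<exists>y. snd r \<subseteq> cyl n y" if "r \<in> R2\<inverse>" for r
  proof -
    have "prod.swap r \<in> R2" using that by auto
    then show ?thesis using R2(3) by force
  qed
  ultimately show ?thesis using c(1) by blast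
qed

end

section \<open>Homeomorphisms that scale the measure piece by piece\<close>

abbreviation finv :: "('a \<Rightarrow> 'b) \<Rightarrow> 'b \<Rightarrow> 'a" where
  "finv \<equiv> inv_into UNIV"

text \<open>Indexed families with possibly empty pieces: partitions that arise from different
  homeomorphisms can then carry the same labels and be compared label by label.\<close>

definition clopen_partition :: "'i set \<Rightarrow> ('i \<Rightarrow> cantor set) \<Rightarrow> bool" where
  "clopen_partition I F \<longleftrightarrow> finite I \<and> (\<forall>i\<in>I. clopen (F i)) \<and> disjoint_family_on F I \<and> (\<Union>i\<in>I. F i) = UNIV"

lemma partition_finite: "clopen_partition I F \<Longrightarrow> finite I"
  by (simp add: clopen_partition_def)

lemma partition_clopen: "clopen_partition I F \<Longrightarrow> i \<in> I \<Longrightarrow> clopen (F i)"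
  by (simp add: clopen_partition_def)

lemma partition_cover: "clopen_partition I F \<Longrightarrow> \<exists>i\<in>I. x \<in> F i"
  unfolding clopen_partition_def by (metis UNIV_I UN_iff)

lemma partition_disjoint: "clopen_partition I F \<Longrightarrow> i \<in> I \<Longrightarrow> j \<in> I \<Longrightarrow> i \<noteq> j \<Longrightarrow> F i \<inter> F j = {}"
  by (auto simp: clopen_partition_def disjoint_family_on_def)

lemma partition_unique: "clopen_partition I F \<Longrightarrow> i \<in> I \<Longrightarrow> j \<in> I \<Longrightarrow> x \<in> F i \<Longrightarrow> x \<in> F j \<Longrightarrow> i = j"
  using partition_disjoint by (metis disjoint_iff)

lemma partition_cyls: "clopen_partition (cyls n) (\<lambda>Q. Q)"
  unfolding clopen_partition_def disjoint_family_on_def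
  using finite_cyls cyls_clopen disjoint_cyls Union_cyls by auto

lemma partition_cong:
  "(\<And>i. i \<in> I \<Longrightarrow> F i = G i) \<Longrightarrow> clopen_partition I F = clopen_partition I G"
  by (simp add: clopen_partition_def disjoint_family_on_def)

lemma partition_coarsen:
  assumes F: "clopen_partition S F" and I: "finite I" "\<And>Q. Q \<in> S \<Longrightarrow> f Q \<in> I"
  shows "clopen_partition I (\<lambda>c. \<Union>Q\<in>{Q\<in>S. f Q = c}. F Q)"
  unfolding clopen_partition_def disjoint_family_on_def
proof (intro conjI ballI impI)
  show "(\<Union>Q\<in>{Q\<in>S. f Q = c}. F Q) \<inter> (\<Union>Q\<in>{Q\<in>S. f Q = d}. F Q) = {}" if "c \<noteq> d" for c d
    using that partition_unique[OF F] by blast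
  show "(\<Union>c\<in>I. \<Union>Q\<in>{Q\<in>S. f Q = c}. F Q) = UNIV"
    using partition_cover[OF F] I(2) by blast
  show "open (\<Union>Q\<in>{Q\<in>S. f Q = c}. F Q)" "closed (\<Union>Q\<in>{Q\<in>S. f Q = c}. F Q)" for c
    using partition_clopen[OF F] partition_finite[OF F] by (auto intro!: open_UN closed_UN)
qed (rule I(1))

lemma matching_partition:
  assumes "matching R UNIV UNIV"
  shows "clopen_partition R fst"
  using matching_finite[OF assms] matching_piece(1)[OF assms] matching_disjoint(1)[OF assms]
    matching_cover(1)[OF assms]
  unfolding clopen_partition_def disjoint_family_on_def by auto

lemma homeomorphism_image_borel:
  assumes "homeomorphism UNIV UNIV g h" "A \<in> sets borel"
  shows "g ` A \<in> sets borel"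
proof -
  have "g ` A = h -` A"
    using assms(1) unfolding homeomorphism_def by (auto simp: image_iff) (metis UNIV_I)+
  moreover have "h -` A \<inter> space borel \<in> sets borel"
    using assms by (intro measurable_sets[OF borel_measurable_continuous_onI])
      (auto simp: homeomorphism_def)
  ultimately show ?thesis by simp
qed

lemma homeomorphism_UNIV_bij: "homeomorphism UNIV UNIV g h \<Longrightarrow> bij g \<and> h = finv g"
proof -
  assume h: "homeomorphism UNIV UNIV g h"
  then have gh: "g (h y) = y" "h (g x) = x" for x y
    unfolding homeomorphism_def by auto
  then have "bij g" by (metis bijI')
  moreover have "h = finv g" using gh by (metis ext inv_equality)
  ultimately show ?thesis ..
qed

lemma homeomorphism_UNIV_clopen:
  assumes h: "homeomorphism UNIV UNIV g h" and U: "clopen U"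
  shows "clopen (g ` U)"
proof -
  have "g ` U = h -` U"
    using h unfolding homeomorphism_def by (auto simp: image_iff) (metis UNIV_I)+
  moreover have "continuous_on UNIV h" using h by (simp add: homeomorphism_def)
  ultimately show ?thesis using U by (auto intro: open_vimage closed_vimage)
qed

context ratio_measure
begin

lemma measure_partition:
  assumes F: "clopen_partition I F" and A: "A \<in> sets borel"
  shows "m A = (\<Sum>i\<in>I. m (A \<inter> F i))"
proof -
  have "m (\<Union>i\<in>I. A \<inter> F i) = (\<Sum>i\<in>I. m (A \<inter> F i))"
    using F A unfolding clopen_partition_def disjoint_family_on_def
    by (intro finite_measure_finite_Union) (auto intro!: borel_sets sets.Int simp: disjoint_family_on_def)
  moreover have "(\<Union>i\<in>I. A \<inter> F i) = A" using partition_cover[OF F] by blast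
  ultimately show ?thesis by simp
qed

definition scales :: "(cantor \<Rightarrow> cantor) \<Rightarrow> cantor set \<Rightarrow> real \<Rightarrow> bool" where
  "scales g P r \<longleftrightarrow> (\<forall>A\<in>sets borel. A \<subseteq> P \<longrightarrow> m (g ` A) = r * m A)"

lemma scalesD: "scales g P r \<Longrightarrow> A \<in> sets borel \<Longrightarrow> A \<subseteq> P \<Longrightarrow> m (g ` A) = r * m A"
  by (simp add: scales_def)

lemma scales_subset: "scales g P r \<Longrightarrow> Q \<subseteq> P \<Longrightarrow> scales g Q r"
  by (auto simp: scales_def)

lemma H_iff: "g \<in> H_bac \<mu> \<longleftrightarrow>
    (\<exists>h. homeomorphism UNIV UNIV g h) \<and> (\<forall>A\<in>sets borel. m A = 0 \<longleftrightarrow> m (g ` A) = 0)"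
  unfolding H_bac_def by (auto simp: emeasure_eq_measure)

lemma H_homeo: "g \<in> H_bac \<mu> \<Longrightarrow> homeomorphism UNIV UNIV g (finv g)"
  using H_iff homeomorphism_UNIV_bij by metis

lemma H_bij: "g \<in> H_bac \<mu> \<Longrightarrow> bij g"
  using H_iff homeomorphism_UNIV_bij by metis

lemma H_inj: "g \<in> H_bac \<mu> \<Longrightarrow> inj g"
  using H_bij bij_is_inj by blast

lemma H_null: "g \<in> H_bac \<mu> \<Longrightarrow> A \<in> sets borel \<Longrightarrow> m (g ` A) = 0 \<longleftrightarrow> m A = 0"
  using H_iff by auto

lemma H_borel: "g \<in> H_bac \<mu> \<Longrightarrow> A \<in> sets borel \<Longrightarrow> g ` A \<in> sets borel"
  using H_homeo homeomorphism_image_borel by blast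

lemma H_clopen: "g \<in> H_bac \<mu> \<Longrightarrow> clopen U \<Longrightarrow> clopen (g ` U)"
  using H_homeo homeomorphism_UNIV_clopen by blast

lemma H_id: "id \<in> H_bac \<mu>"
proof -
  have "homeomorphism UNIV UNIV id (id :: cantor \<Rightarrow> cantor)"
    by (simp add: homeomorphism_def continuous_on_id)
  then show ?thesis unfolding H_iff by auto
qed

lemma H_comp: "g \<in> H_bac \<mu> \<Longrightarrow> h \<in> H_bac \<mu> \<Longrightarrow> g \<circ> h \<in> H_bac \<mu>"
proof -
  assume g: "g \<in> H_bac \<mu>" and h: "h \<in> H_bac \<mu>"
  have "homeomorphism UNIV UNIV (g \<circ> h) (finv h \<circ> finv g)"
    using homeomorphism_compose[OF H_homeo[OF h] H_homeo[OF g]] .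
  moreover have "m A = 0 \<longleftrightarrow> m ((g \<circ> h) ` A) = 0" if A: "A \<in> sets borel" for A
    using H_null[OF g H_borel[OF h A]] H_null[OF h A] by (simp add: image_comp)
  ultimately show ?thesis unfolding H_iff by blast
qed

lemma H_inv: "g \<in> H_bac \<mu> \<Longrightarrow> finv g \<in> H_bac \<mu>"
proof -
  assume g: "g \<in> H_bac \<mu>"
  have h: "homeomorphism UNIV UNIV (finv g) g"
    using H_homeo[OF g] homeomorphism_symD by blast
  have "m A = 0 \<longleftrightarrow> m (finv g ` A) = 0" if "A \<in> sets borel" for A
    using H_null[OF g homeomorphism_image_borel[OF h that]] bij_is_surj[OF H_bij[OF g]]
    by (simp add: image_f_inv_f)
  then show ?thesis unfolding H_iff using h by blast
qed

lemma H_inv_image: "g \<in> H_bac \<mu> \<Longrightarrow> finv g ` (g ` A) = A"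
  by (simp add: H_inj image_inv_f_f)

lemma H_image_inv: "g \<in> H_bac \<mu> \<Longrightarrow> g ` (finv g ` A) = A"
  by (simp add: H_bij bij_is_surj image_f_inv_f)

lemma H_partition_image:
  assumes g: "g \<in> H_bac \<mu>" and F: "clopen_partition J F"
  shows "clopen_partition J (\<lambda>c. g ` F c)"
  unfolding clopen_partition_def disjoint_family_on_def
proof (intro conjI ballI impI)
  fix c d assume "c \<in> J" "d \<in> J" "c \<noteq> d"
  then show "g ` F c \<inter> g ` F d = {}"
    using partition_disjoint[OF F] image_Int[OF H_inj[OF g]] by (metis image_empty)
next
  have "(\<Union>c\<in>J. g ` F c) = g ` (\<Union>c\<in>J. F c)" by blast
  then show "(\<Union>c\<in>J. g ` F c) = UNIV"
    using F bij_is_surj[OF H_bij[OF g]] by (simp add: clopen_partition_def)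
qed (use F H_clopen[OF g] partition_finite in \<open>auto simp: clopen_partition_def\<close>)

lemma homeomorphism_measure_image:
  assumes g: "homeomorphism UNIV UNIV g h" and F: "clopen_partition I F" and A: "A \<in> sets borel"
  shows "m (g ` A) = (\<Sum>i\<in>I. m (g ` (A \<inter> F i)))"
proof -
  have inj: "inj g" using homeomorphism_UNIV_bij[OF g] bij_is_inj by blast
  have "disjoint_family_on (\<lambda>i. g ` (A \<inter> F i)) I"
    unfolding disjoint_family_on_def
  proof (intro ballI impI)
    fix i j assume "i \<in> I" "j \<in> I" "i \<noteq> j"
    then have "(A \<inter> F i) \<inter> (A \<inter> F j) = {}" using partition_disjoint[OF F] by blast
    then show "g ` (A \<inter> F i) \<inter> g ` (A \<inter> F j) = {}"
      using image_Int[OF inj] by (metis image_empty)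
  qed
  then have "m (\<Union>i\<in>I. g ` (A \<inter> F i)) = (\<Sum>i\<in>I. m (g ` (A \<inter> F i)))"
    using partition_finite[OF F] partition_clopen[OF F] A
    by (intro finite_measure_finite_Union)
      (auto intro!: borel_sets homeomorphism_image_borel[OF g] sets.Int)
  moreover have "(\<Union>i\<in>I. g ` (A \<inter> F i)) = g ` A" using partition_cover[OF F] by blast
  ultimately show ?thesis by simp
qed

text \<open>Clopen sets are closed under intersection and generate the Borel sets, so Dynkin's argument
  extends the scaling relation to all Borel subsets of \<open>P\<close>.\<close>

lemma scales_from_clopen:
  assumes h: "homeomorphism UNIV UNIV s t" and P: "clopen P"
    and cl: "\<And>V. clopen V \<Longrightarrow> V \<subseteq> P \<Longrightarrow> m (s ` V) = c * m V"
  shows "scales s P c"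
proof -
  have inj: "inj s" using homeomorphism_UNIV_bij[OF h] bij_is_inj by blast
  have bs: "s ` B \<in> sets \<mu>" if "B \<in> sets \<mu>" for B
    using homeomorphism_image_borel[OF h] that sets_mu by simp
  have Pm: "P \<in> sets \<mu>" using clopen_sets[OF P] .
  have "m (s ` (A \<inter> P)) = c * m (A \<inter> P)" if "A \<in> sets borel" for A
  proof -
    have "Int_stable {U :: cantor set. clopen U}" by (auto simp: Int_stable_def)
    moreover have "{U :: cantor set. clopen U} \<subseteq> Pow UNIV" by simp
    moreover have "A \<in> sigma_sets UNIV {U. clopen U}" using that sets_borel_clopen by simp
    ultimately show ?thesis
    proof (induction rule: sigma_sets_induct_disjoint)
      case (basic A)
      then show ?case using P by (intro cl) auto
    next
      case empty
      show ?case by simp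
    next
      case (compl A)
      note A = compl(1) and IH = compl(2)
      have AP: "A \<inter> P \<in> sets \<mu>" using A Pm sets_mu sets_borel_clopen by auto
      have "(UNIV - A) \<inter> P = P - A \<inter> P" by blast
      moreover have "m (P - A \<inter> P) = m P - m (A \<inter> P)"
        using AP Pm by (intro finite_measure_Diff) auto
      moreover have "m (s ` P - s ` (A \<inter> P)) = m (s ` P) - m (s ` (A \<inter> P))"
        using AP Pm bs by (intro finite_measure_Diff) auto
      ultimately show ?case
        unfolding IH cl[OF P subset_refl] by (simp only: image_set_diff[OF inj] right_diff_distrib)
    next
      case (union A)
      note dj = union(1) and A = union(2) and IH = union(3)
      have "A i \<in> sets \<mu>" for i using A sets_mu sets_borel_clopen by blast
      then have AP: "A i \<inter> P \<in> sets \<mu>" for i using Pm by blast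
      have "(\<lambda>i. m (A i \<inter> P)) sums m (\<Union>i. A i \<inter> P)"
        using AP dj by (intro finite_measure_UNION) (auto simp: disjoint_family_on_def)
      then have 1: "(\<lambda>i. c * m (A i \<inter> P)) sums (c * m (\<Union>i. A i \<inter> P))" by (rule sums_mult)
      have "disjoint_family (\<lambda>i. s ` (A i \<inter> P))"
        unfolding disjoint_family_on_def
      proof (intro ballI impI)
        fix i j :: nat assume "i \<noteq> j"
        then have "(A i \<inter> P) \<inter> (A j \<inter> P) = {}" using dj by (auto simp: disjoint_family_on_def)
        then show "s ` (A i \<inter> P) \<inter> s ` (A j \<inter> P) = {}"
          using image_Int[OF inj] by (metis image_empty)
      qed
      then have "(\<lambda>i. m (s ` (A i \<inter> P))) sums m (\<Union>i. s ` (A i \<inter> P))"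
        using AP bs by (intro finite_measure_UNION) auto
      then have "(\<lambda>i. c * m (A i \<inter> P)) sums m (\<Union>i. s ` (A i \<inter> P))" using IH by simp
      then have "m (\<Union>i. s ` (A i \<inter> P)) = c * m (\<Union>i. A i \<inter> P)" using 1 by (rule sums_unique2)
      then show ?case
        by (simp add: image_UN[symmetric])
    qed
  qed
  then show ?thesis unfolding scales_def by (metis inf.absorb1)
qed

text \<open>Iterating the back-and-forth step yields a sequence of matchings whose pieces shrink on both
  sides, and \<open>s\<close> is its limit. A clopen subset of a piece of \<open>R\<close> is a union of pieces of a later
  matching, all of which have inherited the same factor; so \<open>s\<close> scales the measure on it.\<close>

lemma exists_scaling_matching:
  assumes R: "matching R UNIV UNIV"
  shows "\<exists>s\<in>H_bac \<mu>. \<forall>r\<in>R. s ` fst r = snd r \<and> scales s (fst r) (m (snd r) / m (fst r))"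
proof -
  have "\<exists>Rs. Rs 0 = R \<and> (\<forall>n. matching (Rs n) UNIV UNIV \<and> refines (Rs (Suc n)) (Rs n) \<and>
      (\<forall>r\<in>Rs (Suc n). (\<exists>x. fst r \<subseteq> cyl n x) \<and> (\<exists>y. snd r \<subseteq> cyl n y)))"
  proof -
    have "\<exists>Rs. \<forall>n. (matching (Rs n) UNIV UNIV \<and> (n = 0 \<longrightarrow> Rs n = R)) \<and>
      (refines (Rs (Suc n)) (Rs n) \<and>
      (\<forall>r\<in>Rs (Suc n). (\<exists>x. fst r \<subseteq> cyl n x) \<and> (\<exists>y. snd r \<subseteq> cyl n y)))"
      by (rule dependent_nat_choice) (use R back_and_forth_step in auto)
    then show ?thesis by metis
  qed
  then obtain Rs where Rs0: "Rs 0 = R" and Rs: "\<And>n. matching (Rs n) UNIV UNIV"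
      and ref: "\<And>n. refines (Rs (Suc n)) (Rs n)"
      and smallf: "\<And>n r. r \<in> Rs (Suc n) \<Longrightarrow> \<exists>x. fst r \<subseteq> cyl n x"
      and smalls: "\<And>n r. r \<in> Rs (Suc n) \<Longrightarrow> \<exists>x. snd r \<subseteq> cyl n x"
    by blast
  have sub: "\<exists>r\<in>Rs n. fst r' \<subseteq> fst r \<and> snd r' \<subseteq> snd r" if r': "r' \<in> Rs (Suc n)" for n r'
  proof -
    obtain r where "r \<in> Rs n" "fst r' \<subseteq> fst r" "snd r' \<subseteq> snd r" by (rule refinesE[OF ref r'])
    then show ?thesis by blast
  qed
  obtain s where s: "continuous_on UNIV s" "\<And>n r. r \<in> Rs n \<Longrightarrow> s ` fst r \<subseteq> snd r"
    using limit_of_matchings[of Rs, OF Rs sub smalls] by blast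
  have sub': "\<exists>r\<in>(Rs n)\<inverse>. fst r' \<subseteq> fst r \<and> snd r' \<subseteq> snd r" if r': "r' \<in> (Rs (Suc n))\<inverse>" for n r'
  proof -
    have "prod.swap r' \<in> Rs (Suc n)" using r' by auto
    then obtain r where "r \<in> Rs n" "snd r' \<subseteq> fst r" "fst r' \<subseteq> snd r" using sub by fastforce
    then show ?thesis by (intro bexI[of _ "prod.swap r"]) (simp_all add: prod.swap_def)
  qed
  have small': "\<exists>y. snd r \<subseteq> cyl n y" if r: "r \<in> (Rs (Suc n))\<inverse>" for n r
  proof -
    have "prod.swap r \<in> Rs (Suc n)" using r by auto
    then show ?thesis using smallf by fastforce
  qed
  obtain t where t: "continuous_on UNIV t" "\<And>n r. r \<in> (Rs n)\<inverse> \<Longrightarrow> t ` fst r \<subseteq> snd r"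
    using limit_of_matchings[of "\<lambda>n. (Rs n)\<inverse>", OF matching_converse[OF Rs] sub' small'] by blast
  have t': "t ` snd r \<subseteq> fst r" if "r \<in> Rs n" for n r
    using t(2)[of "prod.swap r" n] that by (simp add: prod.swap_def)
  have ts: "t (s x) = x" for x
  proof (rule cyl_limit_unique)
    fix n
    obtain r where r: "r \<in> Rs (Suc n)" "x \<in> fst r" using matching_cover(1)[OF Rs] by blast
    then have "t (s x) \<in> fst r" using s(2)[OF r(1)] t'[OF r(1)] by blast
    then show "\<exists>z. t (s x) \<in> cyl n z \<and> x \<in> cyl n z" using smallf[OF r(1)] r(2) by blast
  qed
  have st: "s (t x) = x" for x
  proof (rule cyl_limit_unique)
    fix n
    obtain r where r: "r \<in> Rs (Suc n)" "x \<in> snd r" using matching_cover(2)[OF Rs] by blast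
    then have "s (t x) \<in> snd r" using s(2)[OF r(1)] t'[OF r(1)] by blast
    then show "\<exists>z. s (t x) \<in> cyl n z \<and> x \<in> cyl n z" using smalls[OF r(1)] r(2) by blast
  qed
  have hom: "homeomorphism UNIV UNIV s t"
    unfolding homeomorphism_def using s(1) t(1) ts st by (auto simp: surj_def) metis+
  have sP: "s ` fst r = snd r" if "r \<in> Rs n" for n r
  proof
    show "s ` fst r \<subseteq> snd r" using s(2)[OF that] .
    show "snd r \<subseteq> s ` fst r" using t'[OF that] st by (metis image_eqI image_subset_iff subsetI)
  qed
  have ref0: "refines (Rs n) R" for n
  proof (induction n)
    case 0
    then show ?case using Rs0 refines_refl by simp
  next
    case (Suc n)
    then show ?case using refines_trans[OF R Rs Rs ref] by blast
  qed
  have sc: "scales s (fst r0) (m (snd r0) / m (fst r0))" if r0: "r0 \<in> R" for r0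
  proof (rule scales_from_clopen[OF hom])
    show "clopen (fst r0)" using matching_piece(1)[OF R r0] .
    fix V assume V: "clopen V" "V \<subseteq> fst r0"
    obtain n where n: "decided n V" using clopen_decided[OF V(1)] by blast
    \<comment> \<open>The pieces of a matching so fine that each lies inside \<open>V\<close> or outside it.\<close>
    define L where "L = {r\<in>Rs (Suc n). fst r \<subseteq> V}"
    have L: "L \<subseteq> Rs (Suc n)" "finite L"
      using matching_finite[OF Rs[of "Suc n"]] by (auto simp: L_def)
    have VL: "V = (\<Union>r\<in>L. fst r)"
    proof
      show "V \<subseteq> (\<Union>r\<in>L. fst r)"
      proof
        fix x assume x: "x \<in> V"
        obtain r where r: "r \<in> Rs (Suc n)" "x \<in> fst r" using matching_cover(1)[OF Rs] by blast
        obtain y where y: "fst r \<subseteq> cyl n y" using smallf[OF r(1)] by blast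
        then have "cyl n x = cyl n y" using r(2) cyl_eq_if_in by blast
        then have "fst r \<subseteq> V" using n x y by (auto simp: decided_def)
        then show "x \<in> (\<Union>r\<in>L. fst r)" using r unfolding L_def by blast
      qed
    qed (auto simp: L_def)
    have dj: "disjoint_family_on fst L" "disjoint_family_on snd L"
      using matching_disjoint[OF Rs[of "Suc n"]] L(1) unfolding disjoint_family_on_def by blast+
    have mem: "fst ` L \<subseteq> sets \<mu>" "snd ` L \<subseteq> sets \<mu>"
      using matching_piece(1,2)[OF Rs[of "Suc n"]] L(1) clopen_sets by blast+
    have eq: "m (snd r) = m (snd r0) / m (fst r0) * m (fst r)" if r: "r \<in> L" for r
    proof -
      have rn: "r \<in> Rs (Suc n)" "fst r \<subseteq> V" using r by (auto simp: L_def)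
      obtain r1 where r1: "r1 \<in> R" "fst r \<subseteq> fst r1" "m (snd r) * m (fst r1) = m (fst r) * m (snd r1)"
        using refinesE[OF ref0 rn(1)] by metis
      obtain x where "x \<in> fst r" using matching_piece(3)[OF Rs rn(1)] by blast
      then have "r1 = r0" using matching_unique_fst[OF R r1(1) r0, of x] r1(2) rn(2) V(2) by blast
      moreover have "m (fst r0) > 0" using clopen_pos matching_piece(1,3)[OF R r0] by blast
      ultimately show ?thesis using r1(3) by (simp add: field_simps)
    qed
    have "s ` V = (\<Union>r\<in>L. s ` fst r)" by (subst VL) (rule image_UN)
    also have "\<dots> = (\<Union>r\<in>L. snd r)" using sP[of _ "Suc n"] L(1) by (intro SUP_cong) auto
    finally have "s ` V = (\<Union>r\<in>L. snd r)" .
    then have "m (s ` V) = (\<Sum>r\<in>L. m (snd r))"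
      using finite_measure_finite_Union[OF L(2) mem(2) dj(2)] by simp
    also have "\<dots> = (\<Sum>r\<in>L. m (snd r0) / m (fst r0) * m (fst r))" using eq by (rule sum.cong[OF refl])
    also have "\<dots> = m (snd r0) / m (fst r0) * (\<Sum>r\<in>L. m (fst r))" by (simp add: sum_distrib_left)
    also have "(\<Sum>r\<in>L. m (fst r)) = m V"
      using finite_measure_finite_Union[OF L(2) mem(1) dj(1)] VL by simp
    finally show "m (s ` V) = m (snd r0) / m (fst r0) * m V" .
  qed
  have "m A = 0 \<longleftrightarrow> m (s ` A) = 0" if A: "A \<in> sets borel" for A
  proof -
    note part = matching_partition[OF R]
    have "m (A \<inter> fst r) = 0 \<longleftrightarrow> m (s ` (A \<inter> fst r)) = 0" if r: "r \<in> R" for r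
    proof -
      have "m (snd r) / m (fst r) > 0"
        using clopen_pos matching_piece[OF R r] by (intro divide_pos_pos) blast+
      moreover have "A \<inter> fst r \<in> sets borel" using A matching_piece(1)[OF R r] by auto
      ultimately show ?thesis
        using scalesD[OF sc[OF r] _ Int_lower2] by (metis mult_eq_0_iff less_irrefl)
    qed
    then show ?thesis
      unfolding measure_partition[OF part A] homeomorphism_measure_image[OF hom part A]
      by (simp add: sum_nonneg_eq_0_iff matching_finite[OF R])
  qed
  then have "s \<in> H_bac \<mu>" unfolding H_iff using hom by blast
  then show ?thesis using sP[of _ 0] Rs0 sc by blast
qed

theorem exists_scaling:
  assumes A: "clopen_partition I A" and B: "clopen_partition I B" and ne: "\<And>i. i \<in> I \<Longrightarrow> A i = {} \<longleftrightarrow> B i = {}"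
  obtains s where "s \<in> H_bac \<mu>" "\<And>i. i \<in> I \<Longrightarrow> s ` A i = B i"
    "\<And>i. i \<in> I \<Longrightarrow> scales s (A i) (m (B i) / m (A i))"
proof -
  define R where "R = (\<lambda>i. (A i, B i)) ` {i\<in>I. A i \<noteq> {}}"
  have "matching R UNIV UNIV"
  proof (rule matchingI)
    show "finite R" using partition_finite[OF A] by (simp add: R_def)
    show "clopen P \<and> clopen Q \<and> P \<noteq> {} \<and> Q \<noteq> {}" if "(P, Q) \<in> R" for P Q
      using that partition_clopen[OF A] partition_clopen[OF B] ne by (auto simp: R_def)
    show "fst r \<inter> fst r' = {}" if "r \<in> R" "r' \<in> R" "r \<noteq> r'" for r r'
      using that partition_disjoint[OF A] by (force simp: R_def)
    show "snd r \<inter> snd r' = {}" if "r \<in> R" "r' \<in> R" "r \<noteq> r'" for r r'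
      using that partition_disjoint[OF B] by (force simp: R_def)
    show "(\<Union>r\<in>R. fst r) = UNIV" using partition_cover[OF A] by (force simp: R_def)
    show "(\<Union>r\<in>R. snd r) = UNIV" using partition_cover[OF B] ne by (force simp: R_def)
  qed
  from exists_scaling_matching[OF this] obtain s where s: "s \<in> H_bac \<mu>"
    "\<And>r. r \<in> R \<Longrightarrow> s ` fst r = snd r" "\<And>r. r \<in> R \<Longrightarrow> scales s (fst r) (m (snd r) / m (fst r))"
    by blast
  have "s ` A i = B i" if "i \<in> I" for i
    using s(2)[of "(A i, B i)"] that ne by (cases "A i = {}") (auto simp: R_def)
  moreover have "scales s (A i) (m (B i) / m (A i))" if "i \<in> I" for i
    using s(3)[of "(A i, B i)"] that by (cases "A i = {}") (auto simp: R_def scales_def)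
  ultimately show thesis using s(1) that by blast
qed

end

section \<open>Derivatives and their conditional expectations\<close>

definition cyl_constant :: "nat \<Rightarrow> (cantor \<Rightarrow> real) \<Rightarrow> bool" where
  "cyl_constant n \<phi> \<longleftrightarrow> (\<forall>x. \<forall>y\<in>cyl n x. \<phi> y = \<phi> x)"

lemma cyl_constantD: "cyl_constant n \<phi> \<Longrightarrow> y \<in> cyl n x \<Longrightarrow> \<phi> y = \<phi> x"
  by (simp add: cyl_constant_def)

lemma cyl_constant_mono:
  assumes "cyl_constant n \<phi>" "n \<le> k"
  shows "cyl_constant k \<phi>"
  unfolding cyl_constant_def
proof (intro allI ballI)
  fix x y assume "y \<in> cyl k x"
  then have "y \<in> cyl n x" using cyl_antimono[OF assms(2)] by (rule subsetD[rotated])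
  then show "\<phi> y = \<phi> x" by (rule cyl_constantD[OF assms(1)])
qed

lemma cyl_constant_add:
  assumes "cyl_constant n \<phi>" "cyl_constant k \<psi>"
  shows "cyl_constant (max n k) (\<lambda>x. \<phi> x + \<psi> x)"
proof -
  have "cyl_constant (max n k) \<phi>" "cyl_constant (max n k) \<psi>"
    using assms by (auto intro: cyl_constant_mono)
  then show ?thesis unfolding cyl_constant_def by (intro allI ballI arg_cong2[of _ _ _ _ "(+)"]) blast+
qed

lemma cyl_constant_scale: "cyl_constant n \<phi> \<Longrightarrow> cyl_constant n (\<lambda>x. c * \<phi> x)"
  unfolding cyl_constant_def by simp

lemma cyl_constant_const: "cyl_constant 0 (\<lambda>x. c)"
  unfolding cyl_constant_def by simp

lemma cyl_constant_indicator: "decided n U \<Longrightarrow> cyl_constant n (indicator U)"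
  unfolding cyl_constant_def decided_def by (auto simp: indicator_def) (metis cyl_eq_if_in self_in_cyl subsetD)

text \<open>Only applied to functions that are constant on the nonempty set \<open>Q\<close>.\<close>

definition value_on :: "(cantor \<Rightarrow> real) \<Rightarrow> cantor set \<Rightarrow> real" where
  "value_on \<phi> Q = \<phi> (SOME x. x \<in> Q)"

lemma value_on_eq:
  assumes "cyl_constant n \<phi>" "Q \<in> cyls n" "x \<in> Q"
  shows "value_on \<phi> Q = \<phi> x"
proof -
  have "(SOME x. x \<in> Q) \<in> Q" using assms(3) by (rule someI[of "\<lambda>x. x \<in> Q"])
  moreover have "Q = cyl n x" using assms(2,3) cyl_eq_if_in by (auto simp: cyls_def)
  ultimately show ?thesis using assms(1) unfolding value_on_def cyl_constant_def by blast
qed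

lemma sum_indicator_cyls: "(\<Sum>Q\<in>cyls n. c Q * indicator Q x) = (c (cyl n x) :: real)"
proof -
  have "(\<Sum>Q\<in>cyls n. c Q * indicator Q x) = (\<Sum>Q\<in>cyls n. if Q = cyl n x then c Q else 0)"
  proof (rule sum.cong[OF refl])
    fix Q assume "Q \<in> cyls n"
    then have "x \<in> Q \<longleftrightarrow> Q = cyl n x"
      using cyl_eq_if_in self_in_cyl by (auto simp: cyls_def)
    then show "c Q * indicator Q x = (if Q = cyl n x then c Q else 0)"
      by (simp add: indicator_def)
  qed
  also have "\<dots> = c (cyl n x)" using finite_cyls by (simp add: cyls_def)
  finally show ?thesis .
qed

lemma cyl_constant_eq_sum:
  assumes "cyl_constant n \<phi>"
  shows "\<phi> = (\<lambda>x. \<Sum>Q\<in>cyls n. value_on \<phi> Q * indicator Q x)"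
proof
  fix x
  have "value_on \<phi> (cyl n x) = \<phi> x"
    using value_on_eq[OF assms] self_in_cyl by (auto simp: cyls_def)
  then show "\<phi> x = (\<Sum>Q\<in>cyls n. value_on \<phi> Q * indicator Q x)"
    by (simp add: sum_indicator_cyls)
qed

context ratio_measure
begin

lemma space_mu: "space \<mu> = UNIV"
  using sets_eq_imp_space_eq[OF sets_mu] by simp

lemma integrable_indicator_borel: "A \<in> sets borel \<Longrightarrow> integrable \<mu> (indicator A :: _ \<Rightarrow> real)"
  using borel_sets by (simp add: emeasure_eq_measure)

lemma integrable_indicator_mult:
  "integrable \<mu> f \<Longrightarrow> A \<in> sets borel \<Longrightarrow> integrable \<mu> (\<lambda>x. indicator A x * f x :: real)"
  using integrable_mult_indicator[of A \<mu> f] borel_sets by simp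

lemma integral_indicator_borel: "A \<in> sets borel \<Longrightarrow> (\<integral>x. indicator A x \<partial>\<mu>) = m A"
  using borel_sets by simp

lemma cyl_constant_integrable:
  assumes "cyl_constant n \<phi>"
  shows "integrable \<mu> \<phi>"
proof -
  have "integrable \<mu> (\<lambda>x. \<Sum>Q\<in>cyls n. value_on \<phi> Q * indicator Q x)"
    using cyls_clopen integrable_indicator_borel by (intro Bochner_Integration.integrable_sum) auto
  then show ?thesis using cyl_constant_eq_sum[OF assms] by simp
qed

definition L1_approx :: "(cantor \<Rightarrow> real) \<Rightarrow> bool" where
  "L1_approx f \<longleftrightarrow> integrable \<mu> f \<and> (\<forall>d>0. \<exists>n \<phi>. cyl_constant n \<phi> \<and> (\<integral>x. \<bar>f x - \<phi> x\<bar> \<partial>\<mu>) < d)"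

lemma L1_triangle:
  assumes "integrable \<mu> f" "integrable \<mu> g" "integrable \<mu> h"
  shows "(\<integral>x. \<bar>f x - h x\<bar> \<partial>\<mu>) \<le> (\<integral>x. \<bar>f x - g x\<bar> \<partial>\<mu>) + (\<integral>x. \<bar>g x - h x :: real\<bar> \<partial>\<mu>)"
proof -
  have "(\<integral>x. \<bar>f x - h x\<bar> \<partial>\<mu>) \<le> (\<integral>x. \<bar>f x - g x\<bar> + \<bar>g x - h x\<bar> \<partial>\<mu>)"
    using assms by (intro integral_mono) auto
  also have "\<dots> = (\<integral>x. \<bar>f x - g x\<bar> \<partial>\<mu>) + (\<integral>x. \<bar>g x - h x\<bar> \<partial>\<mu>)"
    using assms by (intro Bochner_Integration.integral_add) auto
  finally show ?thesis .
qed

lemma L1_approx_limit: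
  assumes f: "integrable \<mu> f" and ap: "\<And>d. d > 0 \<Longrightarrow> \<exists>g. L1_approx g \<and> (\<integral>x. \<bar>f x - g x\<bar> \<partial>\<mu>) < d"
  shows "L1_approx f"
  unfolding L1_approx_def
proof (intro conjI allI impI)
  fix d :: real assume d: "d > 0"
  obtain g where g: "L1_approx g" "(\<integral>x. \<bar>f x - g x\<bar> \<partial>\<mu>) < d / 2" using ap[of "d / 2"] d by auto
  obtain n \<phi> where p: "cyl_constant n \<phi>" "(\<integral>x. \<bar>g x - \<phi> x\<bar> \<partial>\<mu>) < d / 2"
    using g(1) d unfolding L1_approx_def by (metis half_gt_zero)
  have "(\<integral>x. \<bar>f x - \<phi> x\<bar> \<partial>\<mu>) < d"
    using L1_triangle[OF f _ cyl_constant_integrable[OF p(1)], of g] g p by (simp add: L1_approx_def)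
  then show "\<exists>n \<phi>. cyl_constant n \<phi> \<and> (\<integral>x. \<bar>f x - \<phi> x\<bar> \<partial>\<mu>) < d" using p(1) by blast
qed (rule f)

lemma L1_approx_cyl_constant: "cyl_constant n \<phi> \<Longrightarrow> L1_approx \<phi>"
  unfolding L1_approx_def using cyl_constant_integrable by (auto intro!: exI[of _ n] exI[of _ \<phi>])

lemma L1_approx_add:
  assumes "L1_approx f" "L1_approx g"
  shows "L1_approx (\<lambda>x. f x + g x)"
  unfolding L1_approx_def
proof (intro conjI allI impI)
  have fg: "integrable \<mu> f" "integrable \<mu> g" using assms by (auto simp: L1_approx_def)
  then show "integrable \<mu> (\<lambda>x. f x + g x)" by simp
  fix d :: real assume d: "d > 0"
  obtain n \<phi> where p: "cyl_constant n \<phi>" "(\<integral>x. \<bar>f x - \<phi> x\<bar> \<partial>\<mu>) < d / 2"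
    using assms(1) d unfolding L1_approx_def by (metis half_gt_zero)
  obtain k \<psi> where q: "cyl_constant k \<psi>" "(\<integral>x. \<bar>g x - \<psi> x\<bar> \<partial>\<mu>) < d / 2"
    using assms(2) d unfolding L1_approx_def by (metis half_gt_zero)
  note i = fg cyl_constant_integrable[OF p(1)] cyl_constant_integrable[OF q(1)]
  have "(\<integral>x. \<bar>f x + g x - (\<phi> x + \<psi> x)\<bar> \<partial>\<mu>) \<le> (\<integral>x. \<bar>f x - \<phi> x\<bar> + \<bar>g x - \<psi> x\<bar> \<partial>\<mu>)"
    using i by (intro integral_mono) auto
  also have "\<dots> = (\<integral>x. \<bar>f x - \<phi> x\<bar> \<partial>\<mu>) + (\<integral>x. \<bar>g x - \<psi> x\<bar> \<partial>\<mu>)"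
    using i by (intro Bochner_Integration.integral_add) auto
  also have "\<dots> < d" using p q by simp
  finally show "\<exists>n \<phi>. cyl_constant n \<phi> \<and> (\<integral>x. \<bar>f x + g x - \<phi> x\<bar> \<partial>\<mu>) < d"
    using cyl_constant_add[OF p(1) q(1)] by blast
qed

lemma L1_approx_scale:
  assumes "L1_approx f"
  shows "L1_approx (\<lambda>x. c * f x)"
  unfolding L1_approx_def
proof (intro conjI allI impI)
  show "integrable \<mu> (\<lambda>x. c * f x)" using assms by (simp add: L1_approx_def)
  fix d :: real assume d: "d > 0"
  then have "d / (\<bar>c\<bar> + 1) > 0" by simp
  then obtain n \<phi> where p: "cyl_constant n \<phi>" "(\<integral>x. \<bar>f x - \<phi> x\<bar> \<partial>\<mu>) < d / (\<bar>c\<bar> + 1)"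
    using assms unfolding L1_approx_def by blast
  have "(\<integral>x. \<bar>c * f x - c * \<phi> x\<bar> \<partial>\<mu>) = (\<integral>x. \<bar>c\<bar> * \<bar>f x - \<phi> x\<bar> \<partial>\<mu>)"
    by (simp add: abs_mult[symmetric] right_diff_distrib)
  also have "\<dots> = \<bar>c\<bar> * (\<integral>x. \<bar>f x - \<phi> x\<bar> \<partial>\<mu>)" by simp
  also have "\<dots> \<le> \<bar>c\<bar> * (d / (\<bar>c\<bar> + 1))" using p(2) by (intro mult_left_mono) auto
  also have "\<dots> < d" using d by (simp add: field_simps)
  finally show "\<exists>n \<phi>. cyl_constant n \<phi> \<and> (\<integral>x. \<bar>c * f x - \<phi> x\<bar> \<partial>\<mu>) < d"
    using cyl_constant_scale[OF p(1)] by blast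
qed

lemma L1_approx_sum:
  assumes "\<And>i. i \<in> I \<Longrightarrow> L1_approx (f i)"
  shows "L1_approx (\<lambda>x. \<Sum>i\<in>I. f i x)"
proof (cases "finite I")
  case True
  then show ?thesis using assms
    by (induction I) (auto intro: L1_approx_add L1_approx_cyl_constant[OF cyl_constant_const])
qed (simp add: L1_approx_cyl_constant[OF cyl_constant_const])

text \<open>The sets whose indicators can be approximated form a Dynkin system, since the partial sums of
  a disjoint union of sets converge in \<open>L\<^sup>1\<close>.\<close>

lemma L1_approx_indicator:
  assumes "A \<in> sets borel"
  shows "L1_approx (indicator A)"
proof -
  have "Int_stable {U :: cantor set. clopen U}" by (auto simp: Int_stable_def)
  moreover have "{U :: cantor set. clopen U} \<subseteq> Pow UNIV" by simp
  moreover have "A \<in> sigma_sets UNIV {U. clopen U}" using assms sets_borel_clopen by simp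
  ultimately show ?thesis
  proof (induction rule: sigma_sets_induct_disjoint)
    case (basic A)
    then show ?case using clopen_decided[of A] cyl_constant_indicator L1_approx_cyl_constant by blast
  next
    case empty
    show ?case using L1_approx_cyl_constant[OF cyl_constant_const[of 0]] by (simp add: indicator_def)
  next
    case (compl A)
    have "L1_approx (\<lambda>x. 1 + (-1) * indicator A x)"
      by (intro L1_approx_add L1_approx_scale compl(2) L1_approx_cyl_constant[OF cyl_constant_const])
    moreover have "(\<lambda>x. 1 + (-1) * indicator A x) = (indicator (UNIV - A) :: _ \<Rightarrow> real)"
      by (auto simp: indicator_def)
    ultimately show ?case by simp
  next
    case (union A)
    have Ab: "A i \<in> sets borel" for i using union(2) sets_borel_clopen by blast
    then have UA: "\<Union>(range A) \<in> sets borel" by blast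
    show ?case
    proof (rule L1_approx_limit)
      show "integrable \<mu> (indicator (\<Union>(range A)) :: _ \<Rightarrow> real)"
        by (rule integrable_indicator_borel[OF UA])
      fix d :: real assume d: "d > 0"
      have "(\<lambda>i. m (A i)) sums m (\<Union>(range A))"
        using Ab borel_sets union(1) by (intro finite_measure_UNION) auto
      then have "(\<lambda>n. \<Sum>i<n. m (A i)) \<longlonglongrightarrow> m (\<Union>(range A))" by (simp add: sums_def)
      then obtain N where N: "\<bar>(\<Sum>i<N. m (A i)) - m (\<Union>(range A))\<bar> < d"
        using d unfolding LIMSEQ_iff by (metis real_norm_def le_refl)
      define g where "g = (\<lambda>x. \<Sum>i<N. indicator (A i) x :: real)"
      have "L1_approx g" unfolding g_def by (intro L1_approx_sum union(3))
      have geq: "g = indicator (\<Union>i<N. A i)"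
        using union(1) unfolding g_def
        by (intro ext indicator_UN_disjoint[symmetric]) (auto simp: disjoint_family_on_def)
      have "(\<integral>x. \<bar>indicator (\<Union>(range A)) x - g x\<bar> \<partial>\<mu>) = (\<integral>x. indicator (\<Union>(range A)) x - g x \<partial>\<mu>)"
        unfolding geq by (intro Bochner_Integration.integral_cong) (auto simp: indicator_def)
      also have "\<dots> = m (\<Union>(range A)) - (\<Sum>i<N. m (A i))"
        using Ab UA integrable_indicator_borel integral_indicator_borel
        by (simp add: g_def Bochner_Integration.integral_sum)
      also have "\<dots> < d" using N by simp
      finally show "\<exists>g. L1_approx g \<and> (\<integral>x. \<bar>indicator (\<Union>(range A)) x - g x\<bar> \<partial>\<mu>) < d"
        using \<open>L1_approx g\<close> by blast
    qed
  qed
qed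

theorem L1_approx_integrable:
  assumes "integrable \<mu> f"
  shows "L1_approx f"
  using assms
proof (induction rule: integrable_induct)
  case (base A c)
  then have "A \<in> sets borel" using sets_mu by simp
  then show ?case using L1_approx_scale[OF L1_approx_indicator, of A c] by (simp add: mult.commute)
next
  case (add f g)
  then show ?case by (intro L1_approx_add)
next
  case (lim f s)
  show ?case
  proof (rule L1_approx_limit[OF lim(4)])
    fix d :: real assume d: "d > 0"
    have "(\<lambda>i. \<integral>x. \<bar>f x - s i x\<bar> \<partial>\<mu>) \<longlonglongrightarrow> (\<integral>x. 0 \<partial>\<mu>)"
    proof (rule integral_dominated_convergence[where w = "\<lambda>x. 3 * \<bar>f x\<bar>"])
      show "integrable \<mu> (\<lambda>x. 3 * \<bar>f x\<bar>)" using lim(4) by simp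
      show "AE x in \<mu>. (\<lambda>i. \<bar>f x - s i x\<bar>) \<longlonglongrightarrow> 0"
      proof (rule AE_I2)
        fix x assume "x \<in> space \<mu>"
        then have "(\<lambda>i. \<bar>f x - s i x\<bar>) \<longlonglongrightarrow> \<bar>f x - f x\<bar>" using lim(2) by (intro tendsto_intros)
        then show "(\<lambda>i. \<bar>f x - s i x\<bar>) \<longlonglongrightarrow> 0" by simp
      qed
      show "AE x in \<mu>. norm \<bar>f x - s i x\<bar> \<le> 3 * \<bar>f x\<bar>" for i
      proof (rule AE_I2)
        fix x assume "x \<in> space \<mu>"
        then have "\<bar>s i x\<bar> \<le> 2 * \<bar>f x\<bar>" using lim(3) by simp
        then show "norm \<bar>f x - s i x\<bar> \<le> 3 * \<bar>f x\<bar>" by simp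
      qed
    qed (use lim(1,4) in auto)
    then have "(\<lambda>i. \<integral>x. \<bar>f x - s i x\<bar> \<partial>\<mu>) \<longlonglongrightarrow> 0" by simp
    then obtain N where "\<bar>\<integral>x. \<bar>f x - s N x\<bar> \<partial>\<mu>\<bar> < d"
      using d unfolding LIMSEQ_iff by (metis real_norm_def diff_zero le_refl)
    then show "\<exists>g. L1_approx g \<and> (\<integral>x. \<bar>f x - g x\<bar> \<partial>\<mu>) < d" using lim(5) by force
  qed
qed

text \<open>The derivative is finite almost everywhere, so its real version still represents the measure
  of the images.\<close>

lemma RN_D_properties:
  assumes g: "g \<in> H_bac \<mu>"
  shows "RN_D \<mu> g \<in> borel_measurable \<mu>" "integrable \<mu> (RN_D \<mu> g)"
    "\<And>A. A \<in> sets borel \<Longrightarrow> (\<integral>x. indicator A x * RN_D \<mu> g x \<partial>\<mu>) = m (g ` A)"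
proof -
  define \<nu> where "\<nu> = distr \<mu> borel (finv g)"
  have cont: "continuous_on UNIV (finv g)" using H_homeo[OF g] by (simp add: homeomorphism_def)
  have meas: "finv g \<in> \<mu> \<rightarrow>\<^sub>M borel"
    using borel_measurable_continuous_onI[OF cont] measurable_cong_sets[OF sets_mu refl] by blast
  have nu: "emeasure \<nu> A = emeasure \<mu> (g ` A)" if "A \<in> sets borel" for A
  proof -
    have "finv g -` A \<inter> space \<mu> = g ` A"
      using bij_vimage_eq_inv_image[OF bij_imp_bij_inv[OF H_bij[OF g]]] inv_inv_eq[OF H_bij[OF g]]
      by (simp add: space_mu)
    then show ?thesis unfolding \<nu>_def using emeasure_distr[OF meas that] by simp
  qed
  have snu: "sets \<nu> = sets \<mu>" unfolding \<nu>_def using sets_mu by simp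
  have ac: "absolutely_continuous \<mu> \<nu>"
    unfolding absolutely_continuous_def
  proof
    fix A assume A: "A \<in> null_sets \<mu>"
    then have "A \<in> sets borel" "m A = 0" using sets_mu by (auto simp: null_sets_def measure_def)
    then have "m (g ` A) = 0" using H_null[OF g] by simp
    then show "A \<in> null_sets \<nu>"
      using nu[OF \<open>A \<in> sets borel\<close>] A snu by (auto simp: null_sets_def emeasure_eq_measure)
  qed
  interpret nu: prob_space \<nu> unfolding \<nu>_def by (rule prob_space_distr[OF meas])
  have dens: "density \<mu> (RN_deriv \<mu> \<nu>) = \<nu>" using density_RN_deriv[OF ac snu] .
  have fin: "AE x in \<mu>. RN_deriv \<mu> \<nu> x \<noteq> \<infinity>"
    using RN_deriv_finite[OF nu.sigma_finite_measure_axioms ac snu] .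
  have D: "RN_D \<mu> g = (\<lambda>x. enn2real (RN_deriv \<mu> \<nu> x))" by (simp add: RN_D_def \<nu>_def)
  show mD: "RN_D \<mu> g \<in> borel_measurable \<mu>" unfolding D by measurable
  have key: "integrable \<mu> (\<lambda>x. indicator A x * RN_D \<mu> g x) \<and>
      (\<integral>x. indicator A x * RN_D \<mu> g x \<partial>\<mu>) = m (g ` A)" if A: "A \<in> sets borel" for A
  proof -
    have Am: "A \<in> sets \<mu>" using A sets_mu by simp
    have "(\<integral>\<^sup>+x. ennreal (indicator A x * RN_D \<mu> g x) \<partial>\<mu>) = (\<integral>\<^sup>+x. RN_deriv \<mu> \<nu> x * indicator A x \<partial>\<mu>)"
      using fin by (intro nn_integral_cong_AE, eventually_elim)
        (auto simp: D indicator_def less_top)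
    also have "\<dots> = emeasure (density \<mu> (RN_deriv \<mu> \<nu>)) A"
      using Am by (intro emeasure_density[symmetric]) auto
    also have "\<dots> = ennreal (m (g ` A))" unfolding dens nu[OF A] by (rule emeasure_eq_measure)
    finally have e: "(\<integral>\<^sup>+x. ennreal (indicator A x * RN_D \<mu> g x) \<partial>\<mu>) = ennreal (m (g ` A))" .
    have nn: "AE x in \<mu>. 0 \<le> indicator A x * RN_D \<mu> g x" by (simp add: D)
    have ms: "(\<lambda>x. indicator A x * RN_D \<mu> g x) \<in> borel_measurable \<mu>" using mD Am by measurable
    show ?thesis using nn_integral_eq_integrable[OF ms nn measure_nonneg] e by blast
  qed
  show "(\<integral>x. indicator A x * RN_D \<mu> g x \<partial>\<mu>) = m (g ` A)" if "A \<in> sets borel" for A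
    using key[OF that] by simp
  show "integrable \<mu> (RN_D \<mu> g)" using key[of UNIV] by simp
qed

text \<open>By \<open>near_rho\<close> and \<open>rho_near\<close> this is, up to a factor of two, a bound on the \<open>L\<^sup>1\<close> distance of
  the derivatives. Stated with measures of images, its invariance under right translations is evident.\<close>

definition near :: "real \<Rightarrow> (cantor \<Rightarrow> cantor) \<Rightarrow> (cantor \<Rightarrow> cantor) \<Rightarrow> bool" where
  "near e g h \<longleftrightarrow> (\<forall>A\<in>sets borel. \<bar>m (g ` A) - m (h ` A)\<bar> \<le> e)"

lemma near_rho:
  assumes g: "g \<in> H_bac \<mu>" and h: "h \<in> H_bac \<mu>"
  shows "near (rho_ac \<mu> g h) g h"
  unfolding near_def rho_ac_def
proof
  fix A :: "cantor set" assume A: "A \<in> sets borel"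
  let ?d = "\<lambda>x. RN_D \<mu> g x - RN_D \<mu> h x"
  have i: "integrable \<mu> ?d" using RN_D_properties(2) g h by simp
  have "m (g ` A) - m (h ` A) = (\<integral>x. indicator A x * ?d x \<partial>\<mu>)"
    using RN_D_properties(2,3)[OF g] RN_D_properties(2,3)[OF h] A
    by (simp add: right_diff_distrib integrable_indicator_mult)
  then have "\<bar>m (g ` A) - m (h ` A)\<bar> \<le> (\<integral>x. \<bar>indicator A x * ?d x\<bar> \<partial>\<mu>)"
    using integral_abs_bound by simp
  also have "\<dots> \<le> (\<integral>x. \<bar>?d x\<bar> \<partial>\<mu>)"
    using i A by (intro integral_mono integrable_abs integrable_indicator_mult) (auto simp: indicator_def)
  finally show "\<bar>m (g ` A) - m (h ` A)\<bar> \<le> (\<integral>x. \<bar>?d x\<bar> \<partial>\<mu>)" .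
qed

text \<open>Both derivatives have integral one, so the distance is controlled by the set where the first
  exceeds the second and by its complement.\<close>

lemma rho_near:
  assumes g: "g \<in> H_bac \<mu>" and h: "h \<in> H_bac \<mu>" and n: "near e g h"
  shows "rho_ac \<mu> g h \<le> 2 * e"
proof -
  let ?g = "RN_D \<mu> g" and ?h = "RN_D \<mu> h"
  define A where "A = {x. ?g x > ?h x}"
  have A: "A \<in> sets borel"
  proof -
    have "{x \<in> space \<mu>. ?h x < ?g x} \<in> sets \<mu>"
      using RN_D_properties(1)[OF g] RN_D_properties(1)[OF h] by measurable
    then show ?thesis unfolding A_def using sets_mu by (simp add: space_mu)
  qed
  then have A': "- A \<in> sets borel" by auto
  note ig = RN_D_properties(2)[OF g] and ih = RN_D_properties(2)[OF h]
  note i = integrable_indicator_mult[OF ig] integrable_indicator_mult[OF ih]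
  have "rho_ac \<mu> g h = (\<integral>x. (indicator A x * ?g x - indicator A x * ?h x)
      + (indicator (- A) x * ?h x - indicator (- A) x * ?g x) \<partial>\<mu>)"
    unfolding rho_ac_def A_def
    by (intro Bochner_Integration.integral_cong) (auto simp: indicator_def)
  also have "\<dots> = (m (g ` A) - m (h ` A)) + (m (h ` (- A)) - m (g ` (- A)))"
    using i A A' RN_D_properties(3)[OF g] RN_D_properties(3)[OF h] by simp
  also have "\<dots> \<le> e + e"
    using n A A' unfolding near_def by (intro add_mono) (force simp: abs_le_iff)+
  finally show ?thesis by simp
qed

text \<open>The sum is the integral over \<open>A\<close> of the conditional expectation of the derivative of \<open>g\<close> with
  respect to the cylinders of level \<open>k\<close>. Conditional expectation contracts the \<open>L\<^sup>1\<close> norm and fixes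
  functions that are constant on these cylinders; so if the derivative is within \<open>d / 2\<close> of such a
  function, it is within \<open>d\<close> of its conditional expectation.\<close>

theorem conditional_expectation_approx:
  assumes g: "g \<in> H_bac \<mu>" and d: "d > 0"
  shows "\<exists>n. \<forall>k\<ge>n. \<forall>A\<in>sets borel.
    \<bar>m (g ` A) - (\<Sum>Q\<in>cyls k. m (g ` Q) / m Q * m (A \<inter> Q))\<bar> \<le> d"
proof -
  let ?f = "RN_D \<mu> g"
  have fi: "integrable \<mu> ?f" using RN_D_properties(2)[OF g] .
  obtain n \<phi> where p: "cyl_constant n \<phi>" "(\<integral>x. \<bar>?f x - \<phi> x\<bar> \<partial>\<mu>) < d / 2"
    using L1_approx_integrable[OF fi] d unfolding L1_approx_def by (metis half_gt_zero)
  have ip: "integrable \<mu> \<phi>" using cyl_constant_integrable[OF p(1)] .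
  have "\<bar>m (g ` A) - (\<Sum>Q\<in>cyls k. m (g ` Q) / m Q * m (A \<inter> Q))\<bar> \<le> d"
    if k: "k \<ge> n" and A: "A \<in> sets borel" for k A
  proof -
    have pk: "cyl_constant k \<phi>" using cyl_constant_mono[OF p(1) k] .
    let ?c = "value_on \<phi>"
    have bor: "Q \<in> sets borel" if "Q \<in> cyls k" for Q using cyls_clopen[OF that] by auto
    have int_phi: "(\<integral>x. indicator S x * \<phi> x \<partial>\<mu>) = (\<Sum>Q\<in>cyls k. ?c Q * m (S \<inter> Q))"
      if S: "S \<in> sets borel" for S
    proof -
      have "(\<integral>x. indicator S x * \<phi> x \<partial>\<mu>) = (\<integral>x. (\<Sum>Q\<in>cyls k. ?c Q * indicator (S \<inter> Q) x) \<partial>\<mu>)"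
        by (subst cyl_constant_eq_sum[OF pk])
          (simp add: sum_distrib_left indicator_inter_arith mult_ac)
      also have "\<dots> = (\<Sum>Q\<in>cyls k. ?c Q * m (S \<inter> Q))"
        using bor S by (subst Bochner_Integration.integral_sum)
          (auto intro!: integrable_mult_right integrable_indicator_borel sum.cong simp: integral_indicator_borel space_mu)
      finally show ?thesis .
    qed
    have diff: "m (g ` S) - (\<integral>x. indicator S x * \<phi> x \<partial>\<mu>) = (\<integral>x. indicator S x * (?f x - \<phi> x) \<partial>\<mu>)"
      if "S \<in> sets borel" for S
      using RN_D_properties(3)[OF g that] integrable_indicator_mult[OF fi that]
        integrable_indicator_mult[OF ip that] by (simp add: right_diff_distrib)
    have absle: "\<bar>m (g ` S) - (\<integral>x. indicator S x * \<phi> x \<partial>\<mu>)\<bar> \<le> (\<integral>x. indicator S x * \<bar>?f x - \<phi> x\<bar> \<partial>\<mu>)"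
      if "S \<in> sets borel" for S
    proof -
      have "\<bar>\<integral>x. indicator S x * (?f x - \<phi> x) \<partial>\<mu>\<bar> \<le> (\<integral>x. \<bar>indicator S x * (?f x - \<phi> x)\<bar> \<partial>\<mu>)"
        by (rule integral_abs_bound)
      also have "\<dots> = (\<integral>x. indicator S x * \<bar>?f x - \<phi> x\<bar> \<partial>\<mu>)" by (simp add: abs_mult)
      finally show ?thesis unfolding diff[OF that] .
    qed
    have iabs: "integrable \<mu> (\<lambda>x. \<bar>?f x - \<phi> x\<bar>)" using fi ip by simp
    have tot: "(\<Sum>Q\<in>cyls k. \<integral>x. indicator Q x * \<bar>?f x - \<phi> x\<bar> \<partial>\<mu>) = (\<integral>x. \<bar>?f x - \<phi> x\<bar> \<partial>\<mu>)"
    proof -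
      have "(\<Sum>Q\<in>cyls k. \<integral>x. indicator Q x * \<bar>?f x - \<phi> x\<bar> \<partial>\<mu>)
          = (\<integral>x. (\<Sum>Q\<in>cyls k. indicator Q x * \<bar>?f x - \<phi> x\<bar>) \<partial>\<mu>)"
        using bor by (intro Bochner_Integration.integral_sum[symmetric] integrable_indicator_mult iabs)
      also have "(\<lambda>x. \<Sum>Q\<in>cyls k. indicator Q x * \<bar>?f x - \<phi> x\<bar>) = (\<lambda>x. \<bar>?f x - \<phi> x\<bar>)"
        using sum_indicator_cyls[where c = "\<lambda>Q. 1" and n = k] by (simp add: sum_distrib_right[symmetric])
      finally show ?thesis .
    qed
    have 1: "\<bar>m (g ` A) - (\<Sum>Q\<in>cyls k. ?c Q * m (A \<inter> Q))\<bar> \<le> d / 2"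
    proof -
      have "(\<integral>x. indicator A x * \<bar>?f x - \<phi> x\<bar> \<partial>\<mu>) \<le> (\<integral>x. \<bar>?f x - \<phi> x\<bar> \<partial>\<mu>)"
        using iabs A by (intro integral_mono integrable_indicator_mult) (auto simp: indicator_def)
      then show ?thesis using absle[OF A] p(2) unfolding int_phi[OF A] by linarith
    qed
    have "\<bar>\<Sum>Q\<in>cyls k. (?c Q - m (g ` Q) / m Q) * m (A \<inter> Q)\<bar> \<le> (\<Sum>Q\<in>cyls k. \<bar>(?c Q - m (g ` Q) / m Q) * m (A \<inter> Q)\<bar>)"
      by (rule sum_abs)
    also have "\<dots> \<le> (\<Sum>Q\<in>cyls k. \<integral>x. indicator Q x * \<bar>?f x - \<phi> x\<bar> \<partial>\<mu>)"
    proof (rule sum_mono)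
      fix Q assume Q: "Q \<in> cyls k"
      have pos: "m Q > 0" using clopen_pos cyls_clopen[OF Q] cyls_nonempty[OF Q] by blast
      have iQ: "(\<integral>x. indicator Q x * \<phi> x \<partial>\<mu>) = ?c Q * m Q"
      proof -
        have "(\<integral>x. indicator Q x * \<phi> x \<partial>\<mu>) = (\<integral>x. ?c Q * indicator Q x \<partial>\<mu>)"
          using value_on_eq[OF pk Q]
          by (intro Bochner_Integration.integral_cong) (auto simp: indicator_def)
        then show ?thesis using integral_indicator_borel[OF bor[OF Q]] by simp
      qed
      have "m (A \<inter> Q) \<le> m Q" using borel_sets[OF bor[OF Q]] by (intro finite_measure_mono) auto
      then have "\<bar>(?c Q - m (g ` Q) / m Q) * m (A \<inter> Q)\<bar> \<le> \<bar>?c Q - m (g ` Q) / m Q\<bar> * m Q"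
        by (simp add: abs_mult mult_left_mono)
      also have "\<dots> = \<bar>(?c Q - m (g ` Q) / m Q) * m Q\<bar>" using pos by (simp add: abs_mult)
      also have "\<dots> = \<bar>m (g ` Q) - ?c Q * m Q\<bar>" using pos by (simp add: left_diff_distrib abs_minus_commute)
      also have "\<dots> \<le> (\<integral>x. indicator Q x * \<bar>?f x - \<phi> x\<bar> \<partial>\<mu>)" using absle[OF bor[OF Q]] unfolding iQ .
      finally show "\<bar>(?c Q - m (g ` Q) / m Q) * m (A \<inter> Q)\<bar> \<le> (\<integral>x. indicator Q x * \<bar>?f x - \<phi> x\<bar> \<partial>\<mu>)" .
    qed
    also have "\<dots> \<le> d / 2" using tot p(2) by simp
    finally have "\<bar>\<Sum>Q\<in>cyls k. (?c Q - m (g ` Q) / m Q) * m (A \<inter> Q)\<bar> \<le> d / 2" .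
    then have "\<bar>(\<Sum>Q\<in>cyls k. ?c Q * m (A \<inter> Q)) - (\<Sum>Q\<in>cyls k. m (g ` Q) / m Q * m (A \<inter> Q))\<bar> \<le> d / 2"
      by (simp add: left_diff_distrib sum_subtractf)
    then show ?thesis using 1 by linarith
  qed
  then show ?thesis by blast
qed

section \<open>The topology of the group\<close>

lemma near_sym: "near e g h \<Longrightarrow> near e h g"
  by (simp add: near_def abs_minus_commute)

lemma near_mono: "near d g h \<Longrightarrow> d \<le> e \<Longrightarrow> near e g h"
  by (meson near_def order_trans)

lemma near_trans: "near d g h \<Longrightarrow> near e h k \<Longrightarrow> near (d + e) g k"
  unfolding near_def by (fastforce simp: abs_le_iff)

lemma near_comp_right:
  assumes "near e g h" "k \<in> H_bac \<mu>"
  shows "near e (g \<circ> k) (h \<circ> k)"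
  using assms(1) H_borel[OF assms(2)] unfolding near_def image_comp[symmetric] by blast

text \<open>Left translation by \<open>x\<close> weights a set with the derivative of \<open>x\<close>, which may be replaced by
  constants \<open>c Q\<close> on finitely many cylinders \<open>Q\<close>. If \<open>z\<close> and \<open>y\<close> map the same clopen set onto \<open>Q\<close>,
  then the parts of \<open>z ` A\<close> and \<open>y ` A\<close> inside \<open>Q\<close> are images of the same part of \<open>A\<close>, and their
  measures differ by at most \<open>d\<close>.\<close>

lemma near_comp_leftE:
  assumes x: "x \<in> H_bac \<mu>" and y: "y \<in> H_bac \<mu>" and e: "e > 0"
  obtains F d where "finite F" "\<forall>P\<in>F. clopen P" "d > 0"
    "\<forall>z\<in>H_bac \<mu>. (\<forall>P\<in>F. z ` P = y ` P) \<longrightarrow> near d z y \<longrightarrow> near e (x \<circ> z) (x \<circ> y)"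
proof -
  have "e / 3 > 0" using e by simp
  from conditional_expectation_approx[OF x this] obtain n where
    n: "\<And>A. A \<in> sets borel \<Longrightarrow>
      \<bar>m (x ` A) - (\<Sum>Q\<in>cyls n. m (x ` Q) / m Q * m (A \<inter> Q))\<bar> \<le> e / 3"
    by blast
  define c where "c Q = m (x ` Q) / m Q" for Q
  have c0: "c Q \<ge> 0" for Q by (simp add: c_def)
  define C where "C = (\<Sum>Q\<in>cyls n. c Q)"
  have C0: "C \<ge> 0" unfolding C_def by (intro sum_nonneg c0)
  \<comment> \<open>The error \<open>C * d\<close> must stay below \<open>e / 3\<close>; adding 1 avoids a case distinction for \<open>C = 0\<close>.\<close>
  define d where "d = e / (3 * (C + 1))"
  have d0: "d > 0" using e C0 by (simp add: d_def)
  have Cd: "C * d \<le> e / 3" using C0 e by (simp add: d_def field_simps)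
  define F where "F = (\<lambda>Q. finv y ` Q) ` cyls n"
  have fin: "finite F" unfolding F_def using finite_cyls by simp
  have clF: "\<forall>P\<in>F. clopen P" unfolding F_def using H_clopen[OF H_inv[OF y]] cyls_clopen by blast
  have "near e (x \<circ> z) (x \<circ> y)" if z: "z \<in> H_bac \<mu>" "\<forall>P\<in>F. z ` P = y ` P" "near d z y" for z
    unfolding near_def
  proof
    fix A :: "cantor set" assume A: "A \<in> sets borel"
    let ?S = "\<lambda>B. \<Sum>Q\<in>cyls n. c Q * m (B \<inter> Q)"
    have piece: "\<bar>m (z ` A \<inter> Q) - m (y ` A \<inter> Q)\<bar> \<le> d" if Q: "Q \<in> cyls n" for Q
    proof -
      let ?P = "finv y ` Q"
      have yP: "y ` ?P = Q" using H_image_inv[OF y] .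
      have zP: "z ` ?P = Q" using z(2) Q yP by (auto simp: F_def)
      have "z ` A \<inter> Q = z ` (A \<inter> ?P)" "y ` A \<inter> Q = y ` (A \<inter> ?P)"
        using image_Int[OF H_inj[OF z(1)]] image_Int[OF H_inj[OF y]] zP yP by auto
      moreover have "A \<inter> ?P \<in> sets borel"
        using A H_clopen[OF H_inv[OF y] cyls_clopen[OF Q]] by auto
      ultimately show ?thesis using z(3) by (simp add: near_def)
    qed
    have "\<bar>?S (z ` A) - ?S (y ` A)\<bar> = \<bar>\<Sum>Q\<in>cyls n. c Q * (m (z ` A \<inter> Q) - m (y ` A \<inter> Q))\<bar>"
      by (simp add: sum_subtractf right_diff_distrib)
    also have "\<dots> \<le> (\<Sum>Q\<in>cyls n. c Q * d)"
      using piece c0 by (intro order_trans[OF sum_abs] sum_mono) (auto simp: abs_mult intro: mult_left_mono)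
    also have "\<dots> = C * d" by (simp add: C_def sum_distrib_right)
    finally have "\<bar>?S (z ` A) - ?S (y ` A)\<bar> \<le> e / 3" using Cd by linarith
    moreover have "\<bar>m (x ` (z ` A)) - ?S (z ` A)\<bar> \<le> e / 3"
      using n[OF H_borel[OF z(1) A]] by (simp add: c_def)
    moreover have "\<bar>m (x ` (y ` A)) - ?S (y ` A)\<bar> \<le> e / 3"
      using n[OF H_borel[OF y A]] by (simp add: c_def)
    ultimately show "\<bar>m ((x \<circ> z) ` A) - m ((x \<circ> y) ` A)\<bar> \<le> e"
      unfolding image_comp[symmetric] by linarith
  qed
  then show thesis using that[OF fin clF d0] by blast
qed

definition nbhd :: "(cantor \<Rightarrow> cantor) \<Rightarrow> cantor set set \<Rightarrow> real \<Rightarrow> (cantor \<Rightarrow> cantor) set" where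
  "nbhd f F e = {g \<in> H_bac \<mu>. (\<forall>P\<in>F. g ` P = f ` P) \<and> near e g f}"

text \<open>Open sets are described without a subbasis: they are the sets that contain, around each of their
  points, one of the sets \<open>nbhd f F e\<close>; see \<open>openin_tau_ac_iff\<close>.\<close>

definition locally_nbhd :: "(cantor \<Rightarrow> cantor) set \<Rightarrow> bool" where
  "locally_nbhd U \<longleftrightarrow> (\<forall>f\<in>U \<inter> H_bac \<mu>. \<exists>F e. finite F \<and> (\<forall>P\<in>F. clopen P) \<and> e > 0 \<and> nbhd f F e \<subseteq> U)"

lemma nbhdI: "g \<in> H_bac \<mu> \<Longrightarrow> (\<And>P. P \<in> F \<Longrightarrow> g ` P = f ` P) \<Longrightarrow> near e g f \<Longrightarrow> g \<in> nbhd f F e"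
  by (simp add: nbhd_def)

lemma nbhdD:
  assumes "g \<in> nbhd f F e"
  shows "g \<in> H_bac \<mu>" "\<And>P. P \<in> F \<Longrightarrow> g ` P = f ` P" "near e g f"
  using assms by (auto simp: nbhd_def)

lemma nbhd_mono: "F \<subseteq> G \<Longrightarrow> d \<le> e \<Longrightarrow> nbhd f G d \<subseteq> nbhd f F e"
  unfolding nbhd_def by (auto intro: near_mono simp: subset_iff)

lemma locally_nbhdI:
  assumes "\<And>f. f \<in> U \<Longrightarrow> f \<in> H_bac \<mu> \<Longrightarrow>
    \<exists>F e. finite F \<and> (\<forall>P\<in>F. clopen P) \<and> e > 0 \<and> nbhd f F e \<subseteq> U"
  shows "locally_nbhd U"
  unfolding locally_nbhd_def using assms by simp

lemma locally_nbhdE: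
  assumes "locally_nbhd U" "f \<in> U" "f \<in> H_bac \<mu>"
  obtains F e where "finite F" "\<forall>P\<in>F. clopen P" "e > 0" "nbhd f F e \<subseteq> U"
proof -
  have "\<exists>F e. finite F \<and> (\<forall>P\<in>F. clopen P) \<and> e > 0 \<and> nbhd f F e \<subseteq> U"
    using assms by (simp add: locally_nbhd_def)
  then show thesis using that by (elim exE conjE)
qed

lemma locally_nbhd_Int:
  assumes "locally_nbhd U" "locally_nbhd V"
  shows "locally_nbhd (U \<inter> V)"
proof (rule locally_nbhdI)
  fix f assume f: "f \<in> U \<inter> V" "f \<in> H_bac \<mu>"
  obtain F d where F: "finite F" "\<forall>P\<in>F. clopen P" "d > 0" "nbhd f F d \<subseteq> U"
    by (rule locally_nbhdE[OF assms(1) IntD1[OF f(1)] f(2)])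
  obtain G e where G: "finite G" "\<forall>P\<in>G. clopen P" "e > 0" "nbhd f G e \<subseteq> V"
    by (rule locally_nbhdE[OF assms(2) IntD2[OF f(1)] f(2)])
  have "nbhd f (F \<union> G) (min d e) \<subseteq> nbhd f F d" "nbhd f (F \<union> G) (min d e) \<subseteq> nbhd f G e"
    by (rule nbhd_mono; simp)+
  then have "nbhd f (F \<union> G) (min d e) \<subseteq> U \<inter> V" using F(4) G(4) by blast
  moreover have "finite (F \<union> G)" "\<forall>P\<in>F \<union> G. clopen P" "min d e > 0" using F G by auto
  ultimately show "\<exists>F e. finite F \<and> (\<forall>P\<in>F. clopen P) \<and> e > 0 \<and> nbhd f F e \<subseteq> U \<inter> V"
    by (intro exI conjI)
qed

lemma locally_nbhd_Union:
  assumes "\<And>U. U \<in> \<U> \<Longrightarrow> locally_nbhd U"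
  shows "locally_nbhd (\<Union>\<U>)"
proof (rule locally_nbhdI)
  fix f assume "f \<in> \<Union>\<U>" and f: "f \<in> H_bac \<mu>"
  then obtain U where U: "U \<in> \<U>" "f \<in> U" by blast
  obtain F e where F: "finite F" "\<forall>P\<in>F. clopen P" "e > 0" "nbhd f F e \<subseteq> U"
    by (rule locally_nbhdE[OF assms[OF U(1)] U(2) f])
  have "nbhd f F e \<subseteq> \<Union>\<U>" using F(4) U(1) by blast
  then show "\<exists>F e. finite F \<and> (\<forall>P\<in>F. clopen P) \<and> e > 0 \<and> nbhd f F e \<subseteq> \<Union>\<U>"
    using F by (intro exI conjI)
qed

lemma locally_nbhd_generate:
  assumes "generate_topology_on \<S> U" "\<And>S. S \<in> \<S> \<Longrightarrow> locally_nbhd S"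
  shows "locally_nbhd U"
  using assms
proof induction
  case Empty
  show ?case by (simp add: locally_nbhd_def)
next
  case (Int a b)
  then show ?case using locally_nbhd_Int by blast
next
  case (UN K)
  then show ?case using locally_nbhd_Union by blast
next
  case (Basis s)
  then show ?case by blast
qed

lemma H_continuous: "f \<in> H_bac \<mu> \<Longrightarrow> continuous_on UNIV f"
  using H_homeo by (auto simp: homeomorphism_def)

text \<open>If \<open>f ` C\<close> lies in \<open>W\<close>, interpolate a clopen set \<open>Q\<close>. Every \<open>g\<close> that agrees with \<open>f\<close> on the
  clopen preimage of \<open>Q\<close> also maps \<open>C\<close> into \<open>W\<close>.\<close>

lemma locally_nbhd_compact_open:
  assumes "openin (subtopology compact_open_topology (H_bac \<mu>)) U"
  shows "locally_nbhd U" "U \<subseteq> H_bac \<mu>"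
proof -
  obtain T where T: "generate_topology_on {{f. f ` C \<subseteq> W} | C W. compact C \<and> open W} T"
      "U = T \<inter> {f. continuous_on UNIV f} \<inter> H_bac \<mu>"
    using assms unfolding compact_open_topology_def openin_subtopology openin_topology_generated_by_iff
    by blast
  have "locally_nbhd {f. f ` C \<subseteq> W}" if CW: "compact C" "open W" for C W :: "cantor set"
  proof (rule locally_nbhdI)
    fix f assume f: "f \<in> {f. f ` C \<subseteq> W}" and fH: "f \<in> H_bac \<mu>"
    have "compact (f ` C)"
      using H_continuous[OF fH] CW(1) by (metis compact_continuous_image continuous_on_subset subset_UNIV)
    then obtain Q where Q: "clopen Q" "f ` C \<subseteq> Q" "Q \<subseteq> W"
      using clopen_between[of "f ` C" W] f CW(2) by blast
    define P where "P = finv f ` Q"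
    have P: "clopen P" "f ` P = Q"
      using H_clopen[OF H_inv[OF fH] Q(1)] H_image_inv[OF fH] by (auto simp: P_def)
    have "C \<subseteq> P"
      using Q(2) P(2) H_inj[OF fH] by (metis inj_image_subset_iff)
    then have "nbhd f {P} 1 \<subseteq> {f. f ` C \<subseteq> W}"
      using P(2) Q(3) nbhdD(2)[of _ f "{P}" 1 P] by fastforce
    then show "\<exists>F e. finite F \<and> (\<forall>P\<in>F. clopen P) \<and> e > 0 \<and> nbhd f F e \<subseteq> {f. f ` C \<subseteq> W}"
      using P(1) by (intro exI[of _ "{P}"] exI[of _ 1]) auto
  qed
  then have T': "locally_nbhd T" using locally_nbhd_generate[OF T(1)] by blast
  have "U = T \<inter> H_bac \<mu>" using T(2) H_continuous by blast
  moreover have "locally_nbhd (H_bac \<mu>)"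
    by (rule locally_nbhdI) (auto intro!: exI[of _ "{}"] exI[of _ 1] dest: nbhdD(1))
  ultimately show "locally_nbhd U" using locally_nbhd_Int[OF T'] by simp
  show "U \<subseteq> H_bac \<mu>" using T(2) by blast
qed

lemma locally_nbhd_rho:
  assumes "openin (rho_ac_topology \<mu>) U"
  shows "locally_nbhd U" "U \<subseteq> H_bac \<mu>"
proof -
  have gen: "generate_topology_on {{h \<in> H_bac \<mu>. rho_ac \<mu> g h < \<epsilon>} | g \<epsilon>. g \<in> H_bac \<mu> \<and> \<epsilon> > 0} U"
    using assms unfolding rho_ac_topology_def openin_topology_generated_by_iff .
  have "locally_nbhd {h \<in> H_bac \<mu>. rho_ac \<mu> g h < r}" if g: "g \<in> H_bac \<mu>" for g r
  proof (rule locally_nbhdI)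
    fix f assume "f \<in> {h \<in> H_bac \<mu>. rho_ac \<mu> g h < r}"
    then have f: "f \<in> H_bac \<mu>" "rho_ac \<mu> g f < r" by auto
    define e where "e = (r - rho_ac \<mu> g f) / 3"
    have e: "e > 0" using f(2) by (simp add: e_def)
    have "rho_ac \<mu> g h < r" if h: "h \<in> nbhd f {} e" for h
    proof -
      have hH: "h \<in> H_bac \<mu>" "near e h f" using h by (auto simp: nbhd_def)
      have "rho_ac \<mu> g h \<le> rho_ac \<mu> g f + rho_ac \<mu> f h"
        unfolding rho_ac_def
        using RN_D_properties(2)[OF g] RN_D_properties(2)[OF f(1)] RN_D_properties(2)[OF hH(1)]
        by (rule L1_triangle)
      also have "rho_ac \<mu> f h \<le> 2 * e" using rho_near[OF f(1) hH(1) near_sym[OF hH(2)]] .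
      finally show ?thesis using e by (simp add: e_def field_simps)
    qed
    then have "nbhd f {} e \<subseteq> {h \<in> H_bac \<mu>. rho_ac \<mu> g h < r}" by (auto simp: nbhd_def)
    then show "\<exists>F e. finite F \<and> (\<forall>P\<in>F. clopen P) \<and> e > 0 \<and> nbhd f F e \<subseteq> {h \<in> H_bac \<mu>. rho_ac \<mu> g h < r}"
      using e by (intro exI[of _ "{}"] exI[of _ e]) auto
  qed
  then show "locally_nbhd U" using locally_nbhd_generate[OF gen] by blast
  have "U \<subseteq> topspace (rho_ac_topology \<mu>)" using openin_subset[OF assms] .
  also have "\<dots> \<subseteq> H_bac \<mu>" unfolding rho_ac_topology_def topology_generated_by_topspace by blast
  finally show "U \<subseteq> H_bac \<mu>" .
qed

text \<open>For bijections, \<open>g ` P = f ` P\<close> amounts to two inclusions, one for \<open>P\<close> and one for its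
  complement, and both are subbasic conditions of the compact-open topology.\<close>

lemma open_in_nbhd:
  assumes f: "f \<in> H_bac \<mu>" and F: "finite F" "\<forall>P\<in>F. clopen P" and e: "e > 0"
  shows "\<exists>W. openin (tau_ac \<mu>) W \<and> f \<in> W \<and> W \<subseteq> nbhd f F e"
proof -
  have basis: "openin (tau_ac \<mu>) U"
    if "openin (subtopology compact_open_topology (H_bac \<mu>)) U \<or> openin (rho_ac_topology \<mu>) U" for U
    unfolding tau_ac_def using that by (intro topology_generated_by_Basis) blast
  have co: "openin (tau_ac \<mu>) {g \<in> H_bac \<mu>. g ` C \<subseteq> W}" if "compact C" "open W" for C W :: "cantor set"
  proof -
    have "openin (topology_generated_by {{f. f ` C \<subseteq> U} | C U. compact C \<and> open U}) {g. g ` C \<subseteq> W}"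
      using that by (intro topology_generated_by_Basis) blast
    then have "openin compact_open_topology ({g. g ` C \<subseteq> W} \<inter> {f. continuous_on UNIV f})"
      unfolding compact_open_topology_def by (rule openin_subtopology_Int)
    then have "openin (subtopology compact_open_topology (H_bac \<mu>))
        ({g. g ` C \<subseteq> W} \<inter> {f. continuous_on UNIV f} \<inter> H_bac \<mu>)"
      by (rule openin_subtopology_Int)
    moreover have "{g. g ` C \<subseteq> W} \<inter> {f. continuous_on UNIV f} \<inter> H_bac \<mu> = {g \<in> H_bac \<mu>. g ` C \<subseteq> W}"
      using H_continuous by blast
    ultimately show ?thesis using basis by simp
  qed
  have one: "openin (tau_ac \<mu>) {g \<in> H_bac \<mu>. g ` P = f ` P}" if P: "clopen P" for P
  proof -
    have fP: "clopen (f ` P)" using H_clopen[OF f P] .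
    have comp: "compact P" "compact (- P)"
      using P compact_UNIV_cantor closed_Int_compact[of _ "UNIV :: cantor set"] by auto
    have "{g \<in> H_bac \<mu>. g ` P = f ` P} =
        {g \<in> H_bac \<mu>. g ` P \<subseteq> f ` P} \<inter> {g \<in> H_bac \<mu>. g ` (- P) \<subseteq> - (f ` P)}"
    proof (intro Set.equalityI subsetI)
      fix g assume g: "g \<in> {g \<in> H_bac \<mu>. g ` P = f ` P}"
      then have "g ` (- P) = - (g ` P)" by (intro bij_image_Compl_eq H_bij) simp
      then show "g \<in> {g \<in> H_bac \<mu>. g ` P \<subseteq> f ` P} \<inter> {g \<in> H_bac \<mu>. g ` (- P) \<subseteq> - (f ` P)}"
        using g by auto
    next
      fix g assume g: "g \<in> {g \<in> H_bac \<mu>. g ` P \<subseteq> f ` P} \<inter> {g \<in> H_bac \<mu>. g ` (- P) \<subseteq> - (f ` P)}"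
      then have "g ` (- P) = - (g ` P)" by (intro bij_image_Compl_eq H_bij) simp
      then show "g \<in> {g \<in> H_bac \<mu>. g ` P = f ` P}" using g by auto
    qed
    moreover have "openin (tau_ac \<mu>) ({g \<in> H_bac \<mu>. g ` P \<subseteq> f ` P} \<inter> {g \<in> H_bac \<mu>. g ` (- P) \<subseteq> - (f ` P)})"
      using comp fP by (intro openin_Int co) (auto simp: open_Compl)
    ultimately show ?thesis by simp
  qed
  have "openin (rho_ac_topology \<mu>) {h \<in> H_bac \<mu>. rho_ac \<mu> f h < e}"
    unfolding rho_ac_topology_def using f e by (intro topology_generated_by_Basis) blast
  then have rho: "openin (tau_ac \<mu>) {h \<in> H_bac \<mu>. rho_ac \<mu> f h < e}" using basis by blast
  define W where "W = {h \<in> H_bac \<mu>. rho_ac \<mu> f h < e} \<inter> {g \<in> H_bac \<mu>. \<forall>P\<in>F. g ` P = f ` P}"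
  have "openin (tau_ac \<mu>) ({h \<in> H_bac \<mu>. rho_ac \<mu> f h < e} \<inter> {g \<in> H_bac \<mu>. \<forall>P\<in>F. g ` P = f ` P})"
    using F
  proof (induction F)
    case empty
    have "{h \<in> H_bac \<mu>. rho_ac \<mu> f h < e} \<inter> {g \<in> H_bac \<mu>. \<forall>P\<in>{}. g ` P = f ` P}
        = {h \<in> H_bac \<mu>. rho_ac \<mu> f h < e}" by blast
    then show ?case using rho by simp
  next
    case (insert P F)
    have "{h \<in> H_bac \<mu>. rho_ac \<mu> f h < e} \<inter> {g \<in> H_bac \<mu>. \<forall>P\<in>insert P F. g ` P = f ` P}
        = {h \<in> H_bac \<mu>. rho_ac \<mu> f h < e} \<inter> {g \<in> H_bac \<mu>. \<forall>P\<in>F. g ` P = f ` P}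
          \<inter> {g \<in> H_bac \<mu>. g ` P = f ` P}" by auto
    then show ?case using insert one[of P] by (simp add: openin_Int)
  qed
  then have "openin (tau_ac \<mu>) W" unfolding W_def .
  moreover have "f \<in> W" using f e by (simp add: W_def rho_ac_def)
  moreover have "W \<subseteq> nbhd f F e"
  proof
    fix g assume g: "g \<in> W"
    then have gH: "g \<in> H_bac \<mu>" "rho_ac \<mu> f g < e" by (simp_all add: W_def)
    have "near e g f" using near_sym[OF near_mono[OF near_rho[OF f gH(1)]]] gH(2) by simp
    then show "g \<in> nbhd f F e" using g by (simp add: W_def nbhd_def)
  qed
  ultimately show ?thesis by blast
qed

theorem openin_tau_ac_iff: "openin (tau_ac \<mu>) U \<longleftrightarrow> U \<subseteq> H_bac \<mu> \<and> locally_nbhd U"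
proof
  assume U: "openin (tau_ac \<mu>) U"
  then have "generate_topology_on
       ({U. openin (subtopology compact_open_topology (H_bac \<mu>)) U} \<union> {U. openin (rho_ac_topology \<mu>) U}) U"
    unfolding tau_ac_def openin_topology_generated_by_iff .
  then have "locally_nbhd U"
    by (rule locally_nbhd_generate) (use locally_nbhd_compact_open(1) locally_nbhd_rho(1) in blast)
  moreover have "U \<subseteq> topspace (tau_ac \<mu>)" using openin_subset[OF U] .
  moreover have "topspace (tau_ac \<mu>) \<subseteq> H_bac \<mu>"
    unfolding tau_ac_def topology_generated_by_topspace
    using locally_nbhd_compact_open(2) locally_nbhd_rho(2) by blast
  ultimately show "U \<subseteq> H_bac \<mu> \<and> locally_nbhd U" by blast
next
  assume U: "U \<subseteq> H_bac \<mu> \<and> locally_nbhd U"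
  have "\<exists>W. openin (tau_ac \<mu>) W \<and> f \<in> W \<and> W \<subseteq> U" if f: "f \<in> U" for f
  proof -
    have fH: "f \<in> H_bac \<mu>" using U f by blast
    obtain F e where F: "finite F" "\<forall>P\<in>F. clopen P" "e > 0" "nbhd f F e \<subseteq> U"
      by (rule locally_nbhdE[OF conjunct2[OF U] f fH])
    show ?thesis using open_in_nbhd[OF fH F(1,2,3)] F(4) by blast
  qed
  then show "openin (tau_ac \<mu>) U" by (subst openin_subopen) blast
qed

lemma topspace_tau_ac: "topspace (tau_ac \<mu>) = H_bac \<mu>"
proof
  show "topspace (tau_ac \<mu>) \<subseteq> H_bac \<mu>"
    using openin_tau_ac_iff openin_topspace by blast
  have "locally_nbhd (H_bac \<mu>)"
    by (rule locally_nbhdI) (auto intro!: exI[of _ "{}"] exI[of _ 1] dest: nbhdD(1))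
  then have "openin (tau_ac \<mu>) (H_bac \<mu>)" using openin_tau_ac_iff by blast
  then show "H_bac \<mu> \<subseteq> topspace (tau_ac \<mu>)" by (rule openin_subset)
qed

lemma finv_comp: "f \<in> H_bac \<mu> \<Longrightarrow> finv f \<circ> f = id" "f \<in> H_bac \<mu> \<Longrightarrow> f \<circ> finv f = id"
  using H_bij bij_is_inj bij_is_surj by (auto simp: surj_iff inj_iff)

lemma group_H: "group (H_bac_group \<mu>)"
proof (rule groupI)
  fix x assume "x \<in> carrier (H_bac_group \<mu>)"
  then show "\<exists>y\<in>carrier (H_bac_group \<mu>). y \<otimes>\<^bsub>H_bac_group \<mu>\<^esub> x = \<one>\<^bsub>H_bac_group \<mu>\<^esub>"
    using H_inv finv_comp(1) by (auto simp: H_bac_group_def)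
qed (auto simp: H_bac_group_def H_comp H_id comp_assoc)

lemma inv_H: "f \<in> H_bac \<mu> \<Longrightarrow> inv\<^bsub>H_bac_group \<mu>\<^esub> f = finv f"
  using group.inv_equality[OF group_H, of "finv f" f] H_inv finv_comp(1)
  by (simp add: H_bac_group_def)

lemma continuous_mult:
  "continuous_map (prod_topology (tau_ac \<mu>) (tau_ac \<mu>)) (tau_ac \<mu>) (\<lambda>(x, y). x \<circ> y)"
  unfolding continuous_map_def
proof (intro conjI allI impI)
  show "(\<lambda>(x, y). x \<circ> y) \<in> topspace (prod_topology (tau_ac \<mu>) (tau_ac \<mu>)) \<rightarrow> topspace (tau_ac \<mu>)"
    using H_comp by (auto simp: topspace_tau_ac)
  fix U assume U: "openin (tau_ac \<mu>) U"
  let ?D = "{p \<in> topspace (prod_topology (tau_ac \<mu>) (tau_ac \<mu>)). (case p of (x, y) \<Rightarrow> x \<circ> y) \<in> U}"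
  have D: "(x, y) \<in> ?D \<longleftrightarrow> x \<in> H_bac \<mu> \<and> y \<in> H_bac \<mu> \<and> x \<circ> y \<in> U" for x y
    by (simp add: topspace_tau_ac)
  show "openin (prod_topology (tau_ac \<mu>) (tau_ac \<mu>)) ?D"
    unfolding openin_prod_topology_alt
  proof (intro allI impI)
    fix x y assume "(x, y) \<in> ?D"
    then have x: "x \<in> H_bac \<mu>" and y: "y \<in> H_bac \<mu>" and xy: "x \<circ> y \<in> U" using D by auto
    obtain F e where F: "finite F" "\<forall>P\<in>F. clopen P" "e > 0" "nbhd (x \<circ> y) F e \<subseteq> U"
      using locally_nbhdE[OF _ xy H_comp[OF x y]] U openin_tau_ac_iff by metis
    have e2: "e / 2 > 0" using F(3) by simp
    obtain G d where G: "finite G" "\<forall>P\<in>G. clopen P" "d > 0"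
        "\<forall>z\<in>H_bac \<mu>. (\<forall>P\<in>G. z ` P = y ` P) \<longrightarrow> near d z y \<longrightarrow> near (e / 2) (x \<circ> z) (x \<circ> y)"
      by (rule near_comp_leftE[OF x y e2])
    have "finite ((`) y ` F)" "\<forall>P\<in>(`) y ` F. clopen P" using F H_clopen[OF y] by auto
    from open_in_nbhd[OF x this e2] obtain V where
      V: "openin (tau_ac \<mu>) V" "x \<in> V" "V \<subseteq> nbhd x ((`) y ` F) (e / 2)" by blast
    have "finite (F \<union> G)" "\<forall>P\<in>F \<union> G. clopen P" using F G by auto
    from open_in_nbhd[OF y this G(3)] obtain W where
      W: "openin (tau_ac \<mu>) W" "y \<in> W" "W \<subseteq> nbhd y (F \<union> G) d" by blast
    have "V \<times> W \<subseteq> ?D"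
    proof
      fix p assume "p \<in> V \<times> W"
      then obtain x' y' where p: "p = (x', y')" and "x' \<in> V" "y' \<in> W" by blast
      then have n: "x' \<in> nbhd x ((`) y ` F) (e / 2)" "y' \<in> nbhd y (F \<union> G) d"
        using V(3) W(3) by auto
      have x': "x' \<in> H_bac \<mu>" "\<And>P. P \<in> F \<Longrightarrow> x' ` y ` P = x ` y ` P" "near (e / 2) x' x"
        using nbhdD[OF n(1)] by auto
      have y': "y' \<in> H_bac \<mu>" "\<And>P. P \<in> F \<Longrightarrow> y' ` P = y ` P" "\<forall>P\<in>G. y' ` P = y ` P" "near d y' y"
        using nbhdD[OF n(2)] by auto
      have "near (e / 2) (x' \<circ> y') (x \<circ> y')" using near_comp_right[OF x'(3) y'(1)] .
      moreover have "near (e / 2) (x \<circ> y') (x \<circ> y)" using G(4) y'(1,3,4) by simp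
      ultimately have "near (e / 2 + e / 2) (x' \<circ> y') (x \<circ> y)" by (rule near_trans)
      then have "near e (x' \<circ> y') (x \<circ> y)" by simp
      moreover have "(x' \<circ> y') ` P = (x \<circ> y) ` P" if "P \<in> F" for P
        unfolding image_comp[symmetric] using x'(2)[OF that] y'(2)[OF that] by simp
      ultimately have "x' \<circ> y' \<in> nbhd (x \<circ> y) F e" using H_comp[OF x'(1) y'(1)] by (intro nbhdI)
      then have "x' \<circ> y' \<in> U" using F(4) by blast
      then show "p \<in> ?D" unfolding p D using x'(1) y'(1) by blast
    qed
    then show "\<exists>V W. openin (tau_ac \<mu>) V \<and> openin (tau_ac \<mu>) W \<and> x \<in> V \<and> y \<in> W \<and> V \<times> W \<subseteq> ?D"
      using V(1,2) W(1,2) by blast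
  qed
qed

text \<open>Right translation by \<open>finv z\<close> turns the comparison of \<open>finv x \<circ> z\<close> with the identity into the
  comparison of \<open>finv x\<close> with \<open>finv z\<close>; so continuity of left translation by \<open>finv x\<close> suffices.\<close>

lemma continuous_finv: "continuous_map (tau_ac \<mu>) (tau_ac \<mu>) (\<lambda>x. finv x)"
  unfolding continuous_map_def
proof (intro conjI allI impI)
  show "(\<lambda>x. finv x) \<in> topspace (tau_ac \<mu>) \<rightarrow> topspace (tau_ac \<mu>)"
    using H_inv by (auto simp: topspace_tau_ac)
  fix U assume U: "openin (tau_ac \<mu>) U"
  let ?D = "{x \<in> topspace (tau_ac \<mu>). finv x \<in> U}"
  have "locally_nbhd ?D"
  proof (rule locally_nbhdI)
    fix x assume "x \<in> ?D" and x: "x \<in> H_bac \<mu>"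
    then have xU: "finv x \<in> U" by simp
    obtain F e where F: "finite F" "\<forall>P\<in>F. clopen P" "e > 0" "nbhd (finv x) F e \<subseteq> U"
      using locally_nbhdE[OF _ xU H_inv[OF x]] U openin_tau_ac_iff by metis
    obtain G d where G: "finite G" "\<forall>P\<in>G. clopen P" "d > 0"
        "\<forall>z\<in>H_bac \<mu>. (\<forall>P\<in>G. z ` P = x ` P) \<longrightarrow> near d z x \<longrightarrow> near e (finv x \<circ> z) (finv x \<circ> x)"
      by (rule near_comp_leftE[OF H_inv[OF x] x F(3)])
    let ?F = "(`) (finv x) ` F \<union> G"
    have "nbhd x ?F d \<subseteq> ?D"
    proof
      fix z assume "z \<in> nbhd x ?F d"
      from nbhdD[OF this]
      have z: "z \<in> H_bac \<mu>" "\<And>P. P \<in> F \<Longrightarrow> z ` finv x ` P = x ` finv x ` P" "\<forall>P\<in>G. z ` P = x ` P" "near d z x"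
        by auto
      have "finv z ` P = finv x ` P" if "P \<in> F" for P
        using z(2)[OF that] H_image_inv[OF x, of P] H_inv_image[OF z(1), of "finv x ` P"] by simp
      moreover have "near e (finv z) (finv x)"
      proof -
        have "near e (finv x \<circ> z) (finv x \<circ> x)" using G(4) z(1,3,4) by simp
        then have "near e (finv x \<circ> z \<circ> finv z) (finv x \<circ> x \<circ> finv z)"
          using near_comp_right H_inv[OF z(1)] by blast
        moreover have "finv x \<circ> z \<circ> finv z = finv x" "finv x \<circ> x \<circ> finv z = finv z"
          using finv_comp[OF x] finv_comp[OF z(1)] by (simp_all add: comp_assoc)
        ultimately show ?thesis using near_sym by simp
      qed
      ultimately have "finv z \<in> nbhd (finv x) F e" using H_inv[OF z(1)] by (intro nbhdI)
      then show "z \<in> ?D" using F(4) z(1) topspace_tau_ac by auto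
    qed
    moreover have "finite ?F" "\<forall>P\<in>?F. clopen P" using F G H_clopen[OF H_inv[OF x]] by auto
    ultimately show "\<exists>F e. finite F \<and> (\<forall>P\<in>F. clopen P) \<and> e > 0 \<and> nbhd x F e \<subseteq> ?D"
      using G(3) by (intro exI conjI)
  qed
  then show "openin (tau_ac \<mu>) ?D" unfolding openin_tau_ac_iff by (auto simp: topspace_tau_ac)
qed

theorem topological_group_H: "topological_group (H_bac_group \<mu>) (tau_ac \<mu>)"
proof -
  have "continuous_map (tau_ac \<mu>) (tau_ac \<mu>) (\<lambda>x. inv\<^bsub>H_bac_group \<mu>\<^esub> x)"
    using continuous_finv by (rule continuous_map_eq) (simp add: topspace_tau_ac inv_H)
  then show ?thesis
    unfolding topological_group_def using group_H continuous_mult topspace_tau_ac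
    by (simp add: H_bac_group_def)
qed

end

section \<open>Finitely many double cosets\<close>

text \<open>Every cylinder of level \<open>n\<close> is the union of the pieces \<open>A c\<close> with \<open>p c\<close> equal to it, and also
  of the corresponding pieces \<open>A' c\<close>.\<close>

lemma fixes_cyls:
  assumes A: "clopen_partition I A" "clopen_partition I A'"
    and p: "\<And>c. c \<in> I \<Longrightarrow> p c \<in> cyls n" "\<And>c. c \<in> I \<Longrightarrow> A c \<subseteq> p c" "\<And>c. c \<in> I \<Longrightarrow> A' c \<subseteq> p c"
    and f: "\<And>c. c \<in> I \<Longrightarrow> f ` A c = A' c" and Q: "Q \<in> cyls n"
  shows "f ` Q = Q"
proof
  have eq: "Q = p c" if "c \<in> I" "x \<in> Q" "x \<in> p c" for c x
    using disjoint_cyls[OF Q p(1)[OF that(1)]] that by blast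
  show "f ` Q \<subseteq> Q"
  proof
    fix y assume "y \<in> f ` Q"
    then obtain x where x: "x \<in> Q" "y = f x" by blast
    obtain c where c: "c \<in> I" "x \<in> A c" using partition_cover[OF A(1)] by blast
    have "x \<in> p c" using p(2)[OF c(1)] c(2) by blast
    then have "Q = p c" using eq[OF c(1) x(1)] by blast
    moreover have "y \<in> A' c" using f[OF c(1)] c(2) x(2) by blast
    ultimately show "y \<in> Q" using p(3)[OF c(1)] by blast
  qed
  show "Q \<subseteq> f ` Q"
  proof
    fix y assume y: "y \<in> Q"
    obtain c where c: "c \<in> I" "y \<in> A' c" using partition_cover[OF A(2)] by blast
    have "y \<in> p c" using p(3)[OF c(1)] c(2) by blast
    then have "Q = p c" using eq[OF c(1) y] by blast
    moreover obtain x where "x \<in> A c" "y = f x" using f[OF c(1)] c(2) by blast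
    ultimately show "y \<in> f ` Q" using p(2)[OF c(1)] by blast
  qed
qed

text \<open>The hypotheses place \<open>b / (a + b)\<close> and \<open>\<beta> / (\<alpha> + \<beta>)\<close> in the same interval of length \<open>1 / N\<close>.
  Measuring slopes by this quotient, which lies between 0 and 1, makes finitely many intervals
  sufficient for all slopes \<open>b / a\<close>.\<close>

lemma ratio_merge:
  fixes a b \<alpha> \<beta> l N :: real
  assumes N: "N > 0" and pos: "a > 0" "b > 0" "\<alpha> > 0" "\<beta> > 0"
    and Q: "l * (a + b) \<le> N * b" "N * b \<le> (l + 1) * (a + b)"
    and S: "l * (\<alpha> + \<beta>) \<le> N * \<beta>" "N * \<beta> \<le> (l + 1) * (\<alpha> + \<beta>)"
  shows "\<bar>b * \<alpha> - \<beta> * a\<bar> \<le> (a + b) * (\<alpha> + \<beta>) / N"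
proof -
  have id: "N * (b * \<alpha> - \<beta> * a) = (N * b) * (\<alpha> + \<beta>) - (N * \<beta>) * (a + b)"
    by (simp add: algebra_simps)
  have "(N * b) * (\<alpha> + \<beta>) \<le> ((l + 1) * (a + b)) * (\<alpha> + \<beta>)"
    using Q(2) pos by (intro mult_right_mono) auto
  moreover have "(l * (\<alpha> + \<beta>)) * (a + b) \<le> (N * \<beta>) * (a + b)"
    using S(1) pos by (intro mult_right_mono) auto
  ultimately have 1: "N * (b * \<alpha> - \<beta> * a) \<le> (a + b) * (\<alpha> + \<beta>)"
    unfolding id by (simp add: algebra_simps)
  have "(l * (a + b)) * (\<alpha> + \<beta>) \<le> (N * b) * (\<alpha> + \<beta>)"
    using Q(1) pos by (intro mult_right_mono) auto
  moreover have "(N * \<beta>) * (a + b) \<le> ((l + 1) * (\<alpha> + \<beta>)) * (a + b)"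
    using S(2) pos by (intro mult_right_mono) auto
  ultimately have 2: "- (N * (b * \<alpha> - \<beta> * a)) \<le> (a + b) * (\<alpha> + \<beta>)"
    unfolding id by (simp add: algebra_simps)
  have "N * \<bar>b * \<alpha> - \<beta> * a\<bar> \<le> (a + b) * (\<alpha> + \<beta>)"
  proof -
    have "N * \<bar>b * \<alpha> - \<beta> * a\<bar> = \<bar>N * (b * \<alpha> - \<beta> * a)\<bar>" using N by (simp add: abs_mult)
    then show ?thesis using 1 2 by (simp only: abs_le_iff)
  qed
  then show ?thesis using N by (simp add: field_simps)
qed

text \<open>Replacing the slope \<open>b / a\<close> by \<open>\<beta> / \<alpha>\<close> changes \<open>b\<close> by little relative to \<open>a + b\<close>, provided that
  the new slope is at most one. For steeper slopes the lemma is applied with the two sides exchanged.\<close>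

lemma ratio_merge_low:
  fixes a b \<alpha> \<beta> N :: real
  assumes m: "\<bar>b * \<alpha> - \<beta> * a\<bar> \<le> (a + b) * (\<alpha> + \<beta>) / N"
    and N: "N > 0" and pos: "a > 0" "b > 0" "\<alpha> > 0" "\<beta> > 0" and low: "\<beta> \<le> \<alpha>"
  shows "\<bar>b - \<beta> / \<alpha> * a\<bar> \<le> 2 * (a + b) / N"
proof -
  have "\<alpha> * \<bar>b - \<beta> / \<alpha> * a\<bar> = \<bar>\<alpha> * (b - \<beta> / \<alpha> * a)\<bar>" using pos by (simp add: abs_mult)
  also have "\<alpha> * (b - \<beta> / \<alpha> * a) = b * \<alpha> - \<beta> * a" using pos by (simp add: field_simps)
  also have "\<bar>b * \<alpha> - \<beta> * a\<bar> \<le> (a + b) * (\<alpha> + \<beta>) / N" by (rule m)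
  also have "\<dots> \<le> (a + b) * (2 * \<alpha>) / N"
    using pos low N by (intro divide_right_mono mult_left_mono) auto
  also have "\<dots> = \<alpha> * (2 * (a + b) / N)" by simp
  finally show ?thesis using pos(3) by (simp only: mult_le_cancel_left_pos)
qed

context ratio_measure
begin

lemma scales_comp:
  assumes "g \<in> H_bac \<mu>" "scales g P c" "scales h (g ` P) d"
  shows "scales (h \<circ> g) P (d * c)"
  unfolding scales_def
proof (intro ballI impI)
  fix A :: "cantor set" assume A: "A \<in> sets borel" "A \<subseteq> P"
  have "m (h ` g ` A) = d * m (g ` A)"
    using scalesD[OF assms(3) H_borel[OF assms(1) A(1)]] A(2) by blast
  also have "m (g ` A) = c * m A" using scalesD[OF assms(2) A] .
  finally show "m ((h \<circ> g) ` A) = d * c * m A" unfolding image_comp[symmetric] by simp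
qed

lemma scales_inv:
  assumes g: "g \<in> H_bac \<mu>" "scales g P c" and c: "c \<noteq> 0"
  shows "scales (finv g) (g ` P) (1 / c)"
  unfolding scales_def
proof (intro ballI impI)
  fix A :: "cantor set" assume A: "A \<in> sets borel" "A \<subseteq> g ` P"
  have "finv g ` A \<subseteq> P" using A(2) H_inv_image[OF g(1), of P] by blast
  then have "m (g ` (finv g ` A)) = c * m (finv g ` A)"
    using scalesD[OF g(2) H_borel[OF H_inv[OF g(1)] A(1)]] by blast
  then show "m (finv g ` A) = 1 / c * m A" using c H_image_inv[OF g(1), of A] by simp
qed

lemma H_measure_scales:
  assumes k: "k \<in> H_bac \<mu>" and F: "clopen_partition I F" and sc: "\<And>i. i \<in> I \<Longrightarrow> scales k (F i) (c i)"
    and A: "A \<in> sets borel"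
  shows "m (k ` A) = (\<Sum>i\<in>I. c i * m (A \<inter> F i))"
proof -
  have "m (k ` A) = (\<Sum>i\<in>I. m (k ` (A \<inter> F i)))" by (rule homeomorphism_measure_image[OF H_homeo[OF k] F A])
  also have "\<dots> = (\<Sum>i\<in>I. c i * m (A \<inter> F i))"
  proof (rule sum.cong[OF refl])
    fix i assume i: "i \<in> I"
    have "A \<inter> F i \<in> sets borel" using A partition_clopen[OF F i] by auto
    then show "m (k ` (A \<inter> F i)) = c i * m (A \<inter> F i)" using scalesD[OF sc[OF i]] by blast
  qed
  finally show ?thesis .
qed

lemma sum_coeff_bound:
  assumes F: "clopen_partition I F" and A: "A \<in> sets borel"
  shows "\<bar>\<Sum>i\<in>I. c i * m (A \<inter> F i)\<bar> \<le> (\<Sum>i\<in>I. \<bar>c i\<bar> * m (F i))"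
proof -
  have "\<bar>\<Sum>i\<in>I. c i * m (A \<inter> F i)\<bar> \<le> (\<Sum>i\<in>I. \<bar>c i * m (A \<inter> F i)\<bar>)" by (rule sum_abs)
  also have "\<dots> \<le> (\<Sum>i\<in>I. \<bar>c i\<bar> * m (F i))"
  proof (rule sum_mono)
    fix i assume "i \<in> I"
    then have "m (A \<inter> F i) \<le> m (F i)"
      using clopen_sets[OF partition_clopen[OF F]] by (intro finite_measure_mono) auto
    then show "\<bar>c i * m (A \<inter> F i)\<bar> \<le> \<bar>c i\<bar> * m (F i)" by (simp add: abs_mult mult_left_mono)
  qed
  finally show ?thesis .
qed

lemma near_id_if_scales:
  assumes k: "k \<in> H_bac \<mu>" and F: "clopen_partition I F" and sc: "\<And>i. i \<in> I \<Longrightarrow> scales k (F i) (c i)"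
    and e: "(\<Sum>i\<in>I. \<bar>c i - 1\<bar> * m (F i)) \<le> e"
  shows "near e k id"
  unfolding near_def
proof
  fix A :: "cantor set" assume A: "A \<in> sets borel"
  have "m (k ` A) - m A = (\<Sum>i\<in>I. (c i - 1) * m (A \<inter> F i))"
    using H_measure_scales[OF k F sc A] measure_partition[OF F A]
    by (simp add: left_diff_distrib sum_subtractf)
  then show "\<bar>m (k ` A) - m (id ` A)\<bar> \<le> e"
    using sum_coeff_bound[OF F A, of "\<lambda>i. c i - 1"] e by simp
qed

lemma nbhd_id_comp:
  assumes g: "g \<in> nbhd id F d" and h: "h \<in> nbhd id F e"
  shows "g \<circ> h \<in> nbhd id F (d + e)"
proof (rule nbhdI)
  show "g \<circ> h \<in> H_bac \<mu>" using nbhdD(1)[OF g] nbhdD(1)[OF h] H_comp by blast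
  show "(g \<circ> h) ` P = id ` P" if "P \<in> F" for P
    unfolding image_comp[symmetric] using nbhdD(2)[OF g that] nbhdD(2)[OF h that] by simp
  have "near d (g \<circ> h) (id \<circ> h)" by (rule near_comp_right[OF nbhdD(3)[OF g] nbhdD(1)[OF h]])
  then show "near (d + e) (g \<circ> h) id" using near_trans nbhdD(3)[OF h] by simp
qed

lemma sum_ratio_deviation:
  assumes F: "clopen_partition I F"
  shows "(\<Sum>c\<in>I. \<bar>x c / m (F c) - 1\<bar> * m (F c)) \<le> (\<Sum>c\<in>I. \<bar>x c - m (F c)\<bar>)"
proof (rule sum_mono)
  fix c assume c: "c \<in> I"
  show "\<bar>x c / m (F c) - 1\<bar> * m (F c) \<le> \<bar>x c - m (F c)\<bar>"
  proof (cases "F c = {}")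
    case False
    then have pos: "m (F c) > 0" using clopen_pos partition_clopen[OF F c] by blast
    then have "\<bar>x c / m (F c) - 1\<bar> * m (F c) = \<bar>(x c / m (F c) - 1) * m (F c)\<bar>"
      by (simp add: abs_mult)
    also have "\<dots> = \<bar>x c - m (F c)\<bar>" using pos by (simp add: left_diff_distrib)
    finally show ?thesis by simp
  qed simp
qed

text \<open>A label \<open>c\<close> fixes in advance a set \<open>p c\<close> for the piece \<open>A c\<close> and a set \<open>q c\<close> for its image.
  With cylinders for \<open>p c\<close> and \<open>q c\<close>, the labels record how \<open>t\<close> distributes cylinders over
  cylinders.\<close>

definition blockwise_scaling where
  "blockwise_scaling I p q t A B \<longleftrightarrow> t \<in> H_bac \<mu> \<and> clopen_partition I A \<and> clopen_partition I B \<and>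
    (\<forall>c\<in>I. A c \<subseteq> p c \<and> B c \<subseteq> q c \<and> t ` A c = B c \<and> scales t (A c) (m (B c) / m (A c)))"

text \<open>A piecewise scaling \<open>k\<close> carries the images \<open>B c\<close> to \<open>B' c\<close>; it is close to the identity because
  these sets have similar measures. The equation \<open>t' = k \<circ> t \<circ> k'\<close> then determines \<open>k'\<close>, and in \<open>k'\<close>
  the factors of \<open>t\<close> and \<open>t'\<close> cancel: it scales \<open>A' c\<close> by \<open>m (A c) / m (A' c)\<close>, however large the
  factors of \<open>t\<close> and \<open>t'\<close> themselves are.\<close>

lemma similar_blockwise_scalings:
  assumes P: "blockwise_scaling I p q t A B" and P': "blockwise_scaling I p q t' A' B'"
    and pq: "\<And>c. c \<in> I \<Longrightarrow> p c \<in> cyls n" "\<And>c. c \<in> I \<Longrightarrow> q c \<in> cyls n"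
    and ne: "\<And>c. c \<in> I \<Longrightarrow> A c = {} \<longleftrightarrow> A' c = {}"
    and dA: "(\<Sum>c\<in>I. \<bar>m (A c) - m (A' c)\<bar>) \<le> e" and dB: "(\<Sum>c\<in>I. \<bar>m (B c) - m (B' c)\<bar>) \<le> e"
  shows "\<exists>k\<in>nbhd id (cyls n) e. \<exists>k'\<in>nbhd id (cyls n) e. t' = k \<circ> t \<circ> k'"
proof -
  have t: "t \<in> H_bac \<mu>" "clopen_partition I A" "clopen_partition I B" and t': "t' \<in> H_bac \<mu>" "clopen_partition I A'" "clopen_partition I B'"
    using P P' unfolding blockwise_scaling_def by simp_all
  have tc: "A c \<subseteq> p c" "B c \<subseteq> q c" "t ` A c = B c" "scales t (A c) (m (B c) / m (A c))"
    and tc': "A' c \<subseteq> p c" "B' c \<subseteq> q c" "t' ` A' c = B' c" "scales t' (A' c) (m (B' c) / m (A' c))"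
    if "c \<in> I" for c
    using P P' that unfolding blockwise_scaling_def by simp_all
  have ne': "B c = {} \<longleftrightarrow> B' c = {}" if "c \<in> I" for c
    using ne[OF that] tc(3)[OF that] tc'(3)[OF that] by (metis image_is_empty)
  obtain k where k: "k \<in> H_bac \<mu>" "\<And>c. c \<in> I \<Longrightarrow> k ` B c = B' c"
    "\<And>c. c \<in> I \<Longrightarrow> scales k (B c) (m (B' c) / m (B c))"
    using exists_scaling[OF t(3) t'(3) ne'] by blast
  have "near e k id"
  proof (rule near_id_if_scales[OF k(1) t(3) k(3)])
    show "(\<Sum>c\<in>I. \<bar>m (B' c) / m (B c) - 1\<bar> * m (B c)) \<le> e"
      using sum_ratio_deviation[OF t(3), of "\<lambda>c. m (B' c)"] dB by (simp add: abs_minus_commute)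
  qed
  moreover have "k ` Q = Q" if "Q \<in> cyls n" for Q
    using fixes_cyls[OF t(3) t'(3) pq(2) tc(2) tc'(2) k(2) that] .
  ultimately have kN: "k \<in> nbhd id (cyls n) e" using k(1) by (intro nbhdI) auto
  define k' where "k' = finv t \<circ> (finv k \<circ> t')"
  have k'H: "k' \<in> H_bac \<mu>" unfolding k'_def using H_comp H_inv t(1) t'(1) k(1) by blast
  have k'A: "k' ` A' c = A c" if c: "c \<in> I" for c
  proof -
    have "k' ` A' c = finv t ` finv k ` B' c"
      unfolding k'_def image_comp[symmetric] tc'(3)[OF c] ..
    also have "finv k ` B' c = B c" using H_inv_image[OF k(1)] k(2)[OF c] by metis
    also have "finv t ` B c = A c" using H_inv_image[OF t(1)] tc(3)[OF c] by metis
    finally show ?thesis .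
  qed
  have k'sc: "scales k' (A' c) (m (A c) / m (A' c))" if c: "c \<in> I" for c
  proof (cases "A' c = {}")
    case True
    then show ?thesis by (simp add: scales_def)
  next
    case False
    then have nz: "A c \<noteq> {}" "B c \<noteq> {}" "B' c \<noteq> {}"
      using ne[OF c] ne'[OF c] tc'(3)[OF c] by auto
    have pos: "m (A c) > 0" "m (B c) > 0" "m (A' c) > 0" "m (B' c) > 0"
      using clopen_pos partition_clopen[OF t(2) c] partition_clopen[OF t(3) c]
        partition_clopen[OF t'(2) c] partition_clopen[OF t'(3) c] nz False by blast+
    have s1: "scales (finv k) (B' c) (1 / (m (B' c) / m (B c)))"
      using scales_inv[OF k(1) k(3)[OF c]] k(2)[OF c] pos by simp
    have s2: "scales (finv t) (B c) (1 / (m (B c) / m (A c)))"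
      using scales_inv[OF t(1) tc(4)[OF c]] tc(3)[OF c] pos by simp
    have s3: "scales (finv k \<circ> t') (A' c) (1 / (m (B' c) / m (B c)) * (m (B' c) / m (A' c)))"
      using scales_comp[OF t'(1) tc'(4)[OF c]] s1 tc'(3)[OF c] by metis
    have "(finv k \<circ> t') ` A' c = B c"
      unfolding image_comp[symmetric] tc'(3)[OF c] using H_inv_image[OF k(1)] k(2)[OF c] by metis
    then have "scales k' (A' c) (1 / (m (B c) / m (A c)) * (1 / (m (B' c) / m (B c)) * (m (B' c) / m (A' c))))"
      unfolding k'_def using scales_comp[OF H_comp[OF H_inv[OF k(1)] t'(1)] s3] s2 by metis
    moreover have "1 / (m (B c) / m (A c)) * (1 / (m (B' c) / m (B c)) * (m (B' c) / m (A' c))) = m (A c) / m (A' c)"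
      using pos by simp
    ultimately show ?thesis by simp
  qed
  have "near e k' id"
  proof (rule near_id_if_scales[OF k'H t'(2) k'sc])
    show "(\<Sum>c\<in>I. \<bar>m (A c) / m (A' c) - 1\<bar> * m (A' c)) \<le> e"
      using sum_ratio_deviation[OF t'(2), of "\<lambda>c. m (A c)"] dA by linarith
  qed
  moreover have "k' ` Q = Q" if "Q \<in> cyls n" for Q
    using fixes_cyls[OF t'(2) t(2) pq(1) tc'(1) tc(1) k'A that] .
  ultimately have k'N: "k' \<in> nbhd id (cyls n) e" using k'H by (intro nbhdI) auto
  have "k \<circ> t \<circ> k' = k \<circ> (t \<circ> finv t) \<circ> finv k \<circ> t'" unfolding k'_def by (simp add: comp_assoc)
  also have "\<dots> = t'" using finv_comp(2)[OF t(1)] finv_comp(2)[OF k(1)] by simp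
  finally show ?thesis using kN k'N by metis
qed

lemma cyl_in_cyl: "n0 \<le> n \<Longrightarrow> Q \<in> cyls n \<Longrightarrow> \<exists>P\<in>cyls n0. Q \<subseteq> P"
  using cyl_antimono unfolding cyls_def by blast

lemma measure_grouped:
  assumes F: "finite S" and S: "\<And>Q. Q \<in> S \<Longrightarrow> clopen (f Q)" and d: "disjoint_family_on f S"
  shows "m (\<Union>Q\<in>S. f Q) = (\<Sum>Q\<in>S. m (f Q))"
  using assms by (intro finite_measure_finite_Union) (auto intro: borel_sets)

text \<open>Cut the space into small cylinders \<open>Q\<close>, so small that \<open>g\<close> is close to being a scaling on each of
  them. The label of \<open>Q\<close> consists of the cylinder of level \<open>n0\<close> that contains \<open>Q\<close>, the one that
  contains \<open>g ` Q\<close>, and the interval of length \<open>1 / N\<close> that contains \<open>b / (a + b)\<close>, where \<open>a\<close> and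
  \<open>b\<close> are the measures of \<open>Q\<close> and \<open>g ` Q\<close>. All cylinders with the same label are merged into one
  piece, on which \<open>t\<close> is a scaling. The set of labels does not depend on \<open>g\<close>.

  Merging replaces the individual slopes \<open>b / a\<close> by their average. If the average is at most one,
  the images of the cylinders change little in measure, and the correction is a factor on the left of
  \<open>t\<close>. If it exceeds one, this is true of the inverse maps, and the correction is a factor on the
  right. The intermediate map \<open>s\<close> averages only the pieces of the first kind.\<close>

lemma blockwise_scaling_in_double_coset:
  fixes n0 N :: nat
  assumes g: "g \<in> H_bac \<mu>" and e: "e > 0" and N: "4 / real N \<le> e" "N > 0"
  defines "I \<equiv> cyls n0 \<times> cyls n0 \<times> {..<N}"
  shows "\<exists>t A B. blockwise_scaling I fst (\<lambda>c. fst (snd c)) t A B \<and>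
    (\<exists>k\<in>nbhd id (cyls n0) (2 * e). \<exists>k'\<in>nbhd id (cyls n0) e. g = k \<circ> t \<circ> k')"
proof -
  obtain n1 where n1: "\<And>k A. k \<ge> n1 \<Longrightarrow> A \<in> sets borel \<Longrightarrow>
      \<bar>m (g ` A) - (\<Sum>Q\<in>cyls k. m (g ` Q) / m Q * m (A \<inter> Q))\<bar> \<le> e"
    using conditional_expectation_approx[OF g e] by blast
  have "\<exists>n2. \<forall>P\<in>(\<lambda>P. finv g ` P) ` cyls n0. decided n2 P"
    using finite_cyls[of n0] H_clopen[OF H_inv[OF g]] cyls_clopen
    by (intro finite_clopens_decided) auto
  then obtain n2 where n2: "\<And>P. P \<in> cyls n0 \<Longrightarrow> decided n2 (finv g ` P)" by blast
  define n where "n = Max {n0, n1, n2}"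
  have n: "n0 \<le> n" "n1 \<le> n" "n2 \<le> n" by (auto simp: n_def)
  let ?S = "cyls n"
  note part = partition_cyls[of n]
  have clQ: "clopen Q" "Q \<noteq> {}" "clopen (g ` Q)" "g ` Q \<noteq> {}" if "Q \<in> ?S" for Q
    using cyls_clopen[OF that] cyls_nonempty[OF that] H_clopen[OF g] by auto
  define a where "a Q = m Q" for Q
  define b where "b Q = m (g ` Q)" for Q
  have ab: "a Q > 0" "b Q > 0" if "Q \<in> ?S" for Q
    using clopen_pos clQ[OF that] by (auto simp: a_def b_def)
  have "\<exists>P\<in>cyls n0. Q \<subseteq> P" if "Q \<in> ?S" for Q using cyl_in_cyl[OF n(1) that] .
  then obtain src where src: "\<And>Q. Q \<in> ?S \<Longrightarrow> src Q \<in> cyls n0" "\<And>Q. Q \<in> ?S \<Longrightarrow> Q \<subseteq> src Q" by metis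
  have "\<exists>P\<in>cyls n0. g ` Q \<subseteq> P" if Q: "Q \<in> ?S" for Q
  proof -
    obtain x where x: "Q = cyl n x" using Q by (auto simp: cyls_def)
    let ?P = "cyl n0 (g x)"
    have P: "?P \<in> cyls n0" by (simp add: cyls_def)
    have "decided n (finv g ` ?P)" using decided_mono[OF n2[OF P] n(3)] .
    moreover have "x \<in> finv g ` ?P"
      using self_in_cyl[of "g x" n0] H_inj[OF g] by (metis image_eqI inv_f_f)
    ultimately have "Q \<subseteq> finv g ` ?P" unfolding x decided_def by blast
    then have "g ` Q \<subseteq> g ` finv g ` ?P" by blast
    then show ?thesis using H_image_inv[OF g] P by metis
  qed
  then obtain tgt where tgt: "\<And>Q. Q \<in> ?S \<Longrightarrow> tgt Q \<in> cyls n0" "\<And>Q. Q \<in> ?S \<Longrightarrow> g ` Q \<subseteq> tgt Q" by metis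
  \<comment> \<open>Summing the two bounds on \<open>lev Q\<close> over a label class shows that the merged slope lies in the same interval.\<close>
  define lev where "lev Q = nat \<lfloor>N * (b Q / (a Q + b Q))\<rfloor>" for Q
  have lev: "lev Q * (a Q + b Q) \<le> N * b Q" "N * b Q \<le> (lev Q + 1) * (a Q + b Q)" "lev Q < N"
    if Q: "Q \<in> ?S" for Q
  proof -
    let ?r = "N * (b Q / (a Q + b Q))"
    have pos: "a Q + b Q > 0" using ab[OF Q] by simp
    have r0: "?r \<ge> 0" using ab[OF Q] by simp
    have l: "real (lev Q) \<le> ?r" "?r < real (lev Q) + 1"
      using r0 by (auto simp: lev_def)
    have re: "?r * (a Q + b Q) = N * b Q" using pos by simp
    show "lev Q * (a Q + b Q) \<le> N * b Q"
      using mult_right_mono[OF l(1), of "a Q + b Q"] pos re by simp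
    show "N * b Q \<le> (lev Q + 1) * (a Q + b Q)"
      using mult_right_mono[OF less_imp_le[OF l(2)], of "a Q + b Q"] pos re by (simp add: add.commute)
    have "?r < N" using ab[OF Q] N(2) by (simp add: field_simps)
    then show "lev Q < N" using l(1) by simp
  qed
  define cls where "cls Q = (src Q, tgt Q, lev Q)" for Q
  have clsI: "cls Q \<in> I" if "Q \<in> ?S" for Q
    using src(1)[OF that] tgt(1)[OF that] lev(3)[OF that] by (simp add: cls_def I_def)
  define M where "M c = {Q\<in>?S. cls Q = c}" for c
  define A where "A c = \<Union>(M c)" for c
  define B where "B c = g ` A c" for c
  have finM: "finite (M c)" for c using finite_cyls by (simp add: M_def)
  have M_S: "Q \<in> ?S" if "Q \<in> M c" for Q c using that by (simp add: M_def)
  have finI: "finite I" using finite_cyls by (simp add: I_def)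
  have inA: "x \<in> A c \<longleftrightarrow> cls Q = c" if "Q \<in> ?S" "x \<in> Q" for x Q c
  proof
    assume "x \<in> A c"
    then obtain Q' where "Q' \<in> ?S" "cls Q' = c" "x \<in> Q'" by (auto simp: A_def M_def)
    then show "cls Q = c" using partition_unique[OF part that(1) _ that(2)] by blast
  next
    assume "cls Q = c"
    then show "x \<in> A c" using that by (auto simp: A_def M_def)
  qed
  have cover: "\<exists>Q\<in>?S. x \<in> Q" for x using partition_cover[OF part] .
  have cpA: "clopen_partition I A"
    using partition_coarsen[OF part finI clsI] by (simp add: A_def[abs_def] M_def)
  note partition_image = H_partition_image[OF g]
  have cpB: "clopen_partition I B" unfolding B_def by (rule partition_image[OF cpA])
  have neAB: "A c = {} \<longleftrightarrow> B c = {}" for c by (simp add: B_def)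
  obtain t where t: "t \<in> H_bac \<mu>" "\<And>c. c \<in> I \<Longrightarrow> t ` A c = B c"
    "\<And>c. c \<in> I \<Longrightarrow> scales t (A c) (m (B c) / m (A c))"
    using exists_scaling[OF cpA cpB neAB] by blast
  have Asrc: "A c \<subseteq> fst c" for c
    using src(2) unfolding A_def M_def cls_def by fastforce
  have Btgt: "B c \<subseteq> fst (snd c)" for c
    using tgt(2) unfolding B_def A_def M_def cls_def by fastforce
  have pat: "blockwise_scaling I fst (\<lambda>c. fst (snd c)) t A B"
    unfolding blockwise_scaling_def using t cpA cpB Asrc Btgt by blast

  define \<alpha> where "\<alpha> c = m (A c)" for c
  define \<beta> where "\<beta> c = m (B c)" for c
  have dj: "disjoint_family_on (\<lambda>Q. Q) (M c)" "disjoint_family_on (\<lambda>Q. g ` Q) (M c)" for c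
    using partition_disjoint[OF part] partition_disjoint[OF partition_image[OF part]] M_S
    unfolding disjoint_family_on_def by blast+
  have alpha: "\<alpha> c = (\<Sum>Q\<in>M c. a Q)" for c
    using measure_grouped[OF finM _ dj(1)] clQ(1) M_S by (simp add: \<alpha>_def A_def a_def)
  have beta: "\<beta> c = (\<Sum>Q\<in>M c. b Q)" for c
    using measure_grouped[OF finM _ dj(2)] clQ(3) M_S by (simp add: \<beta>_def B_def A_def b_def image_Union)
  have pos: "\<alpha> (cls Q) > 0" "\<beta> (cls Q) > 0" if Q: "Q \<in> ?S" for Q
  proof -
    have "Q \<in> M (cls Q)" using Q by (simp add: M_def)
    then show "\<alpha> (cls Q) > 0" "\<beta> (cls Q) > 0"
      unfolding alpha beta using finM ab M_S by (intro sum_pos; blast)+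
  qed
  have clev: "lev Q * (\<alpha> (cls Q) + \<beta> (cls Q)) \<le> N * \<beta> (cls Q)"
      "N * \<beta> (cls Q) \<le> (lev Q + 1) * (\<alpha> (cls Q) + \<beta> (cls Q))" if Q: "Q \<in> ?S" for Q
  proof -
    have same: "lev Q' = lev Q" if "Q' \<in> M (cls Q)" for Q' using that by (simp add: M_def cls_def)
    have s: "\<alpha> (cls Q) + \<beta> (cls Q) = (\<Sum>Q'\<in>M (cls Q). a Q' + b Q')"
      by (simp add: alpha beta sum.distrib)
    show "lev Q * (\<alpha> (cls Q) + \<beta> (cls Q)) \<le> N * \<beta> (cls Q)"
    proof -
      have "lev Q * (\<alpha> (cls Q) + \<beta> (cls Q)) = (\<Sum>Q'\<in>M (cls Q). lev Q' * (a Q' + b Q'))"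
        unfolding s sum_distrib_left using same by (intro sum.cong refl) simp
      also have "\<dots> \<le> (\<Sum>Q'\<in>M (cls Q). N * b Q')" using lev(1)[OF M_S] by (rule sum_mono)
      finally show ?thesis unfolding beta sum_distrib_left .
    qed
    show "N * \<beta> (cls Q) \<le> (lev Q + 1) * (\<alpha> (cls Q) + \<beta> (cls Q))"
    proof -
      have "N * \<beta> (cls Q) = (\<Sum>Q'\<in>M (cls Q). N * b Q')" unfolding beta sum_distrib_left ..
      also have "\<dots> \<le> (\<Sum>Q'\<in>M (cls Q). (lev Q' + 1) * (a Q' + b Q'))"
        using lev(2)[OF M_S] by (rule sum_mono)
      also have "\<dots> = (lev Q + 1) * (\<alpha> (cls Q) + \<beta> (cls Q))"
        unfolding s sum_distrib_left using same by (intro sum.cong refl) simp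
      finally show ?thesis .
    qed
  qed
  have Npos: "real N > 0" using N by simp
  have merge: "\<bar>b Q * \<alpha> (cls Q) - \<beta> (cls Q) * a Q\<bar> \<le> (a Q + b Q) * (\<alpha> (cls Q) + \<beta> (cls Q)) / N"
    if Q: "Q \<in> ?S" for Q
    using ratio_merge[OF Npos ab[OF Q] pos[OF Q], of "real (lev Q)"] lev[OF Q] clev[OF Q]
    by (simp add: add.commute)
  have low: "\<bar>b Q - \<beta> (cls Q) / \<alpha> (cls Q) * a Q\<bar> \<le> 2 * (a Q + b Q) / N"
    if Q: "Q \<in> ?S" and "\<beta> (cls Q) \<le> \<alpha> (cls Q)" for Q
    using ratio_merge_low[OF merge[OF Q] Npos ab[OF Q] pos[OF Q]] that by simp
  have high: "\<bar>a Q - \<alpha> (cls Q) / \<beta> (cls Q) * b Q\<bar> \<le> 2 * (a Q + b Q) / N"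
    if Q: "Q \<in> ?S" and "\<alpha> (cls Q) \<le> \<beta> (cls Q)" for Q
  proof -
    have "\<bar>a Q * \<beta> (cls Q) - \<alpha> (cls Q) * b Q\<bar> \<le> (b Q + a Q) * (\<beta> (cls Q) + \<alpha> (cls Q)) / N"
      using merge[OF Q] by (simp add: abs_minus_commute mult.commute add.commute)
    from ratio_merge_low[OF this Npos ab(2,1)[OF Q] pos(2,1)[OF Q] that(2)]
    show ?thesis by (simp add: add.commute)
  qed
  have total: "(\<Sum>Q\<in>?S. 2 * (a Q + b Q) / N) \<le> e"
  proof -
    have "(\<Sum>Q\<in>?S. a Q) = 1"
      using measure_partition[OF part, of UNIV] prob_space space_mu by (simp add: a_def)
    moreover have "(\<Sum>Q\<in>?S. b Q) = 1"
      using homeomorphism_measure_image[OF H_homeo[OF g] part, of UNIV] prob_space space_mu bij_is_surj[OF H_bij[OF g]]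
      by (simp add: b_def)
    ultimately have "(\<Sum>Q\<in>?S. 2 * (a Q + b Q) / N) = 4 / N"
      by (simp add: sum_divide_distrib[symmetric] sum_distrib_left[symmetric] sum.distrib)
    then show ?thesis using N by simp
  qed

  \<comment> \<open>The pieces on which \<open>s\<close> is a scaling: whole label classes where the merged slope is at most one, single cylinders elsewhere.\<close>
  define D where "D Q = (if \<beta> (cls Q) \<le> \<alpha> (cls Q) then A (cls Q) else Q)" for Q
  have D_sub: "Q \<subseteq> D Q" "D Q \<subseteq> A (cls Q)" if Q: "Q \<in> ?S" for Q
    using inA[OF Q, of _ "cls Q"] by (auto simp: D_def)
  have D_in: "D Q' = D Q" if Q: "Q \<in> ?S" "Q' \<in> ?S" "x \<in> Q'" "x \<in> D Q" for x Q Q'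
  proof -
    have c: "cls Q' = cls Q" using inA[OF Q(2,3)] D_sub(2)[OF Q(1)] Q(4) by blast
    show ?thesis
    proof (cases "\<beta> (cls Q) \<le> \<alpha> (cls Q)")
      case True
      then show ?thesis using c by (simp add: D_def)
    next
      case False
      then have "x \<in> Q" using Q(4) by (simp add: D_def)
      then show ?thesis using partition_unique[OF part Q(1,2) _ Q(3)] by simp
    qed
  qed
  have cpD: "clopen_partition (D ` ?S) (\<lambda>X. X)"
  proof -
    have "(\<Union>Q\<in>{Q\<in>?S. D Q = X}. Q) = X" if X: "X \<in> D ` ?S" for X
    proof
      show "(\<Union>Q\<in>{Q\<in>?S. D Q = X}. Q) \<subseteq> X" using D_sub(1) by blast
      show "X \<subseteq> (\<Union>Q\<in>{Q\<in>?S. D Q = X}. Q)"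
      proof
        fix x assume x: "x \<in> X"
        obtain Q' where Q': "Q' \<in> ?S" "x \<in> Q'" using cover by blast
        then have "D Q' = X" using D_in X x by blast
        then show "x \<in> (\<Union>Q\<in>{Q\<in>?S. D Q = X}. Q)" using Q' by blast
      qed
    qed
    moreover have "clopen_partition (D ` ?S) (\<lambda>X. \<Union>Q\<in>{Q\<in>?S. D Q = X}. Q)"
      using finite_cyls by (intro partition_coarsen[OF part]) auto
    ultimately show ?thesis by (simp cong: partition_cong)
  qed
  obtain s where s: "s \<in> H_bac \<mu>" "\<And>X. X \<in> D ` ?S \<Longrightarrow> s ` X = g ` X"
    "\<And>X. X \<in> D ` ?S \<Longrightarrow> scales s X (m (g ` X) / m X)"
    using exists_scaling[OF cpD partition_image[OF cpD]] by auto
  have sA: "s ` A c = B c" if "c \<in> I" for c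
  proof -
    have "A c = (\<Union>Q\<in>M c. D Q)"
      using D_sub by (force simp: A_def M_def)
    then have "s ` A c = (\<Union>Q\<in>M c. s ` D Q)" by (simp add: image_UN)
    also have "\<dots> = (\<Union>Q\<in>M c. g ` D Q)" using s(2) M_S by simp
    also have "\<dots> = g ` A c" using \<open>A c = (\<Union>Q\<in>M c. D Q)\<close> by (simp add: image_UN)
    finally show ?thesis by (simp add: B_def)
  qed
  define r where "r Q = m (g ` D Q) / m (D Q)" for Q
  have r_low: "r Q = \<beta> (cls Q) / \<alpha> (cls Q)" if "\<beta> (cls Q) \<le> \<alpha> (cls Q)" for Q
    using that by (simp add: r_def D_def \<alpha>_def \<beta>_def B_def)
  have r_high: "r Q = b Q / a Q" if "\<not> \<beta> (cls Q) \<le> \<alpha> (cls Q)" for Q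
    using that by (simp add: r_def D_def a_def b_def)
  have s_sc: "scales s Q (r Q)" if Q: "Q \<in> ?S" for Q
    using scales_subset[OF s(3) D_sub(1)[OF Q]] Q by (simp add: r_def)

  \<comment> \<open>On steep classes \<open>s\<close> agrees with the conditional expectation of \<open>g\<close>; on the others the slope has been averaged.\<close>
  have near_gs: "near (2 * e) g s"
    unfolding near_def
  proof
    fix X :: "cantor set" assume X: "X \<in> sets borel"
    have eq: "(\<Sum>Q\<in>?S. b Q / a Q * m (X \<inter> Q)) - m (s ` X) = (\<Sum>Q\<in>?S. (b Q / a Q - r Q) * m (X \<inter> Q))"
      using H_measure_scales[OF s(1) part s_sc X] by (simp add: left_diff_distrib sum_subtractf)
    have "(\<Sum>Q\<in>?S. \<bar>b Q / a Q - r Q\<bar> * m Q) \<le> (\<Sum>Q\<in>?S. 2 * (a Q + b Q) / N)"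
    proof (rule sum_mono)
      fix Q assume Q: "Q \<in> ?S"
      show "\<bar>b Q / a Q - r Q\<bar> * m Q \<le> 2 * (a Q + b Q) / N"
      proof (cases "\<beta> (cls Q) \<le> \<alpha> (cls Q)")
        case True
        have "\<bar>b Q / a Q - r Q\<bar> * m Q = \<bar>(b Q / a Q - r Q) * a Q\<bar>" by (simp add: abs_mult a_def)
        also have "(b Q / a Q - r Q) * a Q = b Q - r Q * a Q" using ab(1)[OF Q] by (simp add: left_diff_distrib)
        finally show ?thesis using low[OF Q True] r_low[OF True] by simp
      next
        case False
        then show ?thesis using r_high[OF False] ab[OF Q] by simp
      qed
    qed
    then have "\<bar>(\<Sum>Q\<in>?S. b Q / a Q * m (X \<inter> Q)) - m (s ` X)\<bar> \<le> e"
      unfolding eq using sum_coeff_bound[OF part X, of "\<lambda>Q. b Q / a Q - r Q"] total by linarith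
    moreover have "\<bar>m (g ` X) - (\<Sum>Q\<in>?S. b Q / a Q * m (X \<inter> Q))\<bar> \<le> e"
      using n1[OF n(2) X] by (simp add: a_def b_def)
    ultimately show "\<bar>m (g ` X) - m (s ` X)\<bar> \<le> 2 * e" by linarith
  qed
  define k where "k = g \<circ> finv s"
  have kH: "k \<in> H_bac \<mu>" unfolding k_def using H_comp[OF g H_inv[OF s(1)]] .
  have kB: "k ` B c = B c" if "c \<in> I" for c
    unfolding k_def image_comp[symmetric] using H_inv_image[OF s(1), of "A c"] sA[OF that] by (simp add: B_def)
  have "near (2 * e) k id"
    using near_comp_right[OF near_gs H_inv[OF s(1)]] finv_comp(2)[OF s(1)] by (simp add: k_def)
  moreover have "k ` P = P" if P: "P \<in> cyls n0" for P
    by (rule fixes_cyls[OF cpB cpB, where p = "\<lambda>c. fst (snd c)" and n = n0])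
      (use kB Btgt P in \<open>auto simp: I_def\<close>)
  ultimately have kN: "k \<in> nbhd id (cyls n0) (2 * e)" using kH by (intro nbhdI) auto

  \<comment> \<open>On the classes with slope at most one \<open>s\<close> and \<open>t\<close> have the same factor, so \<open>k'\<close> preserves measure there; on steep classes the exchanged estimate applies.\<close>
  define k' where "k' = finv t \<circ> s"
  have k'H: "k' \<in> H_bac \<mu>" unfolding k'_def using H_comp[OF H_inv[OF t(1)] s(1)] .
  have k'A: "k' ` A c = A c" if "c \<in> I" for c
    unfolding k'_def image_comp[symmetric] sA[OF that] using H_inv_image[OF t(1), of "A c"] t(2)[OF that] by simp
  have k'sc: "scales k' Q (\<alpha> (cls Q) / \<beta> (cls Q) * r Q)" if Q: "Q \<in> ?S" for Q
  proof -
    have "\<beta> (cls Q) / \<alpha> (cls Q) \<noteq> 0" using pos[OF Q] by simp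
    then have "scales (finv t) (t ` A (cls Q)) (1 / (\<beta> (cls Q) / \<alpha> (cls Q)))"
      using scales_inv[OF t(1) t(3)[OF clsI[OF Q]]] by (simp add: \<alpha>_def \<beta>_def)
    then have "scales (finv t) (B (cls Q)) (\<alpha> (cls Q) / \<beta> (cls Q))"
      using t(2)[OF clsI[OF Q]] by simp
    moreover have "s ` Q \<subseteq> B (cls Q)"
      using sA[OF clsI[OF Q]] D_sub[OF Q] by blast
    ultimately have "scales (finv t) (s ` Q) (\<alpha> (cls Q) / \<beta> (cls Q))" by (rule scales_subset)
    then show ?thesis unfolding k'_def using scales_comp[OF s(1) s_sc[OF Q]] by blast
  qed
  have "near e k' id"
  proof (rule near_id_if_scales[OF k'H part k'sc])
    have "(\<Sum>Q\<in>?S. \<bar>\<alpha> (cls Q) / \<beta> (cls Q) * r Q - 1\<bar> * m Q) \<le> (\<Sum>Q\<in>?S. 2 * (a Q + b Q) / N)"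
    proof (rule sum_mono)
      fix Q assume Q: "Q \<in> ?S"
      show "\<bar>\<alpha> (cls Q) / \<beta> (cls Q) * r Q - 1\<bar> * m Q \<le> 2 * (a Q + b Q) / N"
      proof (cases "\<beta> (cls Q) \<le> \<alpha> (cls Q)")
        case True
        then show ?thesis using r_low[OF True] pos[OF Q] ab[OF Q] by simp
      next
        case False
        have "\<bar>\<alpha> (cls Q) / \<beta> (cls Q) * r Q - 1\<bar> * m Q = \<bar>(\<alpha> (cls Q) / \<beta> (cls Q) * r Q - 1) * a Q\<bar>"
          by (simp add: abs_mult a_def)
        also have "(\<alpha> (cls Q) / \<beta> (cls Q) * r Q - 1) * a Q = \<alpha> (cls Q) / \<beta> (cls Q) * b Q - a Q"
          using ab(1)[OF Q] r_high[OF False] by (simp add: left_diff_distrib)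
        finally show ?thesis using high[OF Q] False by (simp add: abs_minus_commute)
      qed
    qed
    then show "(\<Sum>Q\<in>?S. \<bar>\<alpha> (cls Q) / \<beta> (cls Q) * r Q - 1\<bar> * m Q) \<le> e" using total by linarith
  qed
  moreover have "k' ` P = P" if P: "P \<in> cyls n0" for P
    by (rule fixes_cyls[OF cpA cpA, where p = fst and n = n0])
      (use k'A Asrc P in \<open>auto simp: I_def\<close>)
  ultimately have k'N: "k' \<in> nbhd id (cyls n0) e" using k'H by (intro nbhdI) auto
  have "k \<circ> t \<circ> k' = g \<circ> finv s \<circ> (t \<circ> finv t) \<circ> s" unfolding k_def k'_def by (simp add: comp_assoc)
  also have "\<dots> = g" using finv_comp(2)[OF t(1)] finv_comp(1)[OF s(1)] by (simp add: comp_assoc)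
  finally have "g = k \<circ> t \<circ> k'" ..
  then show ?thesis using pat kN k'N by blast
qed

text \<open>The sums of differences in \<open>similar_blockwise_scalings\<close> are small as soon as the measures of all
  pieces, rounded to multiples of \<open>1 / M\<close>, coincide. Since the set of labels is fixed, only finitely
  many families of rounded values occur, and one representative for each is enough.\<close>

theorem finitely_many_double_cosets:
  assumes e: "e > 0"
  shows "\<exists>F. finite F \<and> F \<subseteq> H_bac \<mu> \<and>
    (\<forall>g\<in>H_bac \<mu>. \<exists>t\<in>F. \<exists>k\<in>nbhd id (cyls n) e. \<exists>k'\<in>nbhd id (cyls n) e. g = k \<circ> t \<circ> k')"
proof -
  \<comment> \<open>The factors to the left of the representative contribute \<open>2 * d\<close> and \<open>d\<close>, those to the right \<open>d\<close> each.\<close>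
  define d where "d = e / 4"
  have d: "d > 0" using e by (simp add: d_def)
  obtain N :: nat where N: "N > 0" "4 / real N \<le> d"
  proof -
    obtain N :: nat where N: "4 / d < real N" using reals_Archimedean2 by blast
    then have "real N > 0" using d divide_pos_pos[of 4 d] by linarith
    moreover have "4 / real N \<le> d" using N d calculation by (simp add: field_simps)
    ultimately show thesis using that by simp
  qed
  define I where "I = cyls n \<times> cyls n \<times> {..<N}"
  have finI: "finite I" using finite_cyls by (simp add: I_def)
  obtain M :: nat where M: "M > 0" "real (card I) / real M \<le> d"
  proof -
    obtain M :: nat where M: "real (card I) / d < real M" using reals_Archimedean2 by blast
    have "real (card I) / d \<ge> 0" using d by simp
    then have M0: "real M > 0" using M by linarith
    moreover have "real (card I) / real M \<le> d" using M d M0 by (simp add: field_simps)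
    ultimately show thesis using that by simp
  qed
  let ?q = "\<lambda>c :: cantor set \<times> cantor set \<times> nat. fst (snd c)"
  define T where "T = {(t, A, B). blockwise_scaling I fst ?q t A B}"
  define fl where "fl x = nat \<lfloor>M * x\<rfloor>" for x :: real
  define code where "code = (\<lambda>(t :: cantor \<Rightarrow> cantor, A, B). \<lambda>c\<in>I. (A c = ({} :: cantor set), fl (m (A c)), fl (m (B c))))"
  have fl_le: "fl x \<le> M" if "x \<le> 1" "x \<ge> 0" for x
  proof -
    have "real M * x \<le> real M * 1" using that by (intro mult_left_mono) auto
    then have "\<lfloor>M * x\<rfloor> \<le> int M" by (simp add: floor_le_iff)
    then show ?thesis by (simp add: fl_def)
  qed
  have fl_eq: "\<bar>x - y\<bar> \<le> 1 / M" if "fl x = fl y" "x \<ge> 0" "y \<ge> 0" for x y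
  proof -
    have "0 \<le> M * x" "0 \<le> M * y" using that by simp_all
    then have "\<lfloor>M * x\<rfloor> = \<lfloor>M * y\<rfloor>"
      using that(1) unfolding fl_def by (metis eq_nat_nat_iff zero_le_floor)
    then have "\<bar>M * x - M * y\<bar> < 1"
      using floor_correct[of "M * x"] floor_correct[of "M * y"] by linarith
    moreover have "\<bar>M * x - M * y\<bar> = M * \<bar>x - y\<bar>"
      by (simp add: right_diff_distrib[symmetric] abs_mult)
    ultimately show ?thesis using M(1) by (simp add: field_simps)
  qed
  have "code ` T \<subseteq> I \<rightarrow>\<^sub>E (UNIV \<times> {..M} \<times> {..M})"
    using fl_le by (auto simp: code_def)
  then have "finite (code ` T)"
    by (rule finite_subset) (auto intro!: finite_PiE finI)
  then obtain T0 where T0: "T0 \<subseteq> T" "finite T0" "code ` T = code ` T0"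
    using finite_subset_image[OF _ subset_refl] by metis
  define F where "F = fst ` T0"
  have finF: "finite F" using T0(2) by (simp add: F_def)
  have FH: "F \<subseteq> H_bac \<mu>"
    using T0(1) by (auto simp: F_def T_def blockwise_scaling_def)
  have "\<exists>t\<in>F. \<exists>k\<in>nbhd id (cyls n) e. \<exists>k'\<in>nbhd id (cyls n) e. g = k \<circ> t \<circ> k'"
    if g: "g \<in> H_bac \<mu>" for g
  proof -
    obtain t A B k k' where t: "blockwise_scaling I fst ?q t A B"
      and k: "k \<in> nbhd id (cyls n) (2 * d)" "k' \<in> nbhd id (cyls n) d" "g = k \<circ> t \<circ> k'"
      using blockwise_scaling_in_double_coset[OF g d N(2,1), of n] unfolding I_def by blast
    have "(t, A, B) \<in> T" using t by (simp add: T_def)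
    then obtain p where p: "p \<in> T0" "code (t, A, B) = code p" using T0(3) by blast
    obtain t' A' B' where p': "p = (t', A', B')" by (metis prod_cases3)
    have pat': "blockwise_scaling I fst ?q t' A' B'" using p(1) T0(1) unfolding p' T_def by blast
    have c: "A c = {} \<longleftrightarrow> A' c = {}" "fl (m (A c)) = fl (m (A' c))" "fl (m (B c)) = fl (m (B' c))"
      if "c \<in> I" for c
      using fun_cong[OF p(2), of c] that unfolding p' code_def by auto
    have sums: "(\<Sum>c\<in>I. \<bar>m (A' c) - m (A c)\<bar>) \<le> d" "(\<Sum>c\<in>I. \<bar>m (B' c) - m (B c)\<bar>) \<le> d"
    proof -
      have "(\<Sum>c\<in>I. \<bar>m (A' c) - m (A c)\<bar>) \<le> (\<Sum>c\<in>I. 1 / M)"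
        using c by (intro sum_mono fl_eq) auto
      then show "(\<Sum>c\<in>I. \<bar>m (A' c) - m (A c)\<bar>) \<le> d" using M(2) by simp
      have "(\<Sum>c\<in>I. \<bar>m (B' c) - m (B c)\<bar>) \<le> (\<Sum>c\<in>I. 1 / M)"
        using c by (intro sum_mono fl_eq) auto
      then show "(\<Sum>c\<in>I. \<bar>m (B' c) - m (B c)\<bar>) \<le> d" using M(2) by simp
    qed
    have "\<exists>h\<in>nbhd id (cyls n) d. \<exists>h'\<in>nbhd id (cyls n) d. t = h \<circ> t' \<circ> h'"
      by (rule similar_blockwise_scalings[OF pat' t _ _ _ sums]) (use c(1) in \<open>auto simp: I_def\<close>)
    then obtain h h' where h: "h \<in> nbhd id (cyls n) d" "h' \<in> nbhd id (cyls n) d" "t = h \<circ> t' \<circ> h'" by blast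
    have "k \<circ> h \<in> nbhd id (cyls n) (2 * d + d)" "h' \<circ> k' \<in> nbhd id (cyls n) (d + d)"
      using nbhd_id_comp[OF k(1) h(1)] nbhd_id_comp[OF h(2) k(2)] .
    moreover have "nbhd id (cyls n) (2 * d + d) \<subseteq> nbhd id (cyls n) e"
        "nbhd id (cyls n) (d + d) \<subseteq> nbhd id (cyls n) e"
      using e by (intro nbhd_mono subset_refl; simp add: d_def)+
    moreover have "g = (k \<circ> h) \<circ> t' \<circ> (h' \<circ> k')" unfolding k(3) h(3) by (simp add: comp_assoc)
    moreover have "t' \<in> F" using p(1) p' by (force simp: F_def)
    ultimately show ?thesis by blast
  qed
  then show ?thesis using finF FH by (intro exI[of _ F] conjI ballI)
qed

theorem roelcke_precompact_H: "roelcke_precompact (H_bac_group \<mu>) (tau_ac \<mu>)"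
  unfolding roelcke_precompact_def
proof (intro conjI allI impI topological_group_H)
  fix V U assume VU: "openin (tau_ac \<mu>) U \<and> \<one>\<^bsub>H_bac_group \<mu>\<^esub> \<in> U \<and> U \<subseteq> V \<and> V \<subseteq> carrier (H_bac_group \<mu>)"
  then have U: "openin (tau_ac \<mu>) U" "id \<in> U" "U \<subseteq> V" "V \<subseteq> H_bac \<mu>"
    by (simp_all add: H_bac_group_def)
  have "locally_nbhd U" using U(1) openin_tau_ac_iff by blast
  then obtain S e where S: "finite S" "\<forall>P\<in>S. clopen P" "e > 0" "nbhd id S e \<subseteq> U"
    by (rule locally_nbhdE[OF _ U(2) H_id])
  obtain n where n: "\<forall>P\<in>S. decided n P" using finite_clopens_decided[OF S(1,2)] by blast
  have sub: "nbhd id (cyls n) e \<subseteq> V"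
  proof
    fix g assume g: "g \<in> nbhd id (cyls n) e"
    have "g ` P = P" if P: "P \<in> S" for P
    proof -
      have eq: "P = \<Union>{Q\<in>cyls n. Q \<subseteq> P}" using decided_Union n P by blast
      have "g ` \<Union>{Q\<in>cyls n. Q \<subseteq> P} = (\<Union>Q\<in>{Q\<in>cyls n. Q \<subseteq> P}. g ` Q)" by (rule image_Union)
      also have "\<dots> = (\<Union>Q\<in>{Q\<in>cyls n. Q \<subseteq> P}. Q)"
        using nbhdD(2)[OF g] by (intro SUP_cong refl) simp
      finally show ?thesis using eq by simp
    qed
    then have "g \<in> nbhd id S e" using nbhdD(1,3)[OF g] by (intro nbhdI) auto
    then show "g \<in> V" using S(4) U(3) by blast
  qed
  obtain F where F: "finite F" "F \<subseteq> H_bac \<mu>"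
    "\<forall>g\<in>H_bac \<mu>. \<exists>t\<in>F. \<exists>k\<in>nbhd id (cyls n) e. \<exists>k'\<in>nbhd id (cyls n) e. g = k \<circ> t \<circ> k'"
    using finitely_many_double_cosets[OF S(3), of n] by (elim exE conjE) (rule that)
  have mem: "g \<in> (\<Union>t\<in>F. (V #>\<^bsub>H_bac_group \<mu>\<^esub> t) <#>\<^bsub>H_bac_group \<mu>\<^esub> V) \<longleftrightarrow>
      (\<exists>t\<in>F. \<exists>k\<in>V. \<exists>k'\<in>V. g = k \<circ> t \<circ> k')" for g
    by (auto simp: r_coset_def set_mult_def H_bac_group_def)
  have "carrier (H_bac_group \<mu>) = (\<Union>t\<in>F. (V #>\<^bsub>H_bac_group \<mu>\<^esub> t) <#>\<^bsub>H_bac_group \<mu>\<^esub> V)"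
  proof (intro Set.equalityI subsetI)
    fix g assume "g \<in> carrier (H_bac_group \<mu>)"
    then have "g \<in> H_bac \<mu>" by (simp add: H_bac_group_def)
    then show "g \<in> (\<Union>t\<in>F. (V #>\<^bsub>H_bac_group \<mu>\<^esub> t) <#>\<^bsub>H_bac_group \<mu>\<^esub> V)"
      unfolding mem using F(3) sub by (meson subsetD)
  next
    fix g assume "g \<in> (\<Union>t\<in>F. (V #>\<^bsub>H_bac_group \<mu>\<^esub> t) <#>\<^bsub>H_bac_group \<mu>\<^esub> V)"
    then obtain t k k' where "t \<in> F" "k \<in> V" "k' \<in> V" "g = k \<circ> t \<circ> k'" unfolding mem by blast
    then have "g \<in> H_bac \<mu>" using F(2) U(4) H_comp by blast
    then show "g \<in> carrier (H_bac_group \<mu>)" by (simp add: H_bac_group_def)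
  qed
  then show "\<exists>F. finite F \<and> F \<subseteq> carrier (H_bac_group \<mu>) \<and>
      carrier (H_bac_group \<mu>) = (\<Union>g\<in>F. (V #>\<^bsub>H_bac_group \<mu>\<^esub> g) <#>\<^bsub>H_bac_group \<mu>\<^esub> V)"
    using F(1,2) by (intro exI[of _ F]) (simp add: H_bac_group_def)
qed

end

section \<open>Fraisse limits of measured Boolean algebras\<close>

text \<open>The power set of \<open>{..<n}\<close> with atoms of weight \<open>w i\<close>, coded on natural numbers: the age of a
  Fraisse limit is tested with algebras of this type.\<close>

definition weight_algebra :: "nat \<Rightarrow> (nat \<Rightarrow> real) \<Rightarrow> nat mba" where
  "weight_algebra n w =
     \<lparr>carrier = set_encode ` Pow {..<n},
      ba_meet = (\<lambda>x y. set_encode (set_decode x \<inter> set_decode y)),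
      ba_join = (\<lambda>x y. set_encode (set_decode x \<union> set_decode y)),
      ba_compl = (\<lambda>x. set_encode ({..<n} - set_decode x)),
      ba_bot = set_encode {}, ba_top = set_encode {..<n},
      ba_meas = (\<lambda>x. \<Sum>i\<in>set_decode x. w i)\<rparr>"

lemma set_decode_encode: "X \<subseteq> {..<n} \<Longrightarrow> set_decode (set_encode X) = X"
  using finite_subset set_encode_inverse by blast

lemma weight_algebra_ops:
  assumes "X \<subseteq> {..<n}" "Y \<subseteq> {..<n}"
  shows "set_encode X \<in> carrier (weight_algebra n w)"
    "ba_meet (weight_algebra n w) (set_encode X) (set_encode Y) = set_encode (X \<inter> Y)"
    "ba_join (weight_algebra n w) (set_encode X) (set_encode Y) = set_encode (X \<union> Y)"
    "ba_compl (weight_algebra n w) (set_encode X) = set_encode ({..<n} - X)"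
    "ba_bot (weight_algebra n w) = set_encode {}" "ba_top (weight_algebra n w) = set_encode {..<n}"
    "ba_meas (weight_algebra n w) (set_encode X) = (\<Sum>i\<in>X. w i)"
  using assms by (simp_all add: weight_algebra_def set_decode_encode imageI)

lemma weight_algebra_cases:
  assumes "x \<in> carrier (weight_algebra n w)"
  obtains X where "X \<subseteq> {..<n}" "x = set_encode X"
  using assms by (auto simp: weight_algebra_def)

lemma boolean_weight_algebra: "boolean_alg (weight_algebra n w)"
proof -
  let ?W = "weight_algebra n w"
  note ops = weight_algebra_ops[where w = w]
  have closed: "ba_closed ?W (carrier ?W)"
    unfolding ba_closed_def
  proof (intro conjI ballI)
    show "ba_bot ?W \<in> carrier ?W" "ba_top ?W \<in> carrier ?W"
      unfolding ops(5,6)[OF subset_refl subset_refl] by (intro ops(1)[OF _ subset_refl]; simp)+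
    fix x assume "x \<in> carrier ?W"
    then obtain X where X: "X \<subseteq> {..<n}" "x = set_encode X" by (rule weight_algebra_cases)
    show "ba_compl ?W x \<in> carrier ?W"
      unfolding X(2) ops(4)[OF X(1,1)] by (intro ops(1)[OF _ subset_refl]) auto
    fix y assume "y \<in> carrier ?W"
    then obtain Y where Y: "Y \<subseteq> {..<n}" "y = set_encode Y" by (rule weight_algebra_cases)
    show "ba_meet ?W x y \<in> carrier ?W" "ba_join ?W x y \<in> carrier ?W"
      unfolding X(2) Y(2) ops(2,3)[OF X(1) Y(1)] using X(1) Y(1)
      by (intro ops(1)[OF _ subset_refl]; blast)+
  qed
  show ?thesis
    unfolding boolean_alg_def
  proof (intro conjI closed ballI)
    fix x y z assume "x \<in> carrier ?W" "y \<in> carrier ?W" "z \<in> carrier ?W"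
    then obtain X Y Z where XYZ: "X \<subseteq> {..<n}" "Y \<subseteq> {..<n}" "Z \<subseteq> {..<n}"
      and x: "x = set_encode X" "y = set_encode Y" "z = set_encode Z"
      by (metis weight_algebra_cases)
    have sub: "X \<inter> Y \<subseteq> {..<n}" "Y \<inter> Z \<subseteq> {..<n}" "X \<union> Y \<subseteq> {..<n}" "Y \<union> Z \<subseteq> {..<n}"
      "X \<inter> Z \<subseteq> {..<n}" "X \<union> Z \<subseteq> {..<n}" using XYZ by auto
    show "ba_meet ?W (ba_meet ?W x y) z = ba_meet ?W x (ba_meet ?W y z)"
      unfolding x using XYZ sub by (simp only: ops(2) Int_assoc)
    show "ba_join ?W (ba_join ?W x y) z = ba_join ?W x (ba_join ?W y z)"
      unfolding x using XYZ sub by (simp only: ops(3) Un_assoc)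
    show "ba_meet ?W x (ba_join ?W y z) = ba_join ?W (ba_meet ?W x y) (ba_meet ?W x z)"
      unfolding x using XYZ sub by (simp only: ops(2,3) Int_Un_distrib)
    show "ba_join ?W x (ba_meet ?W y z) = ba_meet ?W (ba_join ?W x y) (ba_join ?W x z)"
      unfolding x using XYZ sub by (simp only: ops(2,3) Un_Int_distrib)
  next
    fix x y
    show "ba_meet ?W x y = ba_meet ?W y x" "ba_join ?W x y = ba_join ?W y x"
      by (simp_all add: weight_algebra_def Int_commute Un_commute)
  next
    fix x assume "x \<in> carrier ?W"
    then obtain X where X: "X \<subseteq> {..<n}" "x = set_encode X" by (rule weight_algebra_cases)
    have e: "X \<inter> {..<n} = X" "X \<inter> ({..<n} - X) = {}" "X \<union> ({..<n} - X) = {..<n}" "X \<union> {} = X"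
      using X by auto
    have s: "{..<n} - X \<subseteq> {..<n}" "{} \<subseteq> {..<n}" by auto
    note b = ops(5,6)[OF s(2,2)]
    show "ba_meet ?W x (ba_top ?W) = x" unfolding X(2) b ops(2)[OF X(1) subset_refl] e ..
    show "ba_join ?W x (ba_bot ?W) = x" unfolding X(2) b ops(3)[OF X(1) s(2)] e ..
    show "ba_meet ?W x (ba_compl ?W x) = ba_bot ?W"
      unfolding X(2) b ops(4)[OF X(1,1)] ops(2)[OF X(1) s(1)] e ..
    show "ba_join ?W x (ba_compl ?W x) = ba_top ?W"
      unfolding X(2) b ops(4)[OF X(1,1)] ops(3)[OF X(1) s(1)] e ..
  qed
qed

lemma finite_measured_weight_algebra:
  assumes K: "real_subfield K" and w: "\<And>i. i < n \<Longrightarrow> w i \<in> K" "\<And>i. i < n \<Longrightarrow> w i > 0"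
    and sum: "(\<Sum>i<n. w i) = 1"
  shows "finite_measured_ba K (weight_algebra n w)"
proof -
  let ?W = "weight_algebra n w"
  note ba = boolean_weight_algebra[of n w]
  have sub: "finite X" if "X \<subseteq> {..<n}" for X using that finite_subset by blast
  note dec = set_decode_encode[of _ n]
  have carr: "carrier ?W = set_encode ` Pow {..<n}" by (simp add: weight_algebra_def)
  have meas: "ba_meas ?W (set_encode X) = (\<Sum>i\<in>X. w i)" if "X \<subseteq> {..<n}" for X
    using dec[OF that] by (simp add: weight_algebra_def)
  have inK: "(\<Sum>i\<in>X. w i) \<in> K" if "X \<subseteq> {..<n}" for X
    using sub[OF that] that
  proof (induction X)
    case empty
    then show ?case using K by (simp add: real_subfield_def)
  next
    case (insert i X)
    then show ?case using K w(1) by (simp add: real_subfield_def)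
  qed
  have bounds: "0 \<le> (\<Sum>i\<in>X. w i)" "(\<Sum>i\<in>X. w i) \<le> 1" if "X \<subseteq> {..<n}" for X
  proof -
    have nn: "0 \<le> w i" if "i < n" for i using w(2)[OF that] by simp
    show "0 \<le> (\<Sum>i\<in>X. w i)" using that nn by (intro sum_nonneg) auto
    show "(\<Sum>i\<in>X. w i) \<le> 1" using that nn sum sum_mono2[of "{..<n}" X w] by auto
  qed
  have pos: "0 < (\<Sum>i\<in>X. w i)" if "X \<subseteq> {..<n}" "X \<noteq> {}" for X
    using that w(2) sub by (intro sum_pos) auto
  have "measured_ba K ?W"
    unfolding measured_ba_def
  proof (intro conjI ba ballI impI)
    fix x assume "x \<in> carrier ?W"
    then obtain X where X: "X \<subseteq> {..<n}" "x = set_encode X" unfolding carr by blast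
    show "ba_meas ?W x \<in> K \<inter> {0..1}"
      unfolding X(2) meas[OF X(1)] using inK[OF X(1)] bounds[OF X(1)] by simp
    show "0 < ba_meas ?W x" if "x \<noteq> ba_bot ?W"
    proof -
      have "X \<noteq> {}" using that X(2) by (auto simp: weight_algebra_def)
      then show ?thesis unfolding X(2) meas[OF X(1)] using pos[OF X(1)] by simp
    qed
    fix y assume "y \<in> carrier ?W" and disj: "ba_meet ?W x y = ba_bot ?W"
    then obtain Y where Y: "Y \<subseteq> {..<n}" "y = set_encode Y" unfolding carr by blast
    have "set_encode (X \<inter> Y) = set_encode {}"
      using disj X Y by (simp add: weight_algebra_def dec)
    then have "X \<inter> Y = {}" using dec[of "X \<inter> Y"] dec[of "{}"] X(1) by (metis empty_subsetI inf.coboundedI1)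
    moreover have "ba_join ?W x y = set_encode (X \<union> Y)" using X Y by (simp add: weight_algebra_def dec)
    ultimately show "ba_meas ?W (ba_join ?W x y) = ba_meas ?W x + ba_meas ?W y"
      using X Y meas[of "X \<union> Y"] sub by (simp add: meas sum.union_disjoint)
  next
    show "ba_meas ?W (ba_top ?W) = 1" using meas[of "{..<n}"] sum by (simp add: weight_algebra_def)
  qed
  then show ?thesis unfolding finite_measured_ba_def carr by simp
qed

text \<open>When \<open>X\<close> and \<open>Y\<close> are neither empty nor the whole space, this is the isomorphism that sends
  \<open>X\<close> to \<open>Y\<close>, from the algebra of the four sets generated by \<open>X\<close> to that of \<open>Y\<close>.\<close>

definition transfer_set :: "'a set \<Rightarrow> 'a set \<Rightarrow> 'a set \<Rightarrow> 'a set" where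
  "transfer_set X Y Z = (if Z = {} then {} else if Z = UNIV then UNIV else if Z = X then Y else - Y)"

definition generated_by :: "'a set \<Rightarrow> 'a set set" where
  "generated_by X = {{}, X, - X, UNIV}"

lemma generated_by_closed:
  assumes "Z \<in> generated_by X" "Z' \<in> generated_by X"
  shows "Z \<inter> Z' \<in> generated_by X" "Z \<union> Z' \<in> generated_by X"
  using assms unfolding generated_by_def by auto

lemma generated_by_compl: "Z \<in> generated_by X \<Longrightarrow> - Z \<in> generated_by X"
  unfolding generated_by_def by auto

lemma transfer_set_simps:
  assumes "X \<noteq> {}" "X \<noteq> UNIV"
  shows "transfer_set X Y {} = {}" "transfer_set X Y UNIV = UNIV" "transfer_set X Y X = Y" "transfer_set X Y (- X) = - Y"
  using assms by (auto simp: transfer_set_def)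

lemma transfer_set_hom:
  assumes X: "X \<noteq> {}" "X \<noteq> UNIV" and Z: "Z \<in> generated_by X" "Z' \<in> generated_by X"
  shows "transfer_set X Y (Z \<inter> Z') = transfer_set X Y Z \<inter> transfer_set X Y Z'"
    "transfer_set X Y (Z \<union> Z') = transfer_set X Y Z \<union> transfer_set X Y Z'"
    "transfer_set X Y (- Z) = - transfer_set X Y Z" "transfer_set X Y Z \<in> generated_by Y"
  using Z unfolding generated_by_def by (auto simp: transfer_set_simps[OF X])

lemma transfer_set_inverse:
  assumes "X \<noteq> {}" "X \<noteq> UNIV" "Y \<noteq> {}" "Y \<noteq> UNIV" "Z \<in> generated_by X"
  shows "transfer_set Y X (transfer_set X Y Z) = Z"
  using assms(5) unfolding generated_by_def
  by (auto simp: transfer_set_simps[OF assms(1,2)] transfer_set_simps[OF assms(3,4)])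

locale fraisse_clopen =
  fixes K :: "real set" and B :: "'b mba" and \<phi> :: "'b \<Rightarrow> cantor set" and \<mu> :: "cantor measure"
  assumes K: "real_subfield K"
    and lim: "fraisse_limit K B"
    and ext: "borel_extension B \<phi> \<mu>"
begin

lemma sets_mu: "sets \<mu> = sets borel"
  using ext by (simp add: borel_extension_def)

sublocale prob_space \<mu>
  using ext by (simp add: borel_extension_def)

lemma clopen_events: "clopen U \<Longrightarrow> U \<in> sets \<mu>"
  using sets_mu by auto

lemma measured: "measured_ba K B"
  using lim by (simp add: fraisse_limit_def)

lemma ba_closed_carrier: "ba_closed B (carrier B)"
  using measured by (simp add: measured_ba_def boolean_alg_def)

lemma iso: "ba_iso B clopen_algebra \<phi>"
  using ext by (simp add: borel_extension_def)

lemma phi_image: "\<phi> ` carrier B = {U. clopen U}"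
  using iso by (simp add: ba_iso_def clopen_algebra_def)

lemma phi_inj: "inj_on \<phi> (carrier B)"
  using iso by (simp add: ba_iso_def ba_embedding_def)

lemma phi_hom:
  "\<phi> (ba_bot B) = {}" "\<phi> (ba_top B) = UNIV"
  "x \<in> carrier B \<Longrightarrow> y \<in> carrier B \<Longrightarrow> \<phi> (ba_meet B x y) = \<phi> x \<inter> \<phi> y"
  "x \<in> carrier B \<Longrightarrow> y \<in> carrier B \<Longrightarrow> \<phi> (ba_join B x y) = \<phi> x \<union> \<phi> y"
  "x \<in> carrier B \<Longrightarrow> \<phi> (ba_compl B x) = - \<phi> x"
  using iso by (simp_all add: ba_iso_def ba_embedding_def clopen_algebra_def)

lemma op_carrier:
  "ba_bot B \<in> carrier B" "ba_top B \<in> carrier B"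
  "x \<in> carrier B \<Longrightarrow> y \<in> carrier B \<Longrightarrow> ba_meet B x y \<in> carrier B"
  "x \<in> carrier B \<Longrightarrow> y \<in> carrier B \<Longrightarrow> ba_join B x y \<in> carrier B"
  "x \<in> carrier B \<Longrightarrow> ba_compl B x \<in> carrier B"
  using ba_closed_carrier by (simp_all add: ba_closed_def)

lemma phi_clopen: "x \<in> carrier B \<Longrightarrow> clopen (\<phi> x)"
  using phi_image by blast

lemma phi_measure: "x \<in> carrier B \<Longrightarrow> measure \<mu> (\<phi> x) = ba_meas B x"
  using ext by (simp add: borel_extension_def)

definition elem :: "cantor set \<Rightarrow> 'b" where
  "elem = inv_into (carrier B) \<phi>"

lemma elem: "clopen U \<Longrightarrow> elem U \<in> carrier B" "clopen U \<Longrightarrow> \<phi> (elem U) = U"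
proof -
  assume "clopen U"
  then have "U \<in> \<phi> ` carrier B" using phi_image by simp
  then show "elem U \<in> carrier B" "\<phi> (elem U) = U"
    unfolding elem_def by (simp_all add: inv_into_into f_inv_into_f)
qed

lemma phi_eqI: "x \<in> carrier B \<Longrightarrow> y \<in> carrier B \<Longrightarrow> \<phi> x = \<phi> y \<Longrightarrow> x = y"
  using phi_inj by (simp add: inj_on_def)

lemma clopen_measure: "clopen U \<Longrightarrow> measure \<mu> U \<in> K"
  using measured elem[of U] phi_measure[of "elem U"] by (simp add: measured_ba_def)

lemma clopen_measure_pos:
  assumes "clopen U" "U \<noteq> {}"
  shows "measure \<mu> U > 0"
proof -
  have "elem U \<noteq> ba_bot B" using elem(2)[OF assms(1)] phi_hom(1) assms(2) by auto
  then show ?thesis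
    using measured elem[OF assms(1)] phi_measure[of "elem U"] by (simp add: measured_ba_def)
qed

lemma carrier_generated_single:
  assumes x: "x \<in> carrier B"
  shows "carrier (generated_sub B {x}) = {z \<in> carrier B. \<phi> z \<in> generated_by (\<phi> x)}" (is "_ = ?S")
proof -
  have "ba_closed B ?S"
    unfolding ba_closed_def
  proof (intro conjI ballI)
    show "ba_bot B \<in> ?S" "ba_top B \<in> ?S" using op_carrier by (simp_all add: phi_hom generated_by_def)
    fix z assume z: "z \<in> ?S"
    then have zc: "z \<in> carrier B" "\<phi> z \<in> generated_by (\<phi> x)" by simp_all
    show "ba_compl B z \<in> ?S"
      using op_carrier(5)[OF zc(1)] phi_hom(5)[OF zc(1)] generated_by_compl[OF zc(2)] by simp
    fix z' assume "z' \<in> ?S"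
    then have zc': "z' \<in> carrier B" "\<phi> z' \<in> generated_by (\<phi> x)" by simp_all
    show "ba_meet B z z' \<in> ?S"
      using op_carrier(3)[OF zc(1) zc'(1)] phi_hom(3)[OF zc(1) zc'(1)] generated_by_closed(1)[OF zc(2) zc'(2)] by simp
    show "ba_join B z z' \<in> ?S"
      using op_carrier(4)[OF zc(1) zc'(1)] phi_hom(4)[OF zc(1) zc'(1)] generated_by_closed(2)[OF zc(2) zc'(2)] by simp
  qed
  moreover have "{x} \<subseteq> ?S" "?S \<subseteq> carrier B" using x by (auto simp: generated_by_def)
  moreover have "?S \<subseteq> S" if S: "{x} \<subseteq> S" "S \<subseteq> carrier B" "ba_closed B S" for S
  proof
    fix z assume z: "z \<in> ?S"
    have mem: "ba_bot B \<in> S" "x \<in> S" "ba_compl B x \<in> S" "ba_top B \<in> S"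
      using S by (auto simp: ba_closed_def)
    have "z = ba_bot B \<or> z = x \<or> z = ba_compl B x \<or> z = ba_top B"
    proof -
      have zc: "z \<in> carrier B" using z by simp
      have "\<phi> z = {} \<or> \<phi> z = \<phi> x \<or> \<phi> z = - \<phi> x \<or> \<phi> z = UNIV"
        using z by (auto simp: generated_by_def)
      then have "\<phi> z = \<phi> (ba_bot B) \<or> \<phi> z = \<phi> x \<or> \<phi> z = \<phi> (ba_compl B x) \<or> \<phi> z = \<phi> (ba_top B)"
        using phi_hom(1,2) phi_hom(5)[OF x] by simp
      then show ?thesis using phi_eqI[OF zc] op_carrier(1,2) op_carrier(5)[OF x] x by blast
    qed
    then show "z \<in> S" using mem by blast
  qed
  ultimately have "\<Inter>{S. {x} \<subseteq> S \<and> S \<subseteq> carrier B \<and> ba_closed B S} = ?S" by blast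
  then show ?thesis by (simp add: generated_sub_def)
qed

lemma generated_sub_ops:
  "ba_meet (generated_sub B X) = ba_meet B" "ba_join (generated_sub B X) = ba_join B"
  "ba_compl (generated_sub B X) = ba_compl B" "ba_bot (generated_sub B X) = ba_bot B"
  "ba_top (generated_sub B X) = ba_top B" "ba_meas (generated_sub B X) = ba_meas B"
  by (simp_all add: generated_sub_def)

text \<open>The subalgebras generated by \<open>U\<close> and by \<open>V\<close> are isomorphic as measured algebras, so
  ultrahomogeneity extends the isomorphism to an automorphism.\<close>

lemma move_clopen:
  assumes U: "clopen U" and V: "clopen V" and eq: "measure \<mu> U = measure \<mu> V"
    and nontriv: "U \<noteq> {}" "U \<noteq> UNIV" "V \<noteq> {}" "V \<noteq> UNIV"
  shows "\<exists>h. mba_iso B B h \<and> h (elem U) = elem V"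
proof -
  let ?x = "elem U" and ?y = "elem V"
  note x = elem[OF U] and y = elem[OF V]
  define f where "f z = elem (transfer_set U V (\<phi> z))" for z
  let ?X = "generated_sub B {?x}" and ?Y = "generated_sub B {?y}"
  have cX: "carrier ?X = {z \<in> carrier B. \<phi> z \<in> generated_by U}" and cY: "carrier ?Y = {z \<in> carrier B. \<phi> z \<in> generated_by V}"
    using carrier_generated_single[OF x(1)] carrier_generated_single[OF y(1)] x(2) y(2) by simp_all
  have fourV: "clopen Z" if "Z \<in> generated_by V" for Z using that V by (auto simp: generated_by_def)
  have fourU: "clopen Z" if "Z \<in> generated_by U" for Z using that U by (auto simp: generated_by_def)
  have fz: "f z \<in> carrier B" "\<phi> (f z) = transfer_set U V (\<phi> z)" if "\<phi> z \<in> generated_by U" for z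
    using elem[OF fourV[OF transfer_set_hom(4)[OF nontriv(1,2) that that]]] by (simp_all add: f_def)
  have in4: "\<phi> (ba_meet B z z') \<in> generated_by U" "\<phi> (ba_join B z z') \<in> generated_by U" "\<phi> (ba_compl B z) \<in> generated_by U"
    if "z \<in> carrier ?X" "z' \<in> carrier ?X" for z z'
    using that generated_by_closed generated_by_compl by (auto simp: cX phi_hom)
  have "mba_iso ?X ?Y f"
    unfolding mba_iso_def mba_embedding_def ba_embedding_def generated_sub_ops
  proof (intro conjI ballI)
    show "f \<in> carrier ?X \<rightarrow> carrier ?Y"
      using fz transfer_set_hom(4)[OF nontriv(1,2)] by (auto simp: cX cY)
    show "inj_on f (carrier ?X)"
    proof (rule inj_onI)
      fix z z' assume z: "z \<in> carrier ?X" "z' \<in> carrier ?X" "f z = f z'"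
      then have z4: "\<phi> z \<in> generated_by U" "\<phi> z' \<in> generated_by U" "z \<in> carrier B" "z' \<in> carrier B" by (auto simp: cX)
      have "transfer_set U V (\<phi> z) = transfer_set U V (\<phi> z')" using fz(2) z(3) z4 by metis
      then have "\<phi> z = \<phi> z'" using transfer_set_inverse[OF nontriv] z4 by metis
      then show "z = z'" using phi_eqI z4 by blast
    qed
    show "f (ba_bot B) = ba_bot B"
      by (rule phi_eqI) (simp_all add: fz phi_hom generated_by_def op_carrier transfer_set_simps[OF nontriv(1,2)])
    show "f (ba_top B) = ba_top B"
      by (rule phi_eqI) (simp_all add: fz phi_hom generated_by_def op_carrier transfer_set_simps[OF nontriv(1,2)])
    show "f ` carrier ?X = carrier ?Y"
    proof
      show "f ` carrier ?X \<subseteq> carrier ?Y"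
        using fz transfer_set_hom(4)[OF nontriv(1,2)] by (auto simp: cX cY)
      show "carrier ?Y \<subseteq> f ` carrier ?X"
      proof
        fix z assume "z \<in> carrier ?Y"
        then have z: "z \<in> carrier B" "\<phi> z \<in> generated_by V" by (auto simp: cY)
        let ?Z = "transfer_set V U (\<phi> z)"
        have Z: "?Z \<in> generated_by U" using transfer_set_hom(4)[OF nontriv(3,4) z(2) z(2)] .
        note cZ = elem[OF fourU[OF Z]]
        have "f (elem ?Z) = z"
          using fz[of "elem ?Z"] cZ Z z transfer_set_inverse[OF nontriv(3,4,1,2) z(2)]
          by (intro phi_eqI) auto
        moreover have "elem ?Z \<in> carrier ?X" using cZ Z by (simp add: cX)
        ultimately show "z \<in> f ` carrier ?X" by (metis imageI)
      qed
    qed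
    fix z assume z: "z \<in> carrier ?X"
    then have z4: "\<phi> z \<in> generated_by U" "z \<in> carrier B" by (auto simp: cX)
    show "f (ba_compl B z) = ba_compl B (f z)"
      using z4 in4(3)[OF z z] fz
      by (intro phi_eqI) (simp_all add: op_carrier phi_hom transfer_set_hom(3)[OF nontriv(1,2) z4(1) z4(1)])
    have "measure \<mu> (transfer_set U V (\<phi> z)) = measure \<mu> (\<phi> z)"
    proof -
      have "measure \<mu> (- U) = 1 - measure \<mu> U" "measure \<mu> (- V) = 1 - measure \<mu> V"
        using prob_compl[OF clopen_events[OF U]] prob_compl[OF clopen_events[OF V]]
          sets_eq_imp_space_eq[OF sets_mu] by (simp_all add: Compl_eq_Diff_UNIV)
      moreover have "\<phi> z = {} \<or> \<phi> z = U \<or> \<phi> z = - U \<or> \<phi> z = UNIV"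
        using z4(1) by (auto simp: generated_by_def)
      ultimately show ?thesis using eq by (elim disjE) (simp_all only: transfer_set_simps[OF nontriv(1,2)])
    qed
    then show "ba_meas B (f z) = ba_meas B z"
      using fz[OF z4(1)] phi_measure z4(2) by metis
    fix z' assume z': "z' \<in> carrier ?X"
    then have z4': "\<phi> z' \<in> generated_by U" "z' \<in> carrier B" by (auto simp: cX)
    show "f (ba_meet B z z') = ba_meet B (f z) (f z')"
      using z4 z4' in4(1)[OF z z'] fz
      by (intro phi_eqI) (simp_all add: op_carrier phi_hom transfer_set_hom(1)[OF nontriv(1,2) z4(1) z4'(1)])
    show "f (ba_join B z z') = ba_join B (f z) (f z')"
      using z4 z4' in4(2)[OF z z'] fz
      by (intro phi_eqI) (simp_all add: op_carrier phi_hom transfer_set_hom(2)[OF nontriv(1,2) z4(1) z4'(1)])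
  qed
  then obtain h where h: "mba_iso B B h" "\<forall>z\<in>carrier ?X. h z = f z"
    using lim x(1) y(1) unfolding fraisse_limit_def
    by (metis empty_subsetI finite.emptyI finite.insertI insert_subset)
  have "?x \<in> carrier ?X" using x by (simp add: cX generated_by_def)
  then have "h ?x = elem (transfer_set U V U)" using h(2) x(2) by (simp add: f_def)
  then show ?thesis using h(1) transfer_set_simps(3)[OF nontriv(1,2)] by metis
qed

text \<open>Embed the algebra whose atoms have weights \<open>r\<close>, \<open>u - r\<close> and \<open>1 - u\<close>. Weights must be strictly
  positive, so the third atom is left out when \<open>u = 1\<close>.\<close>

lemma clopen_pair:
  assumes r: "r \<in> K" "0 < r" "r < u" and u: "u \<in> K" "u \<le> 1"
  shows "\<exists>A W. clopen A \<and> clopen W \<and> A \<subseteq> W \<and> measure \<mu> A = r \<and> measure \<mu> W = u"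
proof -
  define n :: nat where "n = (if u < 1 then 3 else 2)"
  define w where "w i = (if i = 0 then r else if i = 1 then u - r else 1 - u)" for i :: nat
  have diff: "x - y \<in> K" if "x \<in> K" "y \<in> K" for x y
  proof -
    have "x + - y \<in> K" using that K unfolding real_subfield_def by blast
    then show ?thesis by simp
  qed
  have one: "1 \<in> K" using K by (simp add: real_subfield_def)
  let ?A = "weight_algebra n w"
  have "finite_measured_ba K ?A"
  proof (rule finite_measured_weight_algebra[OF K])
    show "w i \<in> K" if "i < n" for i using diff one r u by (simp add: w_def)
    show "w i > 0" if "i < n" for i
      using that r by (auto simp: w_def n_def split: if_splits)
    show "(\<Sum>i<n. w i) = 1"
      using u by (auto simp: n_def w_def numeral_3_eq_3 numeral_2_eq_2)
  qed
  then obtain f where f: "mba_embedding ?A B f" using lim unfolding fraisse_limit_def by blast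
  have n2: "2 \<le> n" by (simp add: n_def)
  define a v where "a = set_encode {0}" and "v = set_encode {0, 1 :: nat}"
  have s: "{0} \<subseteq> {..<n}" "{0, 1} \<subseteq> {..<n}" using n2 by auto
  have mem: "a \<in> carrier ?A" "v \<in> carrier ?A"
    unfolding a_def v_def by (rule weight_algebra_ops(1)[OF s(1,1)], rule weight_algebra_ops(1)[OF s(2,2)])
  have "ba_meet ?A a v = set_encode ({0} \<inter> {0, 1})"
    unfolding a_def v_def by (rule weight_algebra_ops(2)[OF s])
  also have "{0} \<inter> {0, 1} = {0 :: nat}" by simp
  finally have meet: "ba_meet ?A a v = a" unfolding a_def .
  have meas: "ba_meas ?A a = r" "ba_meas ?A v = u"
    unfolding a_def v_def weight_algebra_ops(7)[OF s(1,1)] weight_algebra_ops(7)[OF s(2,2)]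
    by (simp_all add: w_def)
  have fc: "f a \<in> carrier B" "f v \<in> carrier B"
    using f mem unfolding mba_embedding_def ba_embedding_def by auto
  have "ba_meet B (f a) (f v) = f a"
    using f mem meet unfolding mba_embedding_def ba_embedding_def by metis
  then have "\<phi> (f a) = \<phi> (f a) \<inter> \<phi> (f v)" using phi_hom(3)[OF fc] by simp
  then have "\<phi> (f a) \<subseteq> \<phi> (f v)" by (rule inf.orderI)
  moreover have "measure \<mu> (\<phi> (f a)) = r" "measure \<mu> (\<phi> (f v)) = u"
    using phi_measure[OF fc(1)] phi_measure[OF fc(2)] f mem meas
    unfolding mba_embedding_def by simp_all
  ultimately show ?thesis using phi_clopen[OF fc(1)] phi_clopen[OF fc(2)] by blast
qed

lemma full_clopen: "clopen U \<Longrightarrow> measure \<mu> U = 1 \<Longrightarrow> U = UNIV"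
proof (rule ccontr)
  assume U: "clopen U" "measure \<mu> U = 1" "U \<noteq> UNIV"
  then have "measure \<mu> (- U) > 0" by (intro clopen_measure_pos) auto
  moreover have "measure \<mu> (- U) = 1 - measure \<mu> U"
    using prob_compl[OF clopen_events[OF U(1)]] sets_eq_imp_space_eq[OF sets_mu]
    by (simp add: Compl_eq_Diff_UNIV)
  ultimately show False using U(2) by simp
qed

text \<open>The age supplies sets \<open>A \<subseteq> W\<close> of the required measures somewhere in the space, and
  ultrahomogeneity moves \<open>W\<close> onto \<open>Q\<close>.\<close>

lemma clopen_part:
  assumes Q: "clopen Q" and r: "r \<in> K" "0 < r" "r < measure \<mu> Q"
  shows "\<exists>Q'. clopen Q' \<and> Q' \<subseteq> Q \<and> measure \<mu> Q' = r"
proof -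
  obtain A W where AW: "clopen A" "clopen W" "A \<subseteq> W" "measure \<mu> A = r" "measure \<mu> W = measure \<mu> Q"
    using clopen_pair[OF r clopen_measure[OF Q] prob_le_1] by blast
  show ?thesis
  proof (cases "measure \<mu> Q = 1")
    case True
    then have "Q = UNIV" using full_clopen[OF Q] by blast
    then show ?thesis using AW by blast
  next
    case False
    have space: "measure \<mu> UNIV = 1" using prob_space sets_eq_imp_space_eq[OF sets_mu] by simp
    have nontriv: "W \<noteq> {}" "W \<noteq> UNIV" "Q \<noteq> {}" "Q \<noteq> UNIV"
      using False AW(5) r space by auto
    obtain h where h: "mba_iso B B h" "h (elem W) = elem Q"
      using move_clopen[OF AW(2) Q AW(5) nontriv] by blast
    note a = elem[OF AW(1)] and w = elem[OF AW(2)] and q = elem[OF Q]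
    have hc: "h (elem A) \<in> carrier B"
      using h(1) a(1) unfolding mba_iso_def mba_embedding_def ba_embedding_def by auto
    have "ba_meet B (elem A) (elem W) = elem A"
      using AW(3) a w by (intro phi_eqI) (auto simp: op_carrier phi_hom)
    then have "ba_meet B (h (elem A)) (elem Q) = h (elem A)"
      using h a(1) w(1) unfolding mba_iso_def mba_embedding_def ba_embedding_def by metis
    then have "\<phi> (h (elem A)) \<inter> Q = \<phi> (h (elem A))" using phi_hom(3)[OF hc q(1)] q(2) by simp
    then have "\<phi> (h (elem A)) \<subseteq> Q" by (rule inf.orderI[OF sym])
    moreover have "measure \<mu> (\<phi> (h (elem A))) = r"
      using phi_measure[OF hc] phi_measure[OF a(1)] a h(1) AW(4)
      unfolding mba_iso_def mba_embedding_def by simp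
    ultimately show ?thesis using phi_clopen[OF hc] by blast
  qed
qed

sublocale ratio_measure \<mu>
proof
  show "sets \<mu> = sets borel" by (rule sets_mu)
  show "measure \<mu> U > 0" if "clopen U" "U \<noteq> {}" for U using clopen_measure_pos that .
  fix P P' Q :: "cantor set"
  assume P: "clopen P" "clopen P'" "P' \<subset> P" "P' \<noteq> {}" and Q: "clopen Q" "Q \<noteq> {}"
  have "clopen (P - P')" "P - P' \<noteq> {}" using P by (auto intro: open_Diff closed_Diff)
  then have "measure \<mu> (P - P') > 0" by (rule clopen_measure_pos)
  moreover have "measure \<mu> (P - P') = measure \<mu> P - measure \<mu> P'"
    using P by (intro finite_measure_Diff) (auto simp: clopen_events)
  ultimately have less: "measure \<mu> P' < measure \<mu> P" by simp
  have pos: "measure \<mu> P' > 0" "measure \<mu> P > 0" "measure \<mu> Q > 0"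
    using clopen_measure_pos P Q less by auto
  let ?r = "measure \<mu> P' * measure \<mu> Q / measure \<mu> P"
  have "inverse (measure \<mu> P) \<in> K"
    using K clopen_measure[OF P(1)] pos by (auto simp: real_subfield_def)
  then have "measure \<mu> P' * measure \<mu> Q * inverse (measure \<mu> P) \<in> K"
    using K clopen_measure[OF P(2)] clopen_measure[OF Q(1)] by (simp add: real_subfield_def)
  then have rK: "?r \<in> K" by (simp add: divide_inverse)
  have r: "0 < ?r" "?r < measure \<mu> Q" using pos less by (simp_all add: field_simps)
  obtain Q' where Q': "clopen Q'" "Q' \<subseteq> Q" "measure \<mu> Q' = ?r" using clopen_part[OF Q(1) rK r] by blast
  moreover have "measure \<mu> Q' * measure \<mu> P = measure \<mu> P' * measure \<mu> Q" using Q'(3) pos by simp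
  ultimately show "\<exists>Q'. clopen Q' \<and> Q' \<subseteq> Q \<and> measure \<mu> Q' * measure \<mu> P = measure \<mu> P' * measure \<mu> Q"
    by blast
qed

end

theorem theorem5:
  fixes K :: "real set"
    and B :: "'b mba"
    and \<phi> :: "'b \<Rightarrow> cantor set"
    and \<mu> :: "cantor measure"
  assumes "real_subfield K" and "countable K"
    and "fraisse_limit K B"
    and "borel_extension B \<phi> \<mu>"
  shows "roelcke_precompact (H_bac_group \<mu>) (tau_ac \<mu>)"
proof -
  interpret fraisse_clopen K B \<phi> \<mu>
    using assms(1,3,4) by unfold_locales
  show ?thesis by (rule roelcke_precompact_H)
qed

end
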